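(* Let $\mathbf Y$ be a collection of metric graphs with projections $\{\pi_Y\}$ and constant $\theta$ as in the context, let $K\ge4\theta$, and let $\mathcal C_K(\mathbf Y)$ be the associated quasi-tree of metric spaces. Then: (1) If, for some $C$, each $Y\in\mathbf Y$ is $(C,C)$-quasi-isometric to a tree, then $\mathcal C_K(\mathbf Y)$ is a quasi-tree. (2) If, for some $\delta$, each $Y\in\mathbf Y$ is $\delta$-hyperbolic, then $\mathcal C_K(\mathbf Y)$ is hyperbolic. (3) $\mathcal C_K(\mathbf Y)$ is hyperbolic relative to (the family of copies in $\mathcal C_K(\mathbf Y)$ of the elements of) $\mathbf Y$, i.e. it is asymptotically tree-graded with respect to this family.
   Context: Setting. $\mathbf Y=\{(Y,\rho_Y)\}$ is a collection of connected graphs, each with its path metric with edges of length one. For all $X\ne Y$ in $\mathbf Y$ there is a nonempty set of vertices $\pi_Y(X)\subseteq Y$, and $d_Y(X,Z)=\operatorname{diam}(\pi_Y(X)\cup\pi_Y(Z))$ for $X,Z\in\mathbf Y\setminus\{Y\}$. There is an integer $\theta\ge0$ such that: - $d_Y(X,X)\le\theta$ for $X\neq Y$; - (P1') for pairwise distinct $X,Y,Z$: if $d_Y(X,Z)>\theta$ then $\pi_X(Y)=\pi_X(Z)$; - for all $X,Z\in\mathbf Y$ the set $\{Y\in\mathbf Y\setminus\{X,Z\}:d_Y(X,Z)>\theta\}$ is finite. (Consequently $d_Y$ is symmetric, satisfies the triangle inequality, and if $d_Y(X,Z)>\theta$ then $d_Z(X,W)=d_Z(Y,W)$ for all $W\ne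 Z$.) $K>0$ is an integer. $\mathcal P_K(\mathbf Y)$ is the graph with vertex set $\mathbf Y$ with distinct $X,Z$ adjacent iff $d_Y(X,Z)\le K$ for all $Y\in\mathbf Y\setminus\{X,Z\}$. The quasi-tree of metric spaces $\mathcal C_K(\mathbf Y)$ is obtained from the disjoint union of the graphs in $\mathbf Y$ by adding, for each pair $X,Y$ adjacent in $\mathcal P_K(\mathbf Y)$, an edge of length $K$ connecting every point of $\pi_Y(X)$ to every point of $\pi_X(Y)$; it carries the induced path metric. A quasi-tree is a geodesic metric space quasi-isometric to a tree. A geodesic metric space $T$ is tree-graded with respect to a collection $\mathcal Q$ of geodesic subspaces (pieces) if distinct elements of $\mathcal Q$ intersect in at most one point and every simple loop in $T$ is contained in some element of $\mathcal Q$. A metric space $M$ is asymptotically tree-graded (Drutu-Sapir) with respect to a family $\mathcal A$ of subsets if every asymptotic cone of $M$ (for any non-principal ultrafilter $\omega$, any scaling sequence tending to infinity and any base points) is tree-graded with respect to the collection of nonempty $\omega$-limits $\lim_\omega A_n$ of sequences of elements $A_n\in\mathcal A$, where limits of two sequences that are not $\omega$-almost surely equal are regarded as different members of the collection. *)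

theory Defs
  imports "HOL-Analysis.Analysis"
begin

section \<open>Geodesic spaces, quasi-isometries, hyperbolicity\<close>

text \<open>Metric spaces are given by a carrier and a distance, as in \<^locale>\<open>Metric_space\<close>.\<close>

definition geodesic_segment :: "'a set \<Rightarrow> ('a \<Rightarrow> 'a \<Rightarrow> real) \<Rightarrow> (real \<Rightarrow> 'a) \<Rightarrow> 'a \<Rightarrow> 'a \<Rightarrow> bool" where
  "geodesic_segment M d g x y \<longleftrightarrow>
     g ` {0..d x y} \<subseteq> M \<and> g 0 = x \<and> g (d x y) = y \<and>
     (\<forall>s\<in>{0..d x y}. \<forall>t\<in>{0..d x y}. d (g s) (g t) = \<bar>s - t\<bar>)"

definition geodesic_space :: "'a set \<Rightarrow> ('a \<Rightarrow> 'a \<Rightarrow> real) \<Rightarrow> bool" where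
  "geodesic_space M d \<longleftrightarrow>
     Metric_space M d \<and> (\<forall>x\<in>M. \<forall>y\<in>M. \<exists>g. geodesic_segment M d g x y)"

definition quasi_isometry ::
  "real \<Rightarrow> real \<Rightarrow> 'a set \<Rightarrow> ('a \<Rightarrow> 'a \<Rightarrow> real) \<Rightarrow> 'b set \<Rightarrow> ('b \<Rightarrow> 'b \<Rightarrow> real) \<Rightarrow> ('a \<Rightarrow> 'b) \<Rightarrow> bool" where
  "quasi_isometry L A M d N d' f \<longleftrightarrow>
     L \<ge> 1 \<and> A \<ge> 0 \<and> f \<in> M \<rightarrow> N \<and>
     (\<forall>x\<in>M. \<forall>y\<in>M. d x y / L - A \<le> d' (f x) (f y) \<and> d' (f x) (f y) \<le> L * d x y + A) \<and>
     (\<forall>z\<in>N. \<exists>x\<in>M. d' (f x) z \<le> A)"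

text \<open>Hyperbolicity is meant in the sense of slim geodesic triangles.\<close>

definition delta_hyperbolic :: "real \<Rightarrow> 'a set \<Rightarrow> ('a \<Rightarrow> 'a \<Rightarrow> real) \<Rightarrow> bool" where
  "delta_hyperbolic \<delta> M d \<longleftrightarrow>
     \<delta> \<ge> 0 \<and> geodesic_space M d \<and>
     (\<forall>x\<in>M. \<forall>y\<in>M. \<forall>z\<in>M. \<forall>f g h.
        geodesic_segment M d f x y \<and> geodesic_segment M d g y z \<and> geodesic_segment M d h x z \<longrightarrow>
        (\<forall>p \<in> f ` {0..d x y}. \<exists>q \<in> g ` {0..d y z} \<union> h ` {0..d x z}. d p q \<le> \<delta>))"

definition hyperbolic :: "'a set \<Rightarrow> ('a \<Rightarrow> 'a \<Rightarrow> real) \<Rightarrow> bool" where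
  "hyperbolic M d \<longleftrightarrow> (\<exists>\<delta>. delta_hyperbolic \<delta> M d)"

text \<open>The diameter of a set, which is allowed to be infinite.\<close>

definition ediam :: "('a \<Rightarrow> 'a \<Rightarrow> real) \<Rightarrow> 'a set \<Rightarrow> ereal" where
  "ediam d S = (SUP (x, y) \<in> S \<times> S. ereal (d x y))"


section \<open>Metric graphs\<close>

text \<open>
  Undirected graphs, possibly with loops and multiple edges, whose edges have a length.
  The choice of a tail and a head of each edge only serves to parametrise the edge.
\<close>

record ('v, 'e) mgraph =
  mverts :: "'v set"
  medges :: "'e set"
  mtail  :: "'e \<Rightarrow> 'v"
  mhead  :: "'e \<Rightarrow> 'v"
  mlen   :: "'e \<Rightarrow> real"

definition wf_mgraph :: "('v, 'e) mgraph \<Rightarrow> bool" where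
  "wf_mgraph G \<longleftrightarrow>
     (\<forall>e\<in>medges G. mtail G e \<in> mverts G \<and> mhead G e \<in> mverts G \<and> mlen G e > 0)"

definition unit_mgraph :: "('v, 'e) mgraph \<Rightarrow> bool" where
  "unit_mgraph G \<longleftrightarrow> (\<forall>e\<in>medges G. mlen G e = 1)"

definition connected_mgraph :: "('v, 'e) mgraph \<Rightarrow> bool" where
  "connected_mgraph G \<longleftrightarrow>
     (\<forall>u\<in>mverts G. \<forall>v\<in>mverts G.
        (u, v) \<in> (\<Union>e\<in>medges G. {(mtail G e, mhead G e), (mhead G e, mtail G e)})\<^sup>*)"

text \<open>Cycles of length 1 (loops) and 2 (double edges) are included.\<close>

definition is_cycle :: "('v, 'e) mgraph \<Rightarrow> 'v list \<Rightarrow> 'e list \<Rightarrow> bool" where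
  "is_cycle G vs es \<longleftrightarrow>
     es \<noteq> [] \<and> length vs = length es \<and> distinct vs \<and> distinct es \<and> set es \<subseteq> medges G \<and>
     (\<forall>i < length es. {mtail G (es ! i), mhead G (es ! i)} = {vs ! i, vs ! (Suc i mod length es)})"

definition tree_mgraph :: "('v, 'e) mgraph \<Rightarrow> bool" where
  "tree_mgraph T \<longleftrightarrow>
     wf_mgraph T \<and> unit_mgraph T \<and> connected_mgraph T \<and> \<not> (\<exists>vs es. is_cycle T vs es)"

text \<open>
  Points of the geometric realisation: vertices, and interior points of edges. The point
  \<open>Inner e t\<close> is the one at distance \<open>t\<close> from the tail along the edge \<open>e\<close>.
\<close>

datatype ('v, 'e) gpoint = Vert 'v | Inner 'e real

definition gpoints :: "('v, 'e) mgraph \<Rightarrow> ('v, 'e) gpoint set" where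
  "gpoints G = Vert ` mverts G \<union> {Inner e t | e t. e \<in> medges G \<and> 0 < t \<and> t < mlen G e}"

definition edge_point :: "('v, 'e) mgraph \<Rightarrow> 'e \<Rightarrow> real \<Rightarrow> ('v, 'e) gpoint" where
  "edge_point G e t =
     (if t = 0 then Vert (mtail G e) else if t = mlen G e then Vert (mhead G e) else Inner e t)"

text \<open>
  \<open>pl_path G p r q\<close>: there is a path of length \<open>r\<close> from \<open>p\<close> to \<open>q\<close> that is a finite
  concatenation of linear segments, each contained in a closed edge.
\<close>

inductive pl_path :: "('v, 'e) mgraph \<Rightarrow> ('v, 'e) gpoint \<Rightarrow> real \<Rightarrow> ('v, 'e) gpoint \<Rightarrow> bool"
  for G :: "('v, 'e) mgraph" where
  refl: "p \<in> gpoints G \<Longrightarrow> pl_path G p 0 p"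
| step: "pl_path G p r (edge_point G e s) \<Longrightarrow> e \<in> medges G \<Longrightarrow>
         s \<in> {0..mlen G e} \<Longrightarrow> t \<in> {0..mlen G e} \<Longrightarrow>
         pl_path G p (r + \<bar>s - t\<bar>) (edge_point G e t)"

text \<open>
  The path metric. The value 0 for pairs not joined by a path is a dummy:
  \<^locale>\<open>Metric_space\<close> asks for non-negativity outside the carrier as well. In a graph that is
  not connected it makes distinct points have distance 0, so this is then not a metric.
\<close>

definition gdist :: "('v, 'e) mgraph \<Rightarrow> ('v, 'e) gpoint \<Rightarrow> ('v, 'e) gpoint \<Rightarrow> real" where
  "gdist G p q = (if \<exists>r. pl_path G p r q then Inf {r. pl_path G p r q} else 0)"

text \<open>
  HOL cannot quantify over types inside a formula, so a type for the vertices of the tree has to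
  be fixed. This is no restriction: if \<open>f\<close> is a quasi-isometry from \<open>M\<close> to a tree, then
  the hull of the vertices near \<open>f ` M\<close> has at most \<open>max |M| \<aleph>\<^sub>0\<close> vertices, which fits into the
  type \<open>'a set\<close> if \<open>'a\<close> is infinite; and if \<open>'a\<close> is finite, \<open>M\<close> is quasi-isometric to the tree
  with one vertex (or none, if \<open>M\<close> is empty).
\<close>

definition quasi_tree :: "'a set \<Rightarrow> ('a \<Rightarrow> 'a \<Rightarrow> real) \<Rightarrow> bool" where
  "quasi_tree M d \<longleftrightarrow>
     geodesic_space M d \<and>
     (\<exists>(T :: ('a set, 'a set \<times> 'a set) mgraph) L A f.
        tree_mgraph T \<and> quasi_isometry L A M d (gpoints T) (gdist T) f)"


section \<open>Tree-graded spaces\<close>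

definition simple_loop :: "'a set \<Rightarrow> ('a \<Rightarrow> 'a \<Rightarrow> real) \<Rightarrow> (real \<Rightarrow> 'a) \<Rightarrow> bool" where
  "simple_loop M d g \<longleftrightarrow>
     pathin (Metric_space.mtopology M d) g \<and> g 0 = g 1 \<and> inj_on g {0..<1}"

text \<open>The collection of pieces is indexed; pieces with different indices count as different.\<close>

definition tree_graded :: "'a set \<Rightarrow> ('a \<Rightarrow> 'a \<Rightarrow> real) \<Rightarrow> 'j set \<Rightarrow> ('j \<Rightarrow> 'a set) \<Rightarrow> bool" where
  "tree_graded M d J Q \<longleftrightarrow>
     geodesic_space M d \<and>
     (\<forall>j\<in>J. Q j \<subseteq> M \<and> geodesic_space (Q j) d) \<and>
     (\<forall>i\<in>J. \<forall>j\<in>J. i \<noteq> j \<longrightarrow> (\<forall>x \<in> Q i \<inter> Q j. \<forall>y \<in> Q i \<inter> Q j. x = y)) \<and>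
     (\<forall>g. simple_loop M d g \<longrightarrow> (\<exists>j\<in>J. g ` {0..1} \<subseteq> Q j))"


section \<open>Asymptotic cones\<close>

definition nonprincipal_ultrafilter :: "nat filter \<Rightarrow> bool" where
  "nonprincipal_ultrafilter \<omega> \<longleftrightarrow>
     \<omega> \<noteq> bot \<and> \<omega> \<le> cofinite \<and> (\<forall>P. eventually P \<omega> \<or> eventually (\<lambda>n. \<not> P n) \<omega>)"

text \<open>
  \<open>b\<close> is the sequence of base points and \<open>s\<close> the scaling sequence, so the cone is the ultralimit
  of the spaces \<open>(M, d / s n, b n)\<close>.
\<close>

definition cone_seqs ::
  "'a set \<Rightarrow> ('a \<Rightarrow> 'a \<Rightarrow> real) \<Rightarrow> nat filter \<Rightarrow> (nat \<Rightarrow> real) \<Rightarrow> (nat \<Rightarrow> 'a) \<Rightarrow> (nat \<Rightarrow> 'a) set" where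
  "cone_seqs M d \<omega> s b =
     {x. (\<forall>n. x n \<in> M) \<and> (\<exists>B. eventually (\<lambda>n. d (x n) (b n) / s n \<le> B) \<omega>)}"

definition cone_rel ::
  "'a set \<Rightarrow> ('a \<Rightarrow> 'a \<Rightarrow> real) \<Rightarrow> nat filter \<Rightarrow> (nat \<Rightarrow> real) \<Rightarrow> (nat \<Rightarrow> 'a) \<Rightarrow> (nat \<Rightarrow> 'a) rel" where
  "cone_rel M d \<omega> s b =
     {(x, y). x \<in> cone_seqs M d \<omega> s b \<and> y \<in> cone_seqs M d \<omega> s b \<and>
              ((\<lambda>n. d (x n) (y n) / s n) \<longlongrightarrow> 0) \<omega>}"

definition cone ::
  "'a set \<Rightarrow> ('a \<Rightarrow> 'a \<Rightarrow> real) \<Rightarrow> nat filter \<Rightarrow> (nat \<Rightarrow> real) \<Rightarrow> (nat \<Rightarrow> 'a) \<Rightarrow> (nat \<Rightarrow> 'a) set set" where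
  "cone M d \<omega> s b = cone_seqs M d \<omega> s b // cone_rel M d \<omega> s b"

definition cone_dist ::
  "'a set \<Rightarrow> ('a \<Rightarrow> 'a \<Rightarrow> real) \<Rightarrow> nat filter \<Rightarrow> (nat \<Rightarrow> real) \<Rightarrow> (nat \<Rightarrow> 'a) \<Rightarrow>
   (nat \<Rightarrow> 'a) set \<Rightarrow> (nat \<Rightarrow> 'a) set \<Rightarrow> real" where
  "cone_dist M d \<omega> s b p q =
     (if p \<in> cone M d \<omega> s b \<and> q \<in> cone M d \<omega> s b
      then THE l. \<exists>x\<in>p. \<exists>y\<in>q. ((\<lambda>n. d (x n) (y n) / s n) \<longlongrightarrow> l) \<omega>
      else 0)"

text \<open>Sequences of elements of \<open>\<A>\<close>, up to \<open>\<omega>\<close>-almost sure equality.\<close>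

definition ultrapower :: "nat filter \<Rightarrow> 'b set \<Rightarrow> (nat \<Rightarrow> 'b) set set" where
  "ultrapower \<omega> \<A> =
     {A. \<forall>n. A n \<in> \<A>} //
     {(A, B). (\<forall>n. A n \<in> \<A>) \<and> (\<forall>n. B n \<in> \<A>) \<and> eventually (\<lambda>n. A n = B n) \<omega>}"

definition limit_set ::
  "'a set \<Rightarrow> ('a \<Rightarrow> 'a \<Rightarrow> real) \<Rightarrow> nat filter \<Rightarrow> (nat \<Rightarrow> real) \<Rightarrow> (nat \<Rightarrow> 'a) \<Rightarrow>
   (nat \<Rightarrow> 'a set) set \<Rightarrow> (nat \<Rightarrow> 'a) set set" where
  "limit_set M d \<omega> s b c =
     {p \<in> cone M d \<omega> s b. \<exists>x\<in>p. \<exists>A\<in>c. eventually (\<lambda>n. x n \<in> A n) \<omega>}"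

text \<open>As in Drutu--Sapir, scaling sequences tend to infinity along the ultrafilter.\<close>

definition asymptotically_tree_graded ::
  "'a set \<Rightarrow> ('a \<Rightarrow> 'a \<Rightarrow> real) \<Rightarrow> 'a set set \<Rightarrow> bool" where
  "asymptotically_tree_graded M d \<A> \<longleftrightarrow>
     Metric_space M d \<and> (\<forall>A\<in>\<A>. A \<subseteq> M) \<and>
     (\<forall>\<omega> s b. nonprincipal_ultrafilter \<omega> \<and> filterlim s at_top \<omega> \<and> (\<forall>n. b n \<in> M) \<longrightarrow>
        tree_graded (cone M d \<omega> s b) (cone_dist M d \<omega> s b)
          {c \<in> ultrapower \<omega> \<A>. limit_set M d \<omega> s b c \<noteq> {}} (limit_set M d \<omega> s b))"


section \<open>The quasi-tree of metric spaces\<close>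

text \<open>
  The collection of graphs is \<open>G X\<close> for \<open>X \<in> I\<close>, and \<open>\<pi> Y X\<close> is the set of vertices
  of \<open>G Y\<close> onto which \<open>X\<close> is projected.
\<close>

definition proj_dist ::
  "('i \<Rightarrow> ('v, 'e) mgraph) \<Rightarrow> ('i \<Rightarrow> 'i \<Rightarrow> 'v set) \<Rightarrow> 'i \<Rightarrow> 'i \<Rightarrow> 'i \<Rightarrow> ereal" where
  "proj_dist G \<pi> Y X Z = ediam (gdist (G Y)) (Vert ` (\<pi> Y X \<union> \<pi> Y Z))"

text \<open>Adjacency in the projection complex.\<close>

definition proj_adjacent ::
  "'i set \<Rightarrow> ('i \<Rightarrow> ('v, 'e) mgraph) \<Rightarrow> ('i \<Rightarrow> 'i \<Rightarrow> 'v set) \<Rightarrow> nat \<Rightarrow> 'i \<Rightarrow> 'i \<Rightarrow> bool" where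
  "proj_adjacent I G \<pi> K X Z \<longleftrightarrow>
     X \<in> I \<and> Z \<in> I \<and> X \<noteq> Z \<and> (\<forall>Y \<in> I - {X, Z}. proj_dist G \<pi> Y X Z \<le> ereal (real K))"

text \<open>
  The edges of the graphs \<open>G X\<close> are tagged with \<open>Inl\<close>. An added edge is \<open>Inr\<close> of the set of its
  two endpoints, so that there is only one such edge between two given vertices; its orientation
  is chosen arbitrarily.
\<close>

definition quasi_tree_of_spaces ::
  "'i set \<Rightarrow> ('i \<Rightarrow> ('v, 'e) mgraph) \<Rightarrow> ('i \<Rightarrow> 'i \<Rightarrow> 'v set) \<Rightarrow> nat \<Rightarrow>
   ('i \<times> 'v, 'i \<times> 'e + ('i \<times> 'v) set) mgraph" where
  "quasi_tree_of_spaces I G \<pi> K =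
     \<lparr> mverts = (SIGMA X:I. mverts (G X)),
       medges = Inl ` (SIGMA X:I. medges (G X)) \<union>
                Inr ` {{(Y, y), (X, x)} | X Y x y.
                         proj_adjacent I G \<pi> K X Y \<and> y \<in> \<pi> Y X \<and> x \<in> \<pi> X Y},
       mtail = case_sum (\<lambda>(X, e). (X, mtail (G X) e)) (\<lambda>S. fst (SOME p. S = {fst p, snd p})),
       mhead = case_sum (\<lambda>(X, e). (X, mhead (G X) e)) (\<lambda>S. snd (SOME p. S = {fst p, snd p})),
       mlen  = case_sum (\<lambda>(X, e). mlen (G X) e) (\<lambda>_. real K) \<rparr>"

text \<open>The copy of \<open>G X\<close> in the quasi-tree of metric spaces.\<close>

definition space_copy ::
  "('i \<Rightarrow> ('v, 'e) mgraph) \<Rightarrow> 'i \<Rightarrow> ('i \<times> 'v, 'i \<times> 'e + ('i \<times> 'v) set) gpoint set" where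
  "space_copy G X = map_gpoint (Pair X) (\<lambda>e. Inl (X, e)) ` gpoints (G X)"

end

theory Submission
  imports Defs
begin

text \<open>
  Project the quasi-tree of metric spaces to the copy of \<open>Y\<close> by sending \<open>X\<close> to a point of
  \<open>\<pi> Y X\<close>. This is 1-Lipschitz on vertices, so the copies are isometrically embedded. If an
  added edge between \<open>X\<close> and \<open>Z\<close> changes the projection to \<open>Y\<close>, then (P1') forces the edge to lie
  within \<open>4 * K\<close> of both projections. Hence a path along which the projection to \<open>Y\<close> changes
  passes near its value at either end, and every geodesic is a chain of pieces whose ends are
  projections through which all paths between the same points must nearly pass.

  All three claims follow from this. A geodesic triangle is thin because each point on a side
  lies near a geodesic triangle in a single piece. A bottleneck in a piece is a bottleneck of the
  whole space, and a geodesic space with bottlenecks is quasi-isometric to the tree of its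
  branches seen from a base point (Manning). In an asymptotic cone the limits of the projections are
  cut points, which a simple loop can avoid only by staying in the limit of one sequence of pieces.
\<close>


section \<open>Path metrics of graphs\<close>

text \<open>Everything about the quasi-tree of metric spaces enters through one interface, the
  locale \<open>guided\<close>; each conclusion is derived from it without further use of graphs.
  Projections jump instead of moving continuously, so arguments by continuity become statements
  about a single step of a coarse path: at a step that changes the projection to a piece,
  \<open>pr_jump\<close> places the path near that projection.

  The graphs may have infinite valence. Distances are attained nevertheless, because edge lengths
  are integers and an inner point has only two ways out of its edge.

  (P1') acts as a rewriting rule: if W separates X from Z, then W and Z have the same projection to
  X, and W and X the same projection to Z. Since only finitely many pieces separate X from Z, this
  allows inductions on their number, in which a separator replaces one of the two ends. The added
  edges only join vertices, so projections are first studied on vertices; interior points are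
  handled by moving them to an end of their edge, which accounts for the growth of the constants
  from 4 * K to 7 * K.\<close>

inductive walk :: "('v, 'e) mgraph \<Rightarrow> 'v \<Rightarrow> real \<Rightarrow> 'v \<Rightarrow> bool"
  for G :: "('v, 'e) mgraph" where
  walk_refl: "u \<in> mverts G \<Longrightarrow> walk G u 0 u"
| walk_fwd: "walk G u r (mtail G e) \<Longrightarrow> e \<in> medges G \<Longrightarrow> walk G u (r + mlen G e) (mhead G e)"
| walk_bwd: "walk G u r (mhead G e) \<Longrightarrow> e \<in> medges G \<Longrightarrow> walk G u (r + mlen G e) (mtail G e)"

text \<open>The ways out of a point: the vertices that a path can reach first, with the length spent
  on the edge until then. A vertex is its own exit at length 0, so that inner points and vertices
  are treated alike.\<close>

fun gends :: "('v, 'e) mgraph \<Rightarrow> ('v, 'e) gpoint \<Rightarrow> ('v \<times> real) set" where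
  "gends G (Vert v) = {(v, 0)}"
| "gends G (Inner e s) = {(mtail G e, s), (mhead G e, mlen G e - s)}"

text \<open>Lengths of the shortcuts to which every piecewise linear path can be tightened. Below a
  given bound there are only finitely many, so that distances are attained.\<close>

definition shortcut :: "('v, 'e) mgraph \<Rightarrow> ('v, 'e) gpoint \<Rightarrow> ('v, 'e) gpoint \<Rightarrow> real \<Rightarrow> bool" where
  "shortcut G p q c \<longleftrightarrow>
     (\<exists>a \<alpha> b \<beta> n. (a, \<alpha>) \<in> gends G p \<and> (b, \<beta>) \<in> gends G q \<and> walk G a n b \<and> c = \<alpha> + n + \<beta>) \<or>
     (\<exists>e s t. p = Inner e s \<and> q = Inner e t \<and> c = \<bar>s - t\<bar>)"

locale length_graph =
  fixes G :: "('v, 'e) mgraph"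
  assumes wf: "wf_mgraph G"
    and conn: "connected_mgraph G"
    and len_Nats: "e \<in> medges G \<Longrightarrow> mlen G e \<in> \<nat>"
begin

lemma len_pos: "e \<in> medges G \<Longrightarrow> mlen G e > 0"
  and tail_in: "e \<in> medges G \<Longrightarrow> mtail G e \<in> mverts G"
  and head_in: "e \<in> medges G \<Longrightarrow> mhead G e \<in> mverts G"
  using wf by (auto simp: wf_mgraph_def)

lemma Vert_in [simp]: "Vert v \<in> gpoints G \<longleftrightarrow> v \<in> mverts G"
  by (auto simp: gpoints_def)

lemma Inner_in [simp]: "Inner e t \<in> gpoints G \<longleftrightarrow> e \<in> medges G \<and> 0 < t \<and> t < mlen G e"
  by (auto simp: gpoints_def)

lemma edge_point_0 [simp]: "edge_point G e 0 = Vert (mtail G e)"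
  by (simp add: edge_point_def)

lemma edge_point_len: "e \<in> medges G \<Longrightarrow> edge_point G e (mlen G e) = Vert (mhead G e)"
  using len_pos[of e] by (simp add: edge_point_def)

lemma edge_point_Inner: "0 < t \<Longrightarrow> t < mlen G e \<Longrightarrow> edge_point G e t = Inner e t"
  by (simp add: edge_point_def)

lemma edge_point_in: "e \<in> medges G \<Longrightarrow> t \<in> {0..mlen G e} \<Longrightarrow> edge_point G e t \<in> gpoints G"
  using tail_in head_in by (auto simp: edge_point_def)

lemma gpoint_cases:
  assumes "p \<in> gpoints G"
  obtains v where "v \<in> mverts G" "p = Vert v"
  | e t where "e \<in> medges G" "0 < t" "t < mlen G e" "p = Inner e t"
  using assms by (auto simp: gpoints_def)

section \<open>Piecewise linear paths\<close>

lemma pl_path_nonneg: "pl_path G p r q \<Longrightarrow> r \<ge> 0"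
  by (induction rule: pl_path.induct) auto

lemma pl_path_in: "pl_path G p r q \<Longrightarrow> p \<in> gpoints G \<and> q \<in> gpoints G"
  by (induction rule: pl_path.induct) (auto simp: edge_point_in)

lemma pl_path_edge:
  assumes "e \<in> medges G" "s \<in> {0..mlen G e}" "t \<in> {0..mlen G e}"
  shows "pl_path G (edge_point G e s) \<bar>s - t\<bar> (edge_point G e t)"
  using pl_path.step[OF pl_path.refl[OF edge_point_in[OF assms(1,2)]] assms] by simp

lemma pl_path_trans: "pl_path G q r' z \<Longrightarrow> pl_path G p r q \<Longrightarrow> pl_path G p (r + r') z"
proof (induction rule: pl_path.induct)
  case (step p' r' e s t)
  then show ?case using pl_path.step[of G p "r + r'" e s t] by (simp add: add.assoc)
qed simp

lemma pl_path_sym: "pl_path G p r q \<Longrightarrow> pl_path G q r p"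
proof (induction rule: pl_path.induct)
  case (step p r e s t)
  have "pl_path G (edge_point G e t) (\<bar>t - s\<bar> + r) p"
    using pl_path_trans[OF step.IH pl_path_edge[of e t s]] step.hyps by simp
  then show ?case by (simp add: abs_minus_commute add.commute)
qed (rule pl_path.refl)

section \<open>Walks along whole edges, of integral length\<close>

lemma walk_nonneg: "walk G u r v \<Longrightarrow> r \<ge> 0"
  by (induction rule: walk.induct) (auto simp: len_pos less_imp_le)

lemma walk_Nats: "walk G u r v \<Longrightarrow> r \<in> \<nat>"
  by (induction rule: walk.induct) (auto simp: len_Nats)

lemma walk_in: "walk G u r v \<Longrightarrow> u \<in> mverts G \<and> v \<in> mverts G"
  by (induction rule: walk.induct) (auto simp: tail_in head_in)

lemma walk_zero: "walk G u r v \<Longrightarrow> r = 0 \<Longrightarrow> u = v"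
proof (induction rule: walk.induct)
  case (walk_fwd u r e)
  then show ?case using walk_nonneg[OF walk_fwd.hyps(1)] len_pos[of e] by simp
next
  case (walk_bwd u r e)
  then show ?case using walk_nonneg[OF walk_bwd.hyps(1)] len_pos[of e] by simp
qed simp

lemma walk_exists:
  assumes "u \<in> mverts G" "v \<in> mverts G"
  shows "\<exists>r. walk G u r v"
proof -
  have "(u, v) \<in> (\<Union>e\<in>medges G. {(mtail G e, mhead G e), (mhead G e, mtail G e)})\<^sup>*"
    using conn assms by (auto simp: connected_mgraph_def)
  then show ?thesis
  proof (induction rule: rtrancl_induct)
    case base
    then show ?case using walk_refl[of u G] assms by auto
  next
    case (step y z)
    then show ?case using walk_fwd[of G u] walk_bwd[of G u] by fastforce
  qed
qed

lemma pl_path_walk: "walk G u r v \<Longrightarrow> pl_path G (Vert u) r (Vert v)"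
proof (induction rule: walk.induct)
  case (walk_refl u)
  then show ?case by (simp add: pl_path.refl)
next
  case (walk_fwd u r e)
  have "pl_path G (Vert u) (r + \<bar>0 - mlen G e\<bar>) (edge_point G e (mlen G e))"
    by (rule pl_path.step[of _ _ _ _ 0]) (use walk_fwd len_pos[of e] in auto)
  then show ?case using walk_fwd.hyps len_pos[of e] by (simp add: edge_point_len)
next
  case (walk_bwd u r e)
  have "pl_path G (Vert u) (r + \<bar>mlen G e - 0\<bar>) (edge_point G e 0)"
    by (rule pl_path.step[of _ _ _ _ "mlen G e"])
      (use walk_bwd len_pos[of e] in \<open>auto simp: edge_point_len\<close>)
  then show ?case using walk_bwd.hyps len_pos[of e] by simp
qed

section \<open>Tightening paths to shortcuts\<close>

lemma gends_in:
  assumes "p \<in> gpoints G" "(a, \<alpha>) \<in> gends G p"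
  shows "a \<in> mverts G" "\<alpha> \<ge> 0" "pl_path G p \<alpha> (Vert a)"
proof -
  show "a \<in> mverts G" "\<alpha> \<ge> 0"
    using assms by (auto elim!: gpoint_cases simp: tail_in head_in)
  show "pl_path G p \<alpha> (Vert a)"
    using assms(1)
  proof (cases rule: gpoint_cases)
    case (1 v)
    then show ?thesis using assms by (auto intro: pl_path.refl)
  next
    case (2 e t)
    then show ?thesis
      using assms pl_path_edge[of e t 0] pl_path_edge[of e t "mlen G e"]
      by (auto simp: edge_point_Inner edge_point_len)
  qed
qed

lemma pl_path_shortcut:
  assumes "shortcut G p q c" "p \<in> gpoints G" "q \<in> gpoints G"
  shows "pl_path G p c q"
  using assms(1) unfolding shortcut_def
proof (elim disjE exE conjE)
  fix a \<alpha> b \<beta> n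
  assume *: "(a, \<alpha>) \<in> gends G p" "(b, \<beta>) \<in> gends G q" "walk G a n b" "c = \<alpha> + n + \<beta>"
  show ?thesis
    using pl_path_trans[OF pl_path_sym[OF gends_in(3)[OF assms(3) *(2)]]
        pl_path_trans[OF pl_path_walk[OF *(3)] gends_in(3)[OF assms(2) *(1)]]] *(4) by simp
next
  fix e s t
  assume *: "p = Inner e s" "q = Inner e t" "c = \<bar>s - t\<bar>"
  then show ?thesis using assms pl_path_edge[of e s t] by (auto simp: edge_point_Inner)
qed

text \<open>The candidates for \<open>(b, \<beta>)\<close> are the exits of an inner point at t. At
  \<open>t = 0\<close> or \<open>t = mlen G e\<close> the point is a vertex with one exit only; the
  other candidate is then absorbed by letting the walk traverse e as well.\<close>

lemma shortcut_edge_point: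
  assumes e: "e \<in> medges G" "t \<in> {0..mlen G e}"
    and a: "(a, \<alpha>) \<in> gends G p" and w: "walk G a n b"
    and b: "(b, \<beta>) \<in> {(mtail G e, t), (mhead G e, mlen G e - t)}"
  shows "\<exists>c\<le>\<alpha> + n + \<beta>. shortcut G p (edge_point G e t) c"
proof -
  have sc: "shortcut G p q (\<alpha> + n' + \<beta>')" if "(b', \<beta>') \<in> gends G q" "walk G a n' b'" for q b' \<beta>' n'
    using a that unfolding shortcut_def by blast
  consider "t = 0" | "t = mlen G e" | "0 < t" "t < mlen G e" using e by fastforce
  then show ?thesis
  proof cases
    case 1
    from b show ?thesis
    proof
      assume "(b, \<beta>) = (mtail G e, t)"
      then show ?thesis using sc[of "mtail G e" 0 "Vert (mtail G e)" n] w 1 by auto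
    next
      assume "(b, \<beta>) \<in> {(mhead G e, mlen G e - t)}"
      then show ?thesis
        using sc[of "mtail G e" 0 "Vert (mtail G e)" "n + mlen G e"] walk_bwd[of G a n e] w 1 e
        by (intro exI[of _ "\<alpha> + n + \<beta>"]) (auto simp: add.assoc)
    qed
  next
    case 2
    from b show ?thesis
    proof
      assume "(b, \<beta>) = (mtail G e, t)"
      then show ?thesis
        using sc[of "mhead G e" 0 "Vert (mhead G e)" "n + mlen G e"] walk_fwd[of G a n e] w 2 e
        by (intro exI[of _ "\<alpha> + n + \<beta>"]) (auto simp: edge_point_len add.assoc)
    next
      assume "(b, \<beta>) \<in> {(mhead G e, mlen G e - t)}"
      then show ?thesis
        using sc[of "mhead G e" 0 "Vert (mhead G e)" n] w 2 e by (auto simp: edge_point_len)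
    qed
  next
    case 3
    then show ?thesis using sc[of b \<beta> "Inner e t" n] w b by (auto simp: edge_point_Inner)
  qed
qed

text \<open>Induction along the path. A last segment inside e changes the distance along e to either
  end by at most its length, so an exit once used can be kept. Only a path that has stayed inside
  one edge and now arrives at an end of it changes its type: it becomes a shortcut with a walk of
  length 0.\<close>

lemma shortcut_below_path:
  "pl_path G p r q \<Longrightarrow> \<exists>c\<le>r. shortcut G p q c"
proof (induction rule: pl_path.induct)
  case (refl p)
  then show ?case
  proof (cases rule: gpoint_cases)
    case (1 v)
    then have "shortcut G p p (0 + 0 + 0)" unfolding shortcut_def using walk_refl[of v G] by fastforce
    then show ?thesis by auto
  next
    case (2 e t)
    then have "shortcut G p p \<bar>t - t\<bar>" unfolding shortcut_def by blast
    then show ?thesis by auto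
  qed
next
  case (step p r e s t)
  let ?q = "edge_point G e s"
  have p: "p \<in> gpoints G" using pl_path_in[OF step.hyps(1)] by simp
  from step.IH obtain c where c: "c \<le> r" "shortcut G p ?q c" by blast
  consider (far) a \<alpha> b \<beta> n where "(a, \<alpha>) \<in> gends G p" "(b, \<beta>) \<in> gends G ?q" "walk G a n b" "c = \<alpha> + n + \<beta>"
    | (same) e' s' t' where "p = Inner e' s'" "?q = Inner e' t'" "c = \<bar>s' - t'\<bar>"
    using c(2) unfolding shortcut_def by blast
  then show ?case
  proof cases
    case far
    have "(b, \<beta>) \<in> {(mtail G e, s), (mhead G e, mlen G e - s)}"
      using far(2) step.hyps by (auto simp: edge_point_def split: if_splits)
    then have "\<exists>\<beta>'\<le>\<beta> + \<bar>s - t\<bar>. (b, \<beta>') \<in> {(mtail G e, t), (mhead G e, mlen G e - t)}"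
    proof
      assume "(b, \<beta>) = (mtail G e, s)"
      then show ?thesis by (intro exI[of _ t]) auto
    next
      assume "(b, \<beta>) \<in> {(mhead G e, mlen G e - s)}"
      then show ?thesis by (intro exI[of _ "mlen G e - t"]) auto
    qed
    then obtain \<beta>' where "\<beta>' \<le> \<beta> + \<bar>s - t\<bar>" "(b, \<beta>') \<in> {(mtail G e, t), (mhead G e, mlen G e - t)}"
      by blast
    moreover from this obtain c' where "c' \<le> \<alpha> + n + \<beta>'" "shortcut G p (edge_point G e t) c'"
      using shortcut_edge_point[OF step.hyps(2,4) far(1,3), of \<beta>'] by blast
    ultimately show ?thesis using far(4) c(1) by (intro exI[of _ c']) simp
  next
    case same
    then have e: "e' = e" "t' = s" using step.hyps by (auto simp: edge_point_def split: if_splits)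
    have s': "0 < s'" "s' < mlen G e" using same p e by auto
    show ?thesis
    proof (cases "0 < t \<and> t < mlen G e")
      case True
      then have "shortcut G p (edge_point G e t) \<bar>s' - t\<bar>"
        unfolding shortcut_def using same e by (auto simp: edge_point_Inner)
      then show ?thesis using c(1) same e by (intro exI[of _ "\<bar>s' - t\<bar>"]) auto
    next
      case False
      have 1: "(mtail G e, s') \<in> gends G p" "(mhead G e, mlen G e - s') \<in> gends G p"
        using same e by auto
      have 2: "\<exists>c\<le>s' + 0 + t. shortcut G p (edge_point G e t) c"
        by (rule shortcut_edge_point[OF step.hyps(2,4) 1(1) walk_refl])
          (auto intro: tail_in step.hyps)
      have 3: "\<exists>c\<le>mlen G e - s' + 0 + (mlen G e - t). shortcut G p (edge_point G e t) c"
        by (rule shortcut_edge_point[OF step.hyps(2,4) 1(2) walk_refl])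
          (auto intro: head_in step.hyps)
      have "t = 0 \<or> t = mlen G e" using False step.hyps by auto
      then have "s' + 0 + t \<le> r + \<bar>s - t\<bar> \<or> mlen G e - s' + 0 + (mlen G e - t) \<le> r + \<bar>s - t\<bar>"
        using c(1) same(3) e step.hyps(3) by auto
      then show ?thesis using 2 3 order_trans by blast
    qed
  qed
qed

text \<open>Each point has at most two exits and walks have integral length, so the lengths of
  shortcuts lie in at most four translates of the natural numbers, together with one value inside a
  common edge.\<close>

lemma finite_shortcuts: "finite {c. shortcut G p q c \<and> c \<le> B}"
proof -
  have fin: "finite (gends G p)" for p by (cases p) auto
  let ?F = "\<Union>(a, \<alpha>)\<in>gends G p. \<Union>(b, \<beta>)\<in>gends G q. (\<lambda>k. \<alpha> + real k + \<beta>) ` {k. \<alpha> + real k + \<beta> \<le> B}"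
  have fk: "finite {k. \<alpha> + real k + \<beta> \<le> B}" for \<alpha> \<beta>
  proof (rule finite_subset)
    show "{k. \<alpha> + real k + \<beta> \<le> B} \<subseteq> {..nat \<lceil>B - \<alpha> - \<beta>\<rceil>}" by (auto simp: le_nat_iff) linarith
  qed simp
  have "{c. shortcut G p q c \<and> c \<le> B} \<subseteq> ?F \<union> (case (p, q) of (Inner e s, Inner e' t) \<Rightarrow> {\<bar>s - t\<bar>} | _ \<Rightarrow> {})"
  proof
    fix c assume c: "c \<in> {c. shortcut G p q c \<and> c \<le> B}"
    then consider (far) a \<alpha> b \<beta> n where "(a, \<alpha>) \<in> gends G p" "(b, \<beta>) \<in> gends G q" "walk G a n b" "c = \<alpha> + n + \<beta>"
      | (same) e s t where "p = Inner e s" "q = Inner e t" "c = \<bar>s - t\<bar>"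
      unfolding shortcut_def by blast
    then show "c \<in> ?F \<union> (case (p, q) of (Inner e s, Inner e' t) \<Rightarrow> {\<bar>s - t\<bar>} | _ \<Rightarrow> {})"
    proof cases
      case far
      obtain k where k: "n = real k" using walk_Nats[OF far(3)] by (auto elim: Nats_cases)
      then have "c \<in> (\<lambda>k. \<alpha> + real k + \<beta>) ` {k. \<alpha> + real k + \<beta> \<le> B}" using c far(4) by auto
      then show ?thesis using far(1,2) by blast
    qed auto
  qed
  moreover have "finite ?F" using fin fk by auto
  moreover have "finite (case (p, q) of (Inner e s, Inner e' t) \<Rightarrow> {\<bar>s - t\<bar>} | _ \<Rightarrow> {})"
    by (auto split: gpoint.splits)
  ultimately show ?thesis by (meson finite_UnI finite_subset)
qed

lemma pl_path_exists:
  assumes "p \<in> gpoints G" "q \<in> gpoints G"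
  shows "\<exists>r. pl_path G p r q"
proof -
  have *: "\<exists>a \<alpha>. (a, \<alpha>) \<in> gends G p" for p by (cases p) auto
  obtain a \<alpha> b \<beta> where ab: "(a, \<alpha>) \<in> gends G p" "(b, \<beta>) \<in> gends G q" using * by metis
  then obtain n where "walk G a n b" using walk_exists gends_in(1) assms by metis
  then have "shortcut G p q (\<alpha> + n + \<beta>)" using ab unfolding shortcut_def by blast
  then show ?thesis using pl_path_shortcut assms by blast
qed

lemma gdist_attained:
  assumes p: "p \<in> gpoints G" and q: "q \<in> gpoints G"
  shows "shortcut G p q (gdist G p q)" and "pl_path G p r q \<Longrightarrow> gdist G p q \<le> r"
proof -
  let ?S = "{r. pl_path G p r q}"
  obtain r0 where r0: "pl_path G p r0 q" using pl_path_exists[OF p q] by blast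
  let ?C = "{c. shortcut G p q c \<and> c \<le> r0}"
  have fin: "finite ?C" by (rule finite_shortcuts)
  have ne: "?C \<noteq> {}" using shortcut_below_path[OF r0] by auto
  define m where "m = Min ?C"
  have m: "m \<in> ?C" using Min_in[OF fin ne] by (simp add: m_def)
  have le: "m \<le> r" if r: "pl_path G p r q" for r
  proof -
    obtain c where "c \<le> r" "shortcut G p q c" using shortcut_below_path[OF r] by blast
    then show ?thesis using m Min_le[OF fin, of c] m_def by (cases "c \<le> r0") auto
  qed
  have "pl_path G p m q" using m pl_path_shortcut p q by blast
  then have "Inf ?S = m" using le by (intro cInf_eq_minimum) auto
  then have g: "gdist G p q = m" using r0 by (auto simp: gdist_def)
  show "shortcut G p q (gdist G p q)" using g m by simp
  show "pl_path G p r q \<Longrightarrow> gdist G p q \<le> r" using g le by simp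
qed

section \<open>The path metric is a geodesic metric\<close>

lemma pl_path_gdist: "p \<in> gpoints G \<Longrightarrow> q \<in> gpoints G \<Longrightarrow> pl_path G p (gdist G p q) q"
  using gdist_attained(1) pl_path_shortcut by blast

lemma gdist_nonneg: "gdist G p q \<ge> 0"
proof (cases "\<exists>r. pl_path G p r q")
  case True
  then show ?thesis using pl_path_nonneg by (auto simp: gdist_def intro!: cInf_greatest)
qed (simp add: gdist_def)

lemma gdist_sym: "gdist G p q = gdist G q p"
proof -
  have "{r. pl_path G p r q} = {r. pl_path G q r p}" using pl_path_sym by blast
  then show ?thesis unfolding gdist_def using pl_path_sym by (metis (mono_tags, lifting))
qed

lemma gdist_zero:
  assumes p: "p \<in> gpoints G" and q: "q \<in> gpoints G" and z: "gdist G p q = 0"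
  shows "p = q"
  using gdist_attained(1)[OF p q] unfolding shortcut_def z
proof (elim disjE exE conjE)
  fix a \<alpha> b \<beta> n
  assume *: "(a, \<alpha>) \<in> gends G p" "(b, \<beta>) \<in> gends G q" "walk G a n b" "0 = \<alpha> + n + \<beta>"
  then have "\<alpha> = 0" "\<beta> = 0" "n = 0"
    using gends_in(2)[OF p *(1)] gends_in(2)[OF q *(2)] walk_nonneg[OF *(3)] by linarith+
  moreover have "p = Vert a" if "\<alpha> = 0" using p *(1) that by (auto elim!: gpoint_cases)
  moreover have "q = Vert b" if "\<beta> = 0" using q *(2) that by (auto elim!: gpoint_cases)
  ultimately show ?thesis using walk_zero[OF *(3)] by simp
qed auto

sublocale Metric_space "gpoints G" "gdist G"
proof
  fix x y z
  show "0 \<le> gdist G x y" by (rule gdist_nonneg)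
  show "gdist G x y = gdist G y x" by (rule gdist_sym)
  assume x: "x \<in> gpoints G" and y: "y \<in> gpoints G"
  show "(gdist G x y = 0) = (x = y)"
    using gdist_zero[OF x y] gdist_attained(2)[OF x x pl_path.refl[OF x]] gdist_nonneg[of x x] by auto
  assume z: "z \<in> gpoints G"
  show "gdist G x z \<le> gdist G x y + gdist G y z"
    using gdist_attained(2)[OF x z] pl_path_trans[OF pl_path_gdist[OF y z] pl_path_gdist[OF x y]] by simp
qed

lemma gdist_edge:
  assumes "e \<in> medges G" "s \<in> {0..mlen G e}" "t \<in> {0..mlen G e}"
  shows "gdist G (edge_point G e s) (edge_point G e t) \<le> \<bar>s - t\<bar>"
  using gdist_attained(2) pl_path_edge[OF assms] pl_path_in by blast

lemma gdist_edge_ends: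
  assumes "e \<in> medges G"
  shows "gdist G (Vert (mtail G e)) (Vert (mhead G e)) \<le> mlen G e"
  using gdist_edge[OF assms, of 0 "mlen G e"] len_pos[OF assms] by (simp add: edge_point_len assms)

text \<open>The path traversed at unit speed. It may backtrack, so only the Lipschitz bound holds in
  general; for a path of minimal length it becomes an equality.\<close>

lemma pl_path_parametrised:
  "pl_path G p r q \<Longrightarrow> \<exists>c. c 0 = p \<and> c r = q \<and> c ` {0..r} \<subseteq> gpoints G \<and>
     (\<forall>s\<in>{0..r}. \<forall>t\<in>{0..r}. gdist G (c s) (c t) \<le> \<bar>s - t\<bar>)"
proof (induction rule: pl_path.induct)
  case (refl p)
  then show ?case by (intro exI[of _ "\<lambda>_. p"]) auto
next
  case (step p r e s t)
  obtain c where c: "c 0 = p" "c r = edge_point G e s" "c ` {0..r} \<subseteq> gpoints G"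
    "\<And>u v. u \<in> {0..r} \<Longrightarrow> v \<in> {0..r} \<Longrightarrow> gdist G (c u) (c v) \<le> \<bar>u - v\<bar>"
    using step.IH by blast
  have r: "r \<ge> 0" using pl_path_nonneg[OF step.hyps(1)] .
  define l where "l u = s + sgn (t - s) * (u - r)" for u
  define c' where "c' u = (if u \<le> r then c u else edge_point G e (l u))" for u
  have l_in: "l u \<in> {0..mlen G e}" if "u \<in> {r..r + \<bar>s - t\<bar>}" for u
    using that step.hyps by (cases "t > s"; cases "t = s") (auto simp: l_def)
  have cr: "c' u = edge_point G e (l u)" if "u \<in> {r..r + \<bar>s - t\<bar>}" for u
    using that c(2) by (auto simp: c'_def l_def)
  have in': "c' u \<in> gpoints G" if "u \<in> {0..r + \<bar>s - t\<bar>}" for u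
    using that c(3) edge_point_in[OF step.hyps(2) l_in[of u]] by (auto simp: c'_def)
  have ll: "\<bar>l u - l v\<bar> \<le> \<bar>u - v\<bar>" for u v
    by (cases "t > s"; cases "t = s") (auto simp: l_def)
  have le: "gdist G (c' u) (c' v) \<le> v - u" if uv: "0 \<le> u" "u \<le> v" "v \<le> r + \<bar>s - t\<bar>" for u v
  proof -
    consider "v \<le> r" | "u \<ge> r" | "u < r" "r < v" by linarith
    then show ?thesis
    proof cases
      case 1
      then show ?thesis using c(4)[of u v] uv by (simp add: c'_def)
    next
      case 2
      then show ?thesis
        using gdist_edge[OF step.hyps(2) l_in[of u] l_in[of v]] uv ll[of u v] by (simp add: cr)
    next
      case 3
      have "gdist G (c' u) (c' v) \<le> gdist G (c' u) (c' r) + gdist G (c' r) (c' v)"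
        using uv 3 by (intro triangle in') auto
      moreover have "gdist G (c' u) (c' r) \<le> r - u" using c(4)[of u r] uv 3 by (simp add: c'_def)
      moreover have "gdist G (c' r) (c' v) \<le> v - r"
        using gdist_edge[OF step.hyps(2) l_in[of r] l_in[of v]] uv 3 ll[of r v] by (simp add: cr)
      ultimately show ?thesis by simp
    qed
  qed
  have "gdist G (c' u) (c' v) \<le> \<bar>u - v\<bar>" if "u \<in> {0..r + \<bar>s - t\<bar>}" "v \<in> {0..r + \<bar>s - t\<bar>}" for u v
    using that le[of u v] le[of v u] gdist_sym[of "c' u" "c' v"] by (cases "u \<le> v") auto
  moreover have "c' 0 = p" using r c by (simp add: c'_def)
  moreover have "c' (r + \<bar>s - t\<bar>) = edge_point G e t"
  proof -
    have "l (r + \<bar>s - t\<bar>) = t" by (cases "t > s"; cases "t = s") (auto simp: l_def)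
    then show ?thesis by (simp add: cr)
  qed
  ultimately show ?case using in' by blast
qed

text \<open>A unit speed path of minimal length cannot lose anything: the triangle inequality
  through \<open>c s\<close> and \<open>c t\<close> turns the Lipschitz bounds into
  equalities.\<close>

lemma geodesic: "geodesic_space (gpoints G) (gdist G)"
  unfolding geodesic_space_def
proof (intro conjI ballI)
  show "Metric_space (gpoints G) (gdist G)" ..
  fix x y assume x: "x \<in> gpoints G" and y: "y \<in> gpoints G"
  let ?L = "gdist G x y"
  obtain c where c: "c 0 = x" "c ?L = y" "c ` {0..?L} \<subseteq> gpoints G"
    "\<And>s t. s \<in> {0..?L} \<Longrightarrow> t \<in> {0..?L} \<Longrightarrow> gdist G (c s) (c t) \<le> \<bar>s - t\<bar>"
    using pl_path_parametrised[OF pl_path_gdist[OF x y]] by blast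
  have L: "?L \<ge> 0" by (rule gdist_nonneg)
  have le: "gdist G (c s) (c t) = t - s" if "0 \<le> s" "s \<le> t" "t \<le> ?L" for s t
  proof -
    have "?L \<le> gdist G x (c s) + gdist G (c s) y" "gdist G (c s) y \<le> gdist G (c s) (c t) + gdist G (c t) y"
      using that c(3) x y by (intro triangle; force)+
    then show ?thesis
      using c(4)[of 0 s] c(4)[of s t] c(4)[of t ?L] that L c(1,2) by simp
  qed
  have "gdist G (c s) (c t) = \<bar>s - t\<bar>" if "s \<in> {0..?L}" "t \<in> {0..?L}" for s t
    using that le[of s t] le[of t s] gdist_sym[of "c s" "c t"] by (cases "s \<le> t") auto
  then show "\<exists>g. geodesic_segment (gpoints G) (gdist G) g x y"
    using c unfolding geodesic_segment_def by blast
qed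

section \<open>Distances between vertices\<close>

lemma gdist_walk_le: "walk G u r v \<Longrightarrow> gdist G (Vert u) (Vert v) \<le> r"
  using gdist_attained(2) pl_path_walk pl_path_in by blast

lemma gdist_walk:
  assumes "u \<in> mverts G" "v \<in> mverts G"
  shows "walk G u (gdist G (Vert u) (Vert v)) v"
  using gdist_attained(1)[of "Vert u" "Vert v"] assms by (auto simp: shortcut_def)

text \<open>The way in which lower bounds for distances are found below: choose a potential \<phi>
  on the vertices and check it edge by edge.\<close>

lemma vertex_Lipschitz:
  fixes \<phi> :: "'v \<Rightarrow> real"
  assumes "\<And>e. e \<in> medges G \<Longrightarrow> \<bar>\<phi> (mtail G e) - \<phi> (mhead G e)\<bar> \<le> mlen G e"
    and "u \<in> mverts G" "v \<in> mverts G"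
  shows "\<bar>\<phi> u - \<phi> v\<bar> \<le> gdist G (Vert u) (Vert v)"
proof -
  have "\<bar>\<phi> u - \<phi> v\<bar> \<le> r" if "walk G u r v" for r u v
    using that
  proof (induction rule: walk.induct)
    case (walk_fwd u r e)
    then show ?case using assms(1)[of e] by linarith
  next
    case (walk_bwd u r e)
    then show ?case using assms(1)[of e] by linarith
  qed simp
  then show ?thesis using gdist_walk[OF assms(2,3)] .
qed

lemma gdist_gends:
  assumes "p \<in> gpoints G" "(a, \<alpha>) \<in> gends G p"
  shows "gdist G p (Vert a) \<le> \<alpha>"
  using gdist_attained(2)[OF assms(1) _ gends_in(3)[OF assms]] gends_in(1)[OF assms] by simp

end

section \<open>Spaces guided by projections to pieces\<close>

lemma geodesic_space_metric: "geodesic_space M d \<Longrightarrow> Metric_space M d"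
  by (simp add: geodesic_space_def)

lemma geodesic_segmentD:
  assumes "geodesic_segment M d g x y"
  shows "g 0 = x" "g (d x y) = y" "s \<in> {0..d x y} \<Longrightarrow> g s \<in> M"
    "s \<in> {0..d x y} \<Longrightarrow> t \<in> {0..d x y} \<Longrightarrow> d (g s) (g t) = \<bar>s - t\<bar>"
  using assms by (auto simp: geodesic_segment_def)

lemma geodesic_subsegment:
  assumes g: "geodesic_segment M d g x y" and st: "0 \<le> s" "s \<le> t" "t \<le> d x y"
  shows "d (g s) (g t) = t - s" "geodesic_segment M d (\<lambda>\<tau>. g (s + \<tau>)) (g s) (g t)"
proof -
  show *: "d (g s) (g t) = t - s" using geodesic_segmentD(4)[OF g, of s t] st by simp
  show "geodesic_segment M d (\<lambda>\<tau>. g (s + \<tau>)) (g s) (g t)"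
    unfolding geodesic_segment_def *
    using geodesic_segmentD(3,4)[OF g] st by auto
qed

text \<open>Replaces the intermediate value theorem for properties that change by jumps along a
  coarse path.\<close>

lemma discrete_exit:
  fixes n :: nat
  assumes "P 0" "\<not> P n"
  shows "\<exists>i<n. P i \<and> \<not> P (Suc i)"
  using assms by (induction n) (auto simp: less_Suc_eq)

text \<open>Samples the geodesic at integer times, truncated at its end. This produces the coarse
  paths with steps at most 1 to which \<open>discrete_exit\<close> is applied.\<close>

lemma geodesic_chain:
  assumes g: "geodesic_segment M d g x y" and L: "d x y \<ge> 0"
  obtains \<tau> :: "nat \<Rightarrow> real" and N :: nat where "\<tau> 0 = 0" "\<tau> N = d x y" "mono \<tau>"
    "\<forall>i. \<tau> i \<in> {0..d x y}" "\<forall>i. d (g (\<tau> i)) (g (\<tau> (Suc i))) \<le> 1" "real N \<le> d x y + 1"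
proof -
  define \<tau> where "\<tau> i = min (real i) (d x y)" for i
  have 1: "\<tau> i \<in> {0..d x y}" for i using L by (auto simp: \<tau>_def)
  show thesis
  proof (rule that[of \<tau> "nat \<lceil>d x y\<rceil>"])
    show "\<tau> 0 = 0" "\<tau> (nat \<lceil>d x y\<rceil>) = d x y"
      using L real_nat_ceiling_ge[of "d x y"] by (auto simp: \<tau>_def)
    show "mono \<tau>" by (auto simp: \<tau>_def mono_def)
    show "\<forall>i. d (g (\<tau> i)) (g (\<tau> (Suc i))) \<le> 1"
    proof
      fix i
      have "\<bar>\<tau> i - \<tau> (Suc i)\<bar> \<le> 1" by (auto simp: \<tau>_def min_def)
      then show "d (g (\<tau> i)) (g (\<tau> (Suc i))) \<le> 1" using geodesic_segmentD(4)[OF g 1 1] by metis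
    qed
    show "real (nat \<lceil>d x y\<rceil>) \<le> d x y + 1" using L by linarith
  qed (use 1 in auto)
qed

text \<open>\<open>pr X\<close> is thought of as a coarse nearest point projection to the piece \<open>P X\<close>; by
  \<open>pr_jump\<close> it is locally constant away from the piece.\<close>

locale projections =
  fixes M :: "'a set" and d :: "'a \<Rightarrow> 'a \<Rightarrow> real" and I :: "'i set"
    and P :: "'i \<Rightarrow> 'a set" and pr :: "'i \<Rightarrow> 'a \<Rightarrow> 'a" and D :: real
  assumes geodesic: "geodesic_space M d"
    and piece_sub: "X \<in> I \<Longrightarrow> P X \<subseteq> M"
    and piece_geodesic: "X \<in> I \<Longrightarrow> geodesic_space (P X) d"
    and pr_in: "X \<in> I \<Longrightarrow> m \<in> M \<Longrightarrow> pr X m \<in> P X"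
    and pr_id: "X \<in> I \<Longrightarrow> m \<in> P X \<Longrightarrow> pr X m = m"
    and D_ge: "D \<ge> 1"
    and pr_jump: "X \<in> I \<Longrightarrow> x \<in> M \<Longrightarrow> z \<in> M \<Longrightarrow> pr X x \<noteq> pr X z \<Longrightarrow> d x (pr X x) \<le> d x z + D"
begin

sublocale Metric_space M d
  using geodesic by (rule geodesic_space_metric)

lemma pr_in_M: "X \<in> I \<Longrightarrow> m \<in> M \<Longrightarrow> pr X m \<in> M"
  using pr_in piece_sub by blast

text \<open>At a step that leaves the value \<open>pr V x\<close>, \<open>pr_jump\<close> places the
  geodesic within D plus the step size of it. The value \<open>pr V z\<close> has to be entered at
  this step or a later one, which puts the visits in the right order.\<close>

lemma visits_projections:
  assumes g: "geodesic_segment M d g x z" and x: "x \<in> M" and z: "z \<in> M" and V: "V \<in> I"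
    and ne: "pr V x \<noteq> pr V z"
  obtains a b where "0 \<le> a" "a \<le> b" "b \<le> d x z"
    "d (g a) (pr V x) \<le> D + 1" "d (g b) (pr V z) \<le> D + 1"
proof -
  from geodesic_chain[OF g nonneg]
  obtain \<tau> and N :: nat where \<tau>: "\<tau> 0 = 0" "\<tau> N = d x z" "mono \<tau>"
    "\<forall>i. \<tau> i \<in> {0..d x z}" "\<forall>i. d (g (\<tau> i)) (g (\<tau> (Suc i))) \<le> 1" "real N \<le> d x z + 1" .
  define c where "c i = g (\<tau> i)" for i
  have c_in: "c i \<in> M" for i
    using geodesic_segmentD(3)[OF g] \<tau>(4) by (simp add: c_def)
  have c0: "c 0 = x" and cN: "c N = z" using \<tau>(1,2) geodesic_segmentD(1,2)[OF g] by (auto simp: c_def)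
  have cstep: "d (c i) (c (Suc i)) \<le> 1" for i
    using \<tau>(5) by (simp add: c_def)
  have jump: "d (c i) (pr V (c i)) \<le> D + 1" "d (c (Suc i)) (pr V (c (Suc i))) \<le> D + 1"
    if ne: "pr V (c i) \<noteq> pr V (c (Suc i))" for i
  proof -
    have c: "c i \<in> M" "c (Suc i) \<in> M" using c_in by auto
    show "d (c i) (pr V (c i)) \<le> D + 1" "d (c (Suc i)) (pr V (c (Suc i))) \<le> D + 1"
      using pr_jump[OF V c ne] pr_jump[OF V c(2,1) ne[symmetric]] cstep[of i]
        commute[of "c i" "c (Suc i)"] by linarith+
  qed
  obtain i where i: "i < N" "pr V (c i) = pr V x" "pr V (c (Suc i)) \<noteq> pr V x"
    using discrete_exit[of "\<lambda>i. pr V (c i) = pr V x" N] ne c0 cN by metis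
  have 1: "d (c i) (pr V x) \<le> D + 1" using jump(1)[of i] i by simp
  have "\<exists>j\<ge>i. j \<le> N \<and> d (c j) (pr V z) \<le> D + 1"
  proof (cases "pr V (c (Suc i)) = pr V z")
    case True
    then show ?thesis using jump(2)[of i] i by (intro exI[of _ "Suc i"]) auto
  next
    case False
    obtain j where "j < N - Suc i" "pr V (c (Suc i + j)) \<noteq> pr V z" "pr V (c (Suc i + Suc j)) = pr V z"
      using discrete_exit[of "\<lambda>j. pr V (c (Suc i + j)) \<noteq> pr V z" "N - Suc i"] False i cN by auto
    then show ?thesis using jump(2)[of "Suc i + j"] i by (intro exI[of _ "Suc i + Suc j"]) auto
  qed
  then obtain j where j: "i \<le> j" "j \<le> N" "d (c j) (pr V z) \<le> D + 1" by blast
  show thesis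
    using that[of "\<tau> i" "\<tau> j"] \<tau>(4) monoD[OF \<tau>(3) j(1)] j i(1) 1 by (auto simp: c_def)
qed

text \<open>The bound of \<open>visits_projections\<close>: D plus one sampling step.\<close>

definition H :: real where "H = D + 1"

lemma H_ge: "H \<ge> 2" "D \<le> H"
  using D_ge by (auto simp: H_def)

text \<open>Between its visits to \<open>pr V x\<close> and \<open>pr V z\<close> the geodesic runs
  along the piece. If the projection u of \<open>g t\<close> is not \<open>pr V x\<close>, the
  geodesic is near u at some time before t; if it is not \<open>pr V z\<close>, at some time after
  t. It cannot be near u at two distant times, so t is close to both. Where u is one of the two
  ends, the visit at a or b supplies the missing time.\<close>

lemma
  assumes g: "geodesic_segment M d g x z" and x: "x \<in> M" and z: "z \<in> M" and V: "V \<in> I"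
    and ne: "pr V x \<noteq> pr V z" and a: "a \<in> {0..d x z}" and b: "b \<in> {0..d x z}"
    and da: "d (g a) (pr V x) \<le> H" and db: "d (g b) (pr V z) \<le> H"
    and t: "t \<in> {0..d x z}" "a - H \<le> t" "t \<le> b + H"
  shows near_piece: "d (g t) (pr V (g t)) \<le> 4 * H"
    and near_piece_aligned: "d (pr V x) (pr V (g t)) + d (pr V (g t)) (pr V z) \<le> d (pr V x) (pr V z) + 16 * H"
    and near_piece_distance: "\<bar>d (pr V x) (pr V (g t)) - (t - a)\<bar> \<le> 7 * H"
proof -
  note gin = geodesic_segmentD(3)[OF g] and gd = geodesic_segmentD(4)[OF g]
  let ?u = "pr V (g t)"
  have m: "g t \<in> M" using gin[OF t(1)] .
  have u: "?u \<in> M" and p: "pr V x \<in> M" and q: "pr V z \<in> M" using pr_in_M[OF V] m x z by auto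
  have before: "\<exists>s\<in>{0..t}. d (g s) ?u \<le> H" if ne': "?u \<noteq> pr V x"
  proof -
    have "d x (g t) = t" using gd[of 0 t] t geodesic_segmentD(1)[OF g] by auto
    moreover have "geodesic_segment M d g x (g t)"
      using geodesic_subsegment(2)[OF g, of 0 t] t geodesic_segmentD(1)[OF g] by simp
    moreover from visits_projections[OF this x m V ne'[symmetric]]
    obtain a' s where "0 \<le> a'" "a' \<le> s" "s \<le> d x (g t)" "d (g s) ?u \<le> D + 1" .
    ultimately have "s \<in> {0..t}" "d (g s) ?u \<le> D + 1" by auto
    then show ?thesis by (intro bexI[of _ s]) (auto simp: H_def)
  qed
  have after: "\<exists>s\<in>{t..d x z}. d (g s) ?u \<le> H" if ne': "?u \<noteq> pr V z"
  proof -
    have *: "g (d x z) = z" using geodesic_segmentD(2)[OF g] .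
    have L: "d (g t) z = d x z - t" using gd[of t "d x z"] t * by auto
    have "geodesic_segment M d (\<lambda>\<tau>. g (t + \<tau>)) (g t) z"
      using geodesic_subsegment(2)[OF g, of t "d x z"] t * by simp
    from visits_projections[OF this m z V ne']
    obtain s b' where "0 \<le> s" "s \<le> b'" "b' \<le> d (g t) z" "d (g (t + s)) ?u \<le> D + 1" .
    then show ?thesis using L by (intro bexI[of _ "t + s"]) (auto simp: H_def)
  qed
  have close: "\<bar>s - s'\<bar> \<le> 2 * H"
    if "d (g s) y \<le> H" "d (g s') y \<le> H" "y \<in> M" "s \<in> {0..d x z}" "s' \<in> {0..d x z}" for s s' y
    using triangle[OF gin[OF that(4)] that(3) gin[OF that(5)]] that(1,2) gd[OF that(4,5)]
      commute[of y "g s'"] by simp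
  have near: "d (g t) ?u \<le> \<bar>t - s\<bar> + H" if "s \<in> {0..d x z}" "d (g s) ?u \<le> H" for s
    using triangle[of "g t" "g s" ?u] m u gin[OF that(1)] gd[OF t(1) that(1)] that(2) by simp
  show N: "d (g t) ?u \<le> 4 * H"
  proof -
    consider "?u = pr V x" | "?u = pr V z" | "?u \<noteq> pr V x" "?u \<noteq> pr V z" by blast
    then show ?thesis
    proof cases
      case 1
      then obtain s where s: "s \<in> {t..d x z}" "d (g s) ?u \<le> H" using after ne by auto
      then have "\<bar>s - a\<bar> \<le> 2 * H" using close[of s ?u a] da 1 u t a by auto
      then show ?thesis using near[of s] s t by auto
    next
      case 2
      then obtain s where s: "s \<in> {0..t}" "d (g s) ?u \<le> H" using before ne by auto
      then have "\<bar>s - b\<bar> \<le> 2 * H" using close[of s ?u b] db 2 u t b by auto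
      then show ?thesis using near[of s] s t by auto
    next
      case 3
      obtain s where s1: "s \<in> {0..t}" "d (g s) ?u \<le> H" using before[OF 3(1)] by blast
      obtain s' where "s' \<in> {t..d x z}" "d (g s') ?u \<le> H" using after[OF 3(2)] by blast
      note s = s1 this
      then have "\<bar>s - s'\<bar> \<le> 2 * H" using close[of s ?u s'] u t by auto
      then show ?thesis using near[of s] s t H_ge by auto
    qed
  qed
  have ga: "g a \<in> M" and gb: "g b \<in> M" using gin a b by auto
  have q1: "d (pr V x) ?u \<le> H + \<bar>t - a\<bar> + 4 * H"
    using triangle[of "pr V x" "g a" ?u] triangle[of "g a" "g t" ?u] da N gd[OF a t(1)] p u m ga
      commute[of "pr V x" "g a"] by auto
  have q2: "\<bar>t - a\<bar> \<le> H + d (pr V x) ?u + 4 * H"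
    using triangle[of "g a" "pr V x" "g t"] triangle[of "pr V x" ?u "g t"] da N gd[OF a t(1)] p u m ga
      commute[of ?u "g t"] by auto
  have q3: "d ?u (pr V z) \<le> 4 * H + \<bar>b - t\<bar> + H"
    using triangle[of ?u "g t" "pr V z"] triangle[of "g t" "g b" "pr V z"] db N gd[OF t(1) b] q u m gb
      commute[of ?u "g t"] by auto
  have q4: "b - a \<le> H + d (pr V x) (pr V z) + H"
    using triangle[of "g a" "pr V x" "g b"] triangle[of "pr V x" "pr V z" "g b"] da db gd[OF a b] p q ga gb
      commute[of "pr V z" "g b"] by auto
  \<comment> \<open>Of the 16 units, 5 + 5 come from the detours through the points of the geodesic,
    4 from t possibly lying H outside the interval from a to b, and 2 from comparing
    \<open>b - a\<close> with the distance of the projections.\<close>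
  show "d (pr V x) ?u + d ?u (pr V z) \<le> d (pr V x) (pr V z) + 16 * H"
    using q1 q3 q4 t(2,3) H_ge by linarith
  show "\<bar>d (pr V x) (pr V (g t)) - (t - a)\<bar> \<le> 7 * H"
    using q1 q2 t by linarith
qed

end

text \<open>The interface between the combinatorics of projections and the three conclusions.
  \<open>guide\<close> stands for the description of geodesics as chains of pieces: for each time it
  names a single piece along which the geodesic is running, and choices for different times need not
  fit together.\<close>

locale guided = projections +
  assumes pr_const: "X \<in> I \<Longrightarrow> Y \<in> I \<Longrightarrow> X \<noteq> Y \<Longrightarrow> p \<in> P Y \<Longrightarrow> q \<in> P Y \<Longrightarrow> pr X p = pr X q"
    and guide: "x \<in> M \<Longrightarrow> z \<in> M \<Longrightarrow> geodesic_segment M d g x z \<Longrightarrow> t \<in> {0..d x z} \<Longrightarrow>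
      d x (g t) \<le> D \<or> d (g t) z \<le> D \<or>
      (\<exists>V\<in>I. pr V x \<noteq> pr V z \<and> (\<exists>a\<in>{0..d x z}. \<exists>b\<in>{0..d x z}.
         d (g a) (pr V x) \<le> D \<and> d (g b) (pr V z) \<le> D \<and> a - D \<le> t \<and> t \<le> b + D))"
begin

lemma guide_cases:
  assumes "x \<in> M" "z \<in> M" "geodesic_segment M d g x z" "t \<in> {0..d x z}"
  obtains (start) "d x (g t) \<le> D" | (finish) "d (g t) z \<le> D"
  | (piece) V a b where "V \<in> I" "pr V x \<noteq> pr V z" "a \<in> {0..d x z}" "b \<in> {0..d x z}"
      "d (g a) (pr V x) \<le> H" "d (g b) (pr V z) \<le> H" "a - H \<le> t" "t \<le> b + H"
proof -
  note guide[OF assms]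
  then consider "d x (g t) \<le> D" | "d (g t) z \<le> D" | V a b where "V \<in> I" "pr V x \<noteq> pr V z"
      "a \<in> {0..d x z}" "b \<in> {0..d x z}"
      "d (g a) (pr V x) \<le> D" "d (g b) (pr V z) \<le> D" "a - D \<le> t" "t \<le> b + D"
    by blast
  then show thesis
  proof cases
    case (3 V a b)
    show thesis by (rule piece[of V a b]) (use 3 H_ge in auto)
  qed (use start finish in auto)
qed

end

section \<open>Hyperbolicity\<close>

lemma delta_hyperbolicD:
  assumes "delta_hyperbolic \<delta> M d" "x \<in> M" "y \<in> M" "z \<in> M" "geodesic_segment M d f x y"
    "geodesic_segment M d g y z" "geodesic_segment M d h x z" "t \<in> {0..d x y}"
  shows "\<exists>q \<in> g ` {0..d y z} \<union> h ` {0..d x z}. d (f t) q \<le> \<delta>"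
  using assms unfolding delta_hyperbolic_def by blast

text \<open>Let r be the point of \<sigma> as far from p as u is. Slimness of the triangle p, q, u
  gives a point w within \<delta> of r on one of the sides ending in u. Comparing distances to q or
  p along that side bounds the rest of it, from w to u, by \<open>c + \<delta>\<close>. The minimum
  is needed because u may be farther from p than q is.\<close>

lemma hyperbolic_aligned:
  assumes hyp: "delta_hyperbolic \<delta> Y d" and pts: "p \<in> Y" "q \<in> Y" "u \<in> Y"
    and c: "d p u + d u q \<le> d p q + c" and \<sigma>: "geodesic_segment Y d \<sigma> p q"
  shows "d u (\<sigma> (min (d p u) (d p q))) \<le> c + 2 * \<delta>"
proof -
  have geo: "geodesic_space Y d" using hyp by (simp add: delta_hyperbolic_def)
  interpret Metric_space Y d using geodesic_space_metric[OF geo] .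
  let ?\<tau> = "min (d p u) (d p q)"
  obtain h g where h: "geodesic_segment Y d h p u" and g: "geodesic_segment Y d g q u"
    using geo pts by (meson geodesic_space_def)
  have \<tau>: "?\<tau> \<in> {0..d p q}" by auto
  have r: "\<sigma> ?\<tau> \<in> Y" using geodesic_segmentD(3)[OF \<sigma> \<tau>] .
  have dr: "d p (\<sigma> ?\<tau>) = ?\<tau>" "d (\<sigma> ?\<tau>) q = d p q - ?\<tau>"
    using geodesic_segmentD(4)[OF \<sigma>, of 0 ?\<tau>] geodesic_segmentD(4)[OF \<sigma>, of ?\<tau> "d p q"]
      geodesic_segmentD(1,2)[OF \<sigma>] by auto
  obtain w where w: "w \<in> g ` {0..d q u} \<union> h ` {0..d p u}" "d (\<sigma> ?\<tau>) w \<le> \<delta>"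
    using delta_hyperbolicD[OF hyp pts \<sigma> g h \<tau>] by blast
  have tri: "d u (\<sigma> ?\<tau>) \<le> d w u + \<delta>" if "w \<in> Y"
    using triangle[OF pts(3) that r] w(2) commute[of w u] commute[of w "\<sigma> ?\<tau>"] by simp
  from w(1) have "d w u \<le> c + \<delta>"
  proof
    assume "w \<in> g ` {0..d q u}"
    then obtain s where s: "s \<in> {0..d q u}" "w = g s" by auto
    have wY: "w \<in> Y" using geodesic_segmentD(3)[OF g s(1)] s by simp
    have ws: "d q w = s" "d w u = d q u - s"
      using geodesic_segmentD(4)[OF g, of 0 s] geodesic_segmentD(4)[OF g, of s "d q u"]
        geodesic_segmentD(1,2)[OF g] s by auto
    have 1: "d p q - ?\<tau> \<le> \<delta> + s"
      using triangle[OF r wY pts(2)] w(2) dr(2) ws(1) commute[of w q] by simp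
    show ?thesis
    proof (cases "d p u \<le> d p q")
      case True
      then show ?thesis using 1 ws c commute[of u q] by simp
    next
      case False
      then show ?thesis using 1 ws c commute[of u q] s(1) w(2) nonneg[of "\<sigma> ?\<tau>" w] by simp
    qed
  next
    assume "w \<in> h ` {0..d p u}"
    then obtain s where s: "s \<in> {0..d p u}" "w = h s" by auto
    have wY: "w \<in> Y" using geodesic_segmentD(3)[OF h s(1)] s by simp
    have ws: "d p w = s" "d w u = d p u - s"
      using geodesic_segmentD(4)[OF h, of 0 s] geodesic_segmentD(4)[OF h, of s "d p u"]
        geodesic_segmentD(1,2)[OF h] s by auto
    have 1: "?\<tau> \<le> s + \<delta>"
      using triangle[OF pts(1) wY r] w(2) dr(1) ws(1) commute[of w "\<sigma> ?\<tau>"] by simp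
    show ?thesis
    proof (cases "d p u \<le> d p q")
      case True
      then show ?thesis using 1 ws c triangle[OF pts(1,3,2)] by simp
    next
      case False
      then show ?thesis using 1 ws c nonneg[of u q] by linarith
    qed
  qed
  moreover have "w \<in> Y"
    using w(1) geodesic_segmentD(3)[OF g] geodesic_segmentD(3)[OF h] by auto
  ultimately show ?thesis using tri by simp
qed

context guided
begin

text \<open>At time \<open>a + \<tau>\<close>, cut off at b, the ambient geodesic projects to a
  point at distance about \<tau> from \<open>pr V x\<close>, which by
  \<open>hyperbolic_aligned\<close> is close to \<open>\<sigma> \<tau>\<close>. The 29 units are 9
  for the error in \<tau>, 16 for the alignment and 4 for the distance from the geodesic to its
  projection.\<close>

lemma shadow_near_geodesic:
  assumes hyp: "delta_hyperbolic \<delta> (P V) d" and V: "V \<in> I" and x: "x \<in> M" and z: "z \<in> M"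
    and h: "geodesic_segment M d h x z" and ne: "pr V x \<noteq> pr V z"
    and \<sigma>: "geodesic_segment (P V) d \<sigma> (pr V x) (pr V z)" and \<tau>: "\<tau> \<in> {0..d (pr V x) (pr V z)}"
  shows "\<exists>t\<in>{0..d x z}. d (\<sigma> \<tau>) (h t) \<le> 29 * H + 2 * \<delta>"
proof -
  let ?p = "pr V x" and ?r = "pr V z"
  obtain a b where ab: "0 \<le> a" "a \<le> b" "b \<le> d x z" "d (h a) ?p \<le> H" "d (h b) ?r \<le> H"
    using visits_projections[OF h x z V ne] by (auto simp: H_def)
  define t where "t = min b (a + \<tau>)"
  have t: "t \<in> {0..d x z}" "a \<le> t" "t \<le> b" using ab \<tau> by (auto simp: t_def)
  have m: "h t \<in> M" "h a \<in> M" "h b \<in> M" using geodesic_segmentD(3)[OF h] t ab by auto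
  have u: "pr V (h t) \<in> P V" "?p \<in> P V" "?r \<in> P V" using pr_in[OF V] m x z by auto
  then have uM: "pr V (h t) \<in> M" "?p \<in> M" "?r \<in> M" using piece_sub[OF V] by auto
  have aI: "a \<in> {0..d x z}" and bI: "b \<in> {0..d x z}" using ab by auto
  have t': "a - H \<le> t" "t \<le> b + H" using t H_ge by auto
  note np = near_piece[OF h x z V ne aI bI ab(4,5) t(1) t'] near_piece_aligned[OF h x z V ne aI bI ab(4,5) t(1) t']
    near_piece_distance[OF h x z V ne aI bI ab(4,5) t(1) t']
  let ?s = "min (d ?p (pr V (h t))) (d ?p ?r)"
  have 1: "d (pr V (h t)) (\<sigma> ?s) \<le> 16 * H + 2 * \<delta>"
    using hyperbolic_aligned[OF hyp u(2,3,1) np(2) \<sigma>] .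
  have "b - a = d (h a) (h b)" using geodesic_segmentD(4)[OF h aI bI] ab by auto
  moreover have "d ?p ?r \<le> d ?p (h a) + d (h a) (h b) + d (h b) ?r"
    using triangle[of ?p "h a" ?r] triangle[of "h a" "h b" ?r] uM m by auto
  ultimately have "d ?p ?r \<le> b - a + 2 * H" using ab commute[of ?p "h a"] by simp
  then have "\<bar>t - a - \<tau>\<bar> \<le> 2 * H" using \<tau> H_ge by (auto simp: t_def min_def)
  then have "\<bar>?s - \<tau>\<bar> \<le> 9 * H" using np(3) \<tau> by (auto simp: min_def abs_le_iff)
  moreover have sI: "?s \<in> {0..d ?p ?r}" by auto
  ultimately have 2: "d (\<sigma> ?s) (\<sigma> \<tau>) \<le> 9 * H" using geodesic_segmentD(4)[OF \<sigma> sI \<tau>] by simp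
  have \<sigma>M: "\<sigma> ?s \<in> M" "\<sigma> \<tau> \<in> M" using geodesic_segmentD(3)[OF \<sigma>] sI \<tau> piece_sub[OF V] by auto
  have "d (\<sigma> \<tau>) (h t) \<le> d (\<sigma> \<tau>) (\<sigma> ?s) + d (\<sigma> ?s) (pr V (h t)) + d (pr V (h t)) (h t)"
    using triangle[of "\<sigma> \<tau>" "\<sigma> ?s" "h t"] triangle[of "\<sigma> ?s" "pr V (h t)" "h t"] \<sigma>M m uM by auto
  then show ?thesis
    using 1 2 np(1) t(1) commute[of "\<sigma> \<tau>"] commute[of "\<sigma> ?s" "pr V (h t)"] commute[of "pr V (h t)" "h t"]
    by (intro bexI[of _ t]) auto
qed

text \<open>Slimness is transferred from the triangle spanned by the projections of x, y and z to
  the piece V that guides the first side at t. The constants add up along the way from m to its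
  projection, to \<sigma>, to another side of the small triangle and back to a large side: 49 = 4 +
  16 + 29 and 5 = 2 + 1 + 2.\<close>

theorem hyperbolic_pieces:
  assumes hyp: "\<And>X. X \<in> I \<Longrightarrow> delta_hyperbolic \<delta> (P X) d" and \<delta>: "\<delta> \<ge> 0"
  shows "delta_hyperbolic (49 * H + 5 * \<delta>) M d"
  unfolding delta_hyperbolic_def
proof (intro conjI ballI allI impI)
  show "0 \<le> 49 * H + 5 * \<delta>" using H_ge \<delta> by simp
  show "geodesic_space M d" by (rule geodesic)
  fix x y z f g h m
  assume pts: "x \<in> M" "y \<in> M" "z \<in> M"
    and seg: "geodesic_segment M d f x y \<and> geodesic_segment M d g y z \<and> geodesic_segment M d h x z"
    and "m \<in> f ` {0..d x y}"
  then obtain t where t: "t \<in> {0..d x y}" "m = f t" by blast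
  have f: "geodesic_segment M d f x y" and g: "geodesic_segment M d g y z" and h: "geodesic_segment M d h x z"
    using seg by auto
  have mM: "m \<in> M" using geodesic_segmentD(3)[OF f t(1)] t(2) by simp
  let ?T = "g ` {0..d y z} \<union> h ` {0..d x z}"
  have xT: "x \<in> ?T" and yT: "y \<in> ?T"
    using geodesic_segmentD(1)[OF h] geodesic_segmentD(1)[OF g]
    by (metis UnCI atLeastAtMost_iff image_eqI nonneg order_refl)+
  from pts(1,2) f t(1) show "\<exists>q\<in>?T. d m q \<le> 49 * H + 5 * \<delta>"
  proof (cases rule: guide_cases)
    case start
    then show ?thesis using xT commute[of m x] t H_ge \<delta> by (intro bexI[of _ x]) auto
  next
    case finish
    then show ?thesis using yT t H_ge \<delta> by (intro bexI[of _ y]) auto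
  next
    case (piece V a b)
    note np = near_piece[OF f pts(1,2) piece(1-6) t(1) piece(7,8)]
      near_piece_aligned[OF f pts(1,2) piece(1-6) t(1) piece(7,8)]
    let ?p = "pr V x" and ?q = "pr V y" and ?r = "pr V z" and ?u = "pr V (f t)"
    have PV: "?p \<in> P V" "?q \<in> P V" "?r \<in> P V" "?u \<in> P V" using pr_in[OF piece(1)] pts mM t(2) by auto
    note hV = hyp[OF piece(1)]
    obtain \<sigma> \<sigma>1 \<sigma>2 where \<sigma>: "geodesic_segment (P V) d \<sigma> ?p ?q"
      and \<sigma>1: "geodesic_segment (P V) d \<sigma>1 ?q ?r" and \<sigma>2: "geodesic_segment (P V) d \<sigma>2 ?p ?r"
      using piece_geodesic[OF piece(1)] PV by (meson geodesic_space_def)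
    let ?s = "min (d ?p ?u) (d ?p ?q)"
    have 1: "d ?u (\<sigma> ?s) \<le> 16 * H + 2 * \<delta>"
      using hyperbolic_aligned[OF hV PV(1,2,4) np(2) \<sigma>] .
    have sI: "?s \<in> {0..d ?p ?q}" by auto
    obtain v where v: "v \<in> \<sigma>1 ` {0..d ?q ?r} \<union> \<sigma>2 ` {0..d ?p ?r}" "d (\<sigma> ?s) v \<le> \<delta>"
      using delta_hyperbolicD[OF hV PV(1-3) \<sigma> \<sigma>1 \<sigma>2 sI] by blast
    have sh1: "\<exists>w\<in>?T. d v w \<le> 29 * H + 2 * \<delta>" if "v \<in> \<sigma>1 ` {0..d ?q ?r}" "?q \<noteq> ?r"
      using shadow_near_geodesic[OF hV piece(1) pts(2,3) g that(2) \<sigma>1] that(1) by blast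
    have sh2: "\<exists>w\<in>?T. d v w \<le> 29 * H + 2 * \<delta>" if "v \<in> \<sigma>2 ` {0..d ?p ?r}" "?p \<noteq> ?r"
      using shadow_near_geodesic[OF hV piece(1) pts(1,3) h that(2) \<sigma>2] that(1) by blast
    have r1: "?r \<in> \<sigma>1 ` {0..d ?q ?r}" and r2: "?r \<in> \<sigma>2 ` {0..d ?p ?r}"
      using geodesic_segmentD(2)[OF \<sigma>1] geodesic_segmentD(2)[OF \<sigma>2]
      by (metis atLeastAtMost_iff image_eqI nonneg order_refl)+
    have rr: "d ?r ?r = 0" using PV piece_sub[OF piece(1)] by auto
    have e1: "v = ?r" if "v \<in> \<sigma>1 ` {0..d ?q ?r}" "?q = ?r"
      using that geodesic_segmentD(1)[OF \<sigma>1] rr by auto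
    have e2: "v = ?r" if "v \<in> \<sigma>2 ` {0..d ?p ?r}" "?p = ?r"
      using that geodesic_segmentD(1)[OF \<sigma>2] rr by auto
    obtain w where w: "w \<in> ?T" "d v w \<le> 29 * H + 2 * \<delta>"
    proof -
      \<comment> \<open>If one of the other two sides is a single point, this point is
        \<open>?r\<close>. It also lies on the remaining side, which is not degenerate since
        \<open>pr V x\<close> and \<open>pr V y\<close> differ.\<close>
      consider "v \<in> \<sigma>1 ` {0..d ?q ?r}" "?q \<noteq> ?r" | "v \<in> \<sigma>2 ` {0..d ?p ?r}" "?p \<noteq> ?r"
        | "v = ?r" "?q = ?r" "?p \<noteq> ?r" | "v = ?r" "?p = ?r" "?q \<noteq> ?r"
        using v(1) e1 e2 piece(2) by (metis UnE)
      then have "\<exists>w\<in>?T. d v w \<le> 29 * H + 2 * \<delta>"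
      proof cases
        case 1 then show ?thesis by (rule sh1)
      next
        case 2 then show ?thesis by (rule sh2)
      next
        case 3 then show ?thesis using sh2 r2 by simp
      next
        case 4 then show ?thesis using sh1 r1 by simp
      qed
      then show thesis using that by blast
    qed
    have M: "?u \<in> M" "\<sigma> ?s \<in> M" "v \<in> M" "w \<in> M"
      using PV(4) geodesic_segmentD(3)[OF \<sigma> sI] v(1) geodesic_segmentD(3)[OF \<sigma>1] geodesic_segmentD(3)[OF \<sigma>2]
        piece_sub[OF piece(1)] w(1) geodesic_segmentD(3)[OF g] geodesic_segmentD(3)[OF h] by auto
    have "d m w \<le> d m ?u + d ?u (\<sigma> ?s) + d (\<sigma> ?s) v + d v w"
      using triangle[of m ?u w] triangle[of ?u "\<sigma> ?s" w] triangle[of "\<sigma> ?s" v w] M mM by auto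
    then show ?thesis using np(1) 1 v(2) w t(2) by (intro bexI[of _ w]) auto
  qed
qed

end

section \<open>Bottlenecks\<close>

text \<open>A coarse form of Manning's bottleneck property. The step size s and the slack c in the
  position of u are left free, because projecting to a piece enlarges the steps of a path and moves
  a point of a geodesic off the geodesics of the piece.\<close>

definition bottleneck :: "'a set \<Rightarrow> ('a \<Rightarrow> 'a \<Rightarrow> real) \<Rightarrow> real \<Rightarrow> real \<Rightarrow> real \<Rightarrow> bool" where
  "bottleneck M d s c \<Delta> \<longleftrightarrow>
     (\<forall>f n u. f ` {..n} \<subseteq> M \<and> (\<forall>i<n. d (f i) (f (Suc i)) \<le> s) \<and> u \<in> M \<and>
        d (f 0) u + d u (f n) \<le> d (f 0) (f n) + c \<longrightarrow> (\<exists>i\<le>n. d (f i) u \<le> \<Delta>))"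

definition geodesic_bottleneck :: "'a set \<Rightarrow> ('a \<Rightarrow> 'a \<Rightarrow> real) \<Rightarrow> real \<Rightarrow> bool" where
  "geodesic_bottleneck M d \<Delta> \<longleftrightarrow>
     (\<forall>f n g t. f ` {..n} \<subseteq> M \<and> (\<forall>i<n. d (f i) (f (Suc i)) \<le> 1) \<and>
        geodesic_segment M d g (f 0) (f n) \<and> t \<in> {0..d (f 0) (f n)} \<longrightarrow> (\<exists>i\<le>n. d (f i) (g t) \<le> \<Delta>))"

lemma bottleneckD:
  assumes "bottleneck M d s c \<Delta>" "f ` {..n} \<subseteq> M" "\<forall>i<n. d (f i) (f (Suc i)) \<le> s" "u \<in> M"
    "d (f 0) u + d u (f n) \<le> d (f 0) (f n) + c"
  shows "\<exists>i\<le>n. d (f i) u \<le> \<Delta>"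
  using assms unfolding bottleneck_def by blast

lemma geodesic_bottleneckD:
  assumes "geodesic_bottleneck M d \<Delta>" "f ` {..n} \<subseteq> M" "\<forall>i<n. d (f i) (f (Suc i)) \<le> 1"
    "geodesic_segment M d g (f 0) (f n)" "t \<in> {0..d (f 0) (f n)}"
  shows "\<exists>i\<le>n. d (f i) (g t) \<le> \<Delta>"
  using assms unfolding geodesic_bottleneck_def by blast

text \<open>Project the coarse path to the piece V that guides the geodesic at t. Where the
  projection changes, the path is within H of it, so the projected steps stay below
  \<open>3 * H\<close> and the bottleneck of the piece applies. The bound adds up H, \<Delta> and
  the \<open>4 * H\<close> of \<open>near_piece\<close>.\<close>

theorem (in guided) bottleneck_pieces:
  assumes bot: "\<And>X. X \<in> I \<Longrightarrow> bottleneck (P X) d (3 * H) (16 * H) \<Delta>" and \<Delta>: "\<Delta> \<ge> 0"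
  shows "geodesic_bottleneck M d (5 * H + \<Delta>)"
  unfolding geodesic_bottleneck_def
proof (intro allI impI, elim conjE)
  fix f :: "nat \<Rightarrow> 'a" and n g t
  assume fM: "f ` {..n} \<subseteq> M" and step: "\<forall>i<n. d (f i) (f (Suc i)) \<le> 1"
    and g: "geodesic_segment M d g (f 0) (f n)" and t: "t \<in> {0..d (f 0) (f n)}"
  have f_in: "f i \<in> M" if "i \<le> n" for i using fM that by auto
  have x: "f 0 \<in> M" and z: "f n \<in> M" using f_in by auto
  have m: "g t \<in> M" using geodesic_segmentD(3)[OF g t] .
  from x z g t show "\<exists>i\<le>n. d (f i) (g t) \<le> 5 * H + \<Delta>"
  proof (cases rule: guide_cases)
    case start
    then show ?thesis using H_ge \<Delta> by (intro exI[of _ 0]) auto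
  next
    case finish
    then show ?thesis using H_ge \<Delta> commute[of "g t"] by (intro exI[of _ n]) auto
  next
    case (piece V a b)
    note np = near_piece[OF g x z piece(1-6) t piece(7,8)]
      near_piece_aligned[OF g x z piece(1-6) t piece(7,8)]
    let ?c = "\<lambda>i. pr V (f i)" and ?u = "pr V (g t)"
    have cP: "?c i \<in> P V" if "i \<le> n" for i using pr_in[OF piece(1) f_in[OF that]] .
    have cM: "?c i \<in> M" if "i \<le> n" for i using cP[OF that] piece_sub[OF piece(1)] by auto
    have jump: "d (f i) (?c i) \<le> H" "d (f (Suc i)) (?c (Suc i)) \<le> H" if "i < n" "?c i \<noteq> ?c (Suc i)" for i
      using pr_jump[OF piece(1) f_in[of i] f_in[of "Suc i"]] pr_jump[OF piece(1) f_in[of "Suc i"] f_in[of i]]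
        step that commute[of "f i" "f (Suc i)"] by (fastforce simp: H_def)+
    have cstep: "d (?c i) (?c (Suc i)) \<le> 3 * H" if i: "i < n" for i
    proof (cases "?c i = ?c (Suc i)")
      case True
      then show ?thesis using H_ge cM[of "Suc i"] i by auto
    next
      case False
      have "d (?c i) (?c (Suc i)) \<le> d (?c i) (f i) + d (f i) (f (Suc i)) + d (f (Suc i)) (?c (Suc i))"
        using triangle[of "?c i" "f i" "?c (Suc i)"] triangle[of "f i" "f (Suc i)" "?c (Suc i)"]
          cM[of i] cM[of "Suc i"] f_in[of i] f_in[of "Suc i"] i by auto
      then show ?thesis using jump[OF i False] step i H_ge commute[of "?c i" "f i"] by fastforce
    qed
    have "?c ` {..n} \<subseteq> P V" "\<forall>i<n. d (?c i) (?c (Suc i)) \<le> 3 * H"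
      using cP cstep by auto
    from bottleneckD[OF bot[OF piece(1)] this pr_in[OF piece(1) m] np(2)]
    obtain i where i: "i \<le> n" "d (?c i) ?u \<le> \<Delta>" by blast
    \<comment> \<open>At index i itself the path may be far from the piece. Since
      \<open>?c 0\<close> and \<open>?c n\<close> differ, the value \<open>?c i\<close> is entered
      or left at some step, and there the path is near it.\<close>
    have "\<exists>j\<le>n. ?c j = ?c i \<and> d (f j) (?c j) \<le> H"
    proof (cases "?c i = ?c 0")
      case True
      then obtain j where "j < n - i" "?c (i + j) = ?c i" "?c (i + Suc j) \<noteq> ?c i"
        using discrete_exit[of "\<lambda>j. ?c (i + j) = ?c i" "n - i"] piece(2) i by auto
      then show ?thesis using jump(1)[of "i + j"] by (intro exI[of _ "i + j"]) auto
    next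
      case False
      then obtain j where "j < i" "?c j \<noteq> ?c i" "?c (Suc j) = ?c i"
        using discrete_exit[of "\<lambda>j. ?c j \<noteq> ?c i" i] by auto
      then show ?thesis using jump(2)[of j] i by (intro exI[of _ "Suc j"]) auto
    qed
    then obtain j where j: "j \<le> n" "?c j = ?c i" "d (f j) (?c j) \<le> H" by blast
    have "d (f j) (g t) \<le> d (f j) (?c j) + d (?c j) ?u + d ?u (g t)"
      using triangle[of "f j" "?c j" "g t"] triangle[of "?c j" ?u "g t"] f_in[OF j(1)] cM[OF j(1)] m
        pr_in_M[OF piece(1) m] by auto
    then show ?thesis using j i np(1) commute[of ?u "g t"] by (intro exI[of _ j]) auto
  qed
qed

section \<open>Spaces with bottlenecks are quasi-trees\<close>

text \<open>The reflexive transitive closure describes the coarse components of S. A point outside S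
  is related to itself only, hence the membership hypotheses in what follows.\<close>

definition near :: "('a \<Rightarrow> 'a \<Rightarrow> real) \<Rightarrow> 'a set \<Rightarrow> 'a rel" where
  "near d S = {(u, v). u \<in> S \<and> v \<in> S \<and> d u v \<le> 1}"

lemma near_mono: "S \<subseteq> S' \<Longrightarrow> (near d S)\<^sup>* \<subseteq> (near d S')\<^sup>*"
  by (rule rtrancl_mono) (auto simp: near_def)

lemma geodesic_near:
  assumes g: "geodesic_segment M d g x y" and L: "d x y \<ge> 0" and S: "g ` {0..d x y} \<subseteq> S"
  shows "(x, y) \<in> (near d S)\<^sup>*"
proof -
  from geodesic_chain[OF g L]
  obtain \<tau> and N :: nat where \<tau>: "\<tau> 0 = 0" "\<tau> N = d x y" "mono \<tau>"
    "\<forall>i. \<tau> i \<in> {0..d x y}" "\<forall>i. d (g (\<tau> i)) (g (\<tau> (Suc i))) \<le> 1" "real N \<le> d x y + 1" .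
  have "(g (\<tau> 0), g (\<tau> i)) \<in> (near d S)\<^sup>*" for i
  proof (induction i)
    case (Suc i)
    have "(g (\<tau> i), g (\<tau> (Suc i))) \<in> near d S" using \<tau>(4,5) S unfolding near_def by blast
    then show ?case using Suc by simp
  qed simp
  from this[of N] show ?thesis using \<tau>(1,2) geodesic_segmentD(1,2)[OF g] by simp
qed

text \<open>The tree records how the space branches when seen from a base point \<open>b\<close>: its vertices are
  the coarse components of the complements of the balls around \<open>b\<close> with integral radius.\<close>

locale bottleneck_space =
  fixes M :: "'a set" and d :: "'a \<Rightarrow> 'a \<Rightarrow> real" and \<Delta> :: real and b :: 'a
  assumes geodesic: "geodesic_space M d" and b: "b \<in> M"
    and \<Delta>: "\<Delta> \<ge> 0" and bottleneck: "geodesic_bottleneck M d \<Delta>"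
begin

sublocale Metric_space M d
  using geodesic by (rule geodesic_space_metric)

lemma bottleneck_near:
  assumes S: "S \<subseteq> M" "x \<in> S" and xy: "(x, y) \<in> (near d S)\<^sup>*"
    and g: "geodesic_segment M d g x y" and t: "t \<in> {0..d x y}"
  shows "\<exists>w\<in>S. d w (g t) \<le> \<Delta>"
proof -
  obtain n where "(x, y) \<in> near d S ^^ n" using rtrancl_imp_relpow[OF xy] by blast
  then obtain f where f: "f 0 = x" "f n = y" "\<forall>i<n. (f i, f (Suc i)) \<in> near d S"
    by (auto simp: relpow_fun_conv)
  have fS: "f i \<in> S" if "i \<le> n" for i
  proof (cases i)
    case 0 then show ?thesis using f S by simp
  next
    case (Suc j) then show ?thesis using f(3)[rule_format, of j] that by (simp add: near_def)
  qed
  have "f ` {..n} \<subseteq> M" "\<forall>i<n. d (f i) (f (Suc i)) \<le> 1"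
    using f(3) fS S(1) by (auto simp: near_def)
  then obtain i where "i \<le> n" "d (f i) (g t) \<le> \<Delta>"
    using geodesic_bottleneckD[OF bottleneck, of f n g t] f(1,2) g t by auto
  then show ?thesis using fS by blast
qed

section \<open>Branches seen from the base point\<close>

definition outside :: "nat \<Rightarrow> 'a set" where
  "outside n = {y \<in> M. real n \<le> d b y}"

definition branch :: "nat \<Rightarrow> 'a \<Rightarrow> 'a set" where
  "branch n x = (near d (outside n))\<^sup>* `` {x}"

lemma outside_M: "x \<in> outside n \<Longrightarrow> x \<in> M" and outside_ge: "x \<in> outside n \<Longrightarrow> real n \<le> d b x"
  by (auto simp: outside_def)

lemma outside_mono: "n \<le> m \<Longrightarrow> outside m \<subseteq> outside n"
  by (auto simp: outside_def)

lemma branch_sub: "x \<in> outside n \<Longrightarrow> branch n x \<subseteq> outside n"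
proof
  fix y assume x: "x \<in> outside n" and "y \<in> branch n x"
  then have "(x, y) \<in> (near d (outside n))\<^sup>*" by (simp add: branch_def)
  then show "y \<in> outside n" by (induction rule: rtrancl_induct) (auto simp: x near_def)
qed

lemma sym_near: "sym ((near d S)\<^sup>*)"
  by (rule sym_rtrancl) (auto simp: sym_def near_def commute)

lemma branch_eq:
  assumes "y \<in> branch n x"
  shows "branch n y = branch n x"
proof -
  have xy: "(x, y) \<in> (near d (outside n))\<^sup>*" using assms by (simp add: branch_def)
  then have "(y, x) \<in> (near d (outside n))\<^sup>*" using sym_near by (meson symD)
  then show ?thesis using xy rtrancl_trans by (fastforce simp: branch_def)
qed

lemma branch_mono: "n \<le> m \<Longrightarrow> branch m x \<subseteq> branch n x"
  using near_mono[OF outside_mono, of n m d] by (auto simp: branch_def)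

text \<open>Beyond distance n from b, a geodesic from b to x stays outside the ball.\<close>

lemma branch_descends:
  assumes x: "x \<in> outside n"
  shows "\<exists>y\<in>branch n x. d b y = real n"
proof -
  have xM: "x \<in> M" and xn: "real n \<le> d b x" using x by (auto simp: outside_def)
  obtain g where g: "geodesic_segment M d g b x" using geodesic b xM by (meson geodesic_space_def)
  have gd: "d b (g s) = s" if "s \<in> {0..d b x}" for s
    using geodesic_segmentD(4)[OF g, of 0 s] geodesic_segmentD(1)[OF g] that by auto
  have seg: "geodesic_segment M d (\<lambda>\<tau>. g (real n + \<tau>)) (g (real n)) x" and L: "d (g (real n)) x = d b x - real n"
    using geodesic_subsegment[OF g, of "real n" "d b x"] xn geodesic_segmentD(2)[OF g] by auto
  have "(\<lambda>\<tau>. g (real n + \<tau>)) ` {0..d (g (real n)) x} \<subseteq> outside n"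
    using L geodesic_segmentD(3)[OF g] gd by (auto simp: outside_def)
  from geodesic_near[OF seg nonneg this] have "(x, g (real n)) \<in> (near d (outside n))\<^sup>*"
    using sym_near by (meson symD)
  then show ?thesis using gd[of "real n"] xn by (intro bexI[of _ "g (real n)"]) (auto simp: branch_def)
qed

text \<open>Manning's argument at the midpoint m of x and y. A coarse path outside the ball of
  radius n passes near m, so m is at distance at least \<open>n - \<Delta>\<close> from b. The
  detour through b passes near m as well, at a point u of a geodesic from b to x or y; as u is not
  much nearer to b than n, it is close to x or y. Hence half of the distance is at most
  \<open>2 + 3 * \<Delta>\<close>.\<close>

lemma branch_narrow:
  assumes x: "x \<in> outside n" and y: "y \<in> branch n x" and dx: "d b x \<le> real n + 2" and dy: "d b y \<le> real n + 2"
  shows "d x y \<le> 4 + 6 * \<Delta>"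
proof -
  have xM: "x \<in> M" and yM: "y \<in> M" using x branch_sub[OF x] y outside_M by auto
  obtain g where g: "geodesic_segment M d g x y" using geodesic xM yM by (meson geodesic_space_def)
  let ?m = "g (d x y / 2)"
  have t: "d x y / 2 \<in> {0..d x y}" by auto
  have m: "?m \<in> M" using geodesic_segmentD(3)[OF g t] .
  have dm: "d x ?m = d x y / 2" "d ?m y = d x y / 2"
    using geodesic_segmentD(4)[OF g _ t, of 0] geodesic_segmentD(4)[OF g t, of "d x y"]
      geodesic_segmentD(1,2)[OF g] by auto
  have "(x, y) \<in> (near d (outside n))\<^sup>*" using y by (simp add: branch_def)
  from bottleneck_near[OF _ x this g t] obtain w where w: "w \<in> outside n" "d w ?m \<le> \<Delta>"
    by (auto simp: outside_def)
  have far: "d b ?m \<ge> real n - \<Delta>"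
    using triangle[OF b m outside_M[OF w(1)]] w outside_ge[OF w(1)] commute[of w ?m] by linarith
  \<comment> \<open>Contains every geodesic from x or y to b, and each of its points has an exact
    distance splitting.\<close>
  define S where "S = {u \<in> M. d x u + d u b = d x b \<or> d y u + d u b = d y b}"
  have to_b: "(z, b) \<in> (near d S)\<^sup>*" if z: "z = x \<or> z = y" for z
  proof -
    have zM: "z \<in> M" using z xM yM by auto
    obtain h where h: "geodesic_segment M d h z b" using geodesic zM b by (meson geodesic_space_def)
    have "d z (h s) + d (h s) b = d z b" if "s \<in> {0..d z b}" for s
      using geodesic_segmentD(4)[OF h, of 0 s] geodesic_segmentD(4)[OF h, of s "d z b"]
        geodesic_segmentD(1,2)[OF h] that by auto
    then have "h ` {0..d z b} \<subseteq> S" using z geodesic_segmentD(3)[OF h] by (auto simp: S_def)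
    from geodesic_near[OF h nonneg this] show ?thesis .
  qed
  have "(x, y) \<in> (near d S)\<^sup>*"
    using rtrancl_trans[OF to_b[of x] symD[OF sym_near to_b[of y]]] by simp
  from bottleneck_near[OF _ _ this g t] obtain u where u: "u \<in> S" "d u ?m \<le> \<Delta>"
    using xM b by (auto simp: S_def)
  have uM: "u \<in> M" using u by (simp add: S_def)
  have du: "d u b \<ge> d b ?m - \<Delta>"
    using triangle[OF b uM m] u(2) commute[of b u] by linarith
  from u(1) consider "d x u + d u b = d x b" | "d y u + d u b = d y b" by (auto simp: S_def)
  then show ?thesis
  proof cases
    case 1
    then show ?thesis
      using triangle[OF xM uM m] u(2) du far dx dm commute[of x b] by linarith
  next
    case 2
    then show ?thesis
      using triangle[OF yM uM m] u(2) du far dy dm commute[of y b] commute[of ?m y] by linarith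
  qed
qed

section \<open>The tree of branches\<close>

definition level :: "'a set \<Rightarrow> nat" where
  "level C = nat \<lfloor>INF y\<in>C. d b y\<rfloor>"

definition rep :: "'a set \<Rightarrow> 'a" where
  "rep C = (SOME y. y \<in> C \<and> d b y = real (level C))"

definition parent :: "'a set \<Rightarrow> 'a set" where
  "parent C = branch (level C - 1) (rep C)"

definition branches :: "'a set set" where
  "branches = {branch n x | n x. x \<in> outside n}"

text \<open>Each vertex of positive level owns exactly one edge, named by the pair with its parent;
  the root is \<open>branch 0 b\<close>, which is all of M. The types are those prescribed by
  \<open>quasi_tree\<close>.\<close>

definition branch_tree :: "('a set, 'a set \<times> 'a set) mgraph" where
  "branch_tree = \<lparr> mverts = branches, medges = {(C, parent C) | C. C \<in> branches \<and> level C > 0},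
     mtail = fst, mhead = snd, mlen = (\<lambda>_. 1) \<rparr>"

text \<open>Recovers the radius from the set alone, so that vertices of the tree can be plain
  subsets of M without a tag for the radius.\<close>

lemma level_branch:
  assumes x: "x \<in> outside n"
  shows "level (branch n x) = n"
proof -
  obtain y where y: "y \<in> branch n x" "d b y = real n" using branch_descends[OF x] by blast
  have "(INF y\<in>branch n x. d b y) = real n"
    using y branch_sub[OF x] outside_ge by (intro cInf_eq_minimum) (auto simp: image_iff intro!: bexI[of _ y])
  then show ?thesis by (simp add: level_def)
qed

lemma branch_cases:
  assumes "C \<in> branches"
  obtains n x where "x \<in> outside n" "C = branch n x" "level C = n"
  using assms level_branch by (auto simp: branches_def)

lemma rep:
  assumes "C \<in> branches"
  shows "rep C \<in> C" "d b (rep C) = real (level C)" "rep C \<in> outside (level C)" "branch (level C) (rep C) = C"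
proof -
  obtain n x where C: "x \<in> outside n" "C = branch n x" "level C = n" using branch_cases[OF assms] .
  have "rep C \<in> C \<and> d b (rep C) = real (level C)"
    unfolding rep_def
  proof (rule someI_ex)
    obtain y where "y \<in> branch n x" "d b y = real n" using branch_descends[OF C(1)] by blast
    then show "\<exists>y. y \<in> C \<and> d b y = real (level C)"
      by (intro exI[of _ y]) (simp add: C(2) level_branch[OF C(1)])
  qed
  then show "rep C \<in> C" "d b (rep C) = real (level C)" by auto
  then show "rep C \<in> outside (level C)" "branch (level C) (rep C) = C"
    using C branch_sub[OF C(1)] branch_eq by auto
qed

lemma branch_in: "x \<in> outside n \<Longrightarrow> branch n x \<in> branches"
  by (auto simp: branches_def)

lemma rep_outside: "C \<in> branches \<Longrightarrow> rep C \<in> outside (level C - 1)"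
  using rep(3)[of C] outside_mono[of "level C - 1" "level C"] by auto

lemma parent:
  assumes "C \<in> branches"
  shows "parent C \<in> branches" "level (parent C) = level C - 1"
  using rep_outside[OF assms] by (auto simp: parent_def branch_in level_branch)

lemma parent_branch:
  assumes x: "x \<in> outside (Suc n)"
  shows "parent (branch (Suc n) x) = branch n x"
proof -
  let ?C = "branch (Suc n) x"
  have "rep ?C \<in> branch n x" using rep(1)[OF branch_in[OF x]] branch_mono[of n "Suc n"] by auto
  then show ?thesis using branch_eq level_branch[OF x] by (simp add: parent_def)
qed

lemma branch_0: "x \<in> M \<Longrightarrow> branch 0 x = branch 0 b"
proof -
  assume x: "x \<in> M"
  obtain g where g: "geodesic_segment M d g b x" using geodesic b x by (meson geodesic_space_def)
  have "g ` {0..d b x} \<subseteq> outside 0" using geodesic_segmentD(3)[OF g] by (auto simp: outside_def)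
  from geodesic_near[OF g nonneg this] have "x \<in> branch 0 b" by (simp add: branch_def)
  then show ?thesis by (rule branch_eq)
qed

lemma branch_tree_simps [simp]:
  "mverts branch_tree = branches" "mtail branch_tree = fst" "mhead branch_tree = snd" "mlen branch_tree e = 1"
  "medges branch_tree = {(C, parent C) | C. C \<in> branches \<and> level C > 0}"
  by (auto simp: branch_tree_def)

lemma branch_tree_connected: "connected_mgraph branch_tree"
proof -
  let ?R = "\<Union>e\<in>medges branch_tree. {(mtail branch_tree e, mhead branch_tree e), (mhead branch_tree e, mtail branch_tree e)}"
  have root: "(C, branch 0 b) \<in> ?R\<^sup>*" if "C \<in> branches" "level C = n" for C n
    using that
  proof (induction n arbitrary: C)
    case 0
    then have "C = branch 0 b" using rep(3,4)[of C] branch_0[of "rep C"] outside_M by auto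
    then show ?case by simp
  next
    case (Suc n)
    have "(C, parent C) \<in> ?R" using Suc.prems by force
    moreover have "(parent C, branch 0 b) \<in> ?R\<^sup>*" using Suc parent[of C] by simp
    ultimately show ?case by (rule converse_rtrancl_into_rtrancl)
  qed
  have "sym ?R" by (auto simp: sym_def)
  then have "sym (?R\<^sup>*)" by (rule sym_rtrancl)
  then show ?thesis unfolding connected_mgraph_def branch_tree_simps(1) using root
    by (meson rtrancl_trans symD)
qed

lemma branch_tree_tree: "tree_mgraph branch_tree"
  unfolding tree_mgraph_def
proof (intro conjI notI)
  show "wf_mgraph branch_tree" by (auto simp: wf_mgraph_def parent)
  show "unit_mgraph branch_tree" by (simp add: unit_mgraph_def)
  show "connected_mgraph branch_tree" by (rule branch_tree_connected)
  assume "\<exists>vs es. is_cycle branch_tree vs es"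
  then obtain vs es where es: "es \<noteq> []" "length vs = length es" "distinct vs" "distinct es"
    and sub: "set es \<subseteq> medges branch_tree"
    and inc: "\<And>i. i < length es \<Longrightarrow> {fst (es ! i), snd (es ! i)} = {vs ! i, vs ! (Suc i mod length es)}"
    unfolding is_cycle_def by auto
  let ?n = "length es"
  have n: "?n > 0" using es by simp
  obtain i where i: "i < ?n" "\<And>j. j < ?n \<Longrightarrow> level (vs ! j) \<le> level (vs ! i)"
  proof -
    have "finite (level ` set vs)" "level ` set vs \<noteq> {}" using es n by auto
    then have "Max (level ` set vs) \<in> level ` set vs" by (rule Max_in)
    then obtain i where "i < ?n" "level (vs ! i) = Max (level ` set vs)"
      by (metis (no_types, lifting) es(2) imageE in_set_conv_nth)
    then show thesis using that es(2) by simp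
  qed
  \<comment> \<open>Both edges of the cycle at a vertex of maximal level would lead to its parent.\<close>
  have edge: "es ! j = (vs ! i, parent (vs ! i))"
    if j: "j < ?n" "vs ! i \<in> {vs ! j, vs ! (Suc j mod ?n)}" for j
  proof -
    obtain C where C: "es ! j = (C, parent C)" "C \<in> branches" "level C > 0"
      using sub nth_mem[OF j(1)] by force
    have inc': "{C, parent C} = {vs ! j, vs ! (Suc j mod ?n)}" using inc[OF j(1)] C by simp
    then have "level C \<le> level (vs ! i)"
      using i(2)[OF j(1)] i(2)[of "Suc j mod ?n"] n by (metis insert_iff mod_less_divisor singletonD)
    moreover have "level (parent C) < level C" using parent[OF C(2)] C(3) by simp
    moreover have "vs ! i = C \<or> vs ! i = parent C" using j(2) inc' by blast
    ultimately have "vs ! i = C" by (metis not_le)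
    then show ?thesis using C(1) by simp
  qed
  define k where "k = (if i = 0 then ?n - 1 else i - 1)"
  have k: "k < ?n" "Suc k mod ?n = i" using i n by (auto simp: k_def)
  have "es ! i = es ! k" using edge[of i] edge[of k] k i by simp
  then have "i = k" using es(4) i k by (simp add: nth_eq_iff_index_eq)
  \<comment> \<open>The two edges at a vertex of a cycle coincide only if the cycle is a loop, that
    is, if the vertex is its own parent; the levels exclude this.\<close>
  then have n1: "?n = 1" "i = 0" using k n i by (auto simp: k_def split: if_splits)
  then have e0: "es ! 0 = (vs ! 0, parent (vs ! 0))" using edge[of 0] by simp
  then have "vs ! 0 \<in> branches" "level (vs ! 0) > 0" using sub nth_mem[of 0 es] n by force+
  moreover have "parent (vs ! 0) = vs ! 0" using inc[of 0] e0 n1 by auto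
  ultimately show False using parent[of "vs ! 0"] by simp
qed

sublocale tree: length_graph branch_tree
  using branch_tree_tree by unfold_locales (auto simp: tree_mgraph_def)

section \<open>The map to the tree\<close>

definition floor_level :: "'a \<Rightarrow> nat" where
  "floor_level x = nat \<lfloor>d b x\<rfloor>"

lemma floor_level: "real (floor_level x) \<le> d b x" "d b x < real (floor_level x) + 1"
  using nonneg[of b x] by (simp_all add: floor_level_def)

lemma floor_level_outside: "x \<in> M \<Longrightarrow> x \<in> outside (floor_level x)"
  using floor_level(1) by (simp add: outside_def)

definition to_tree :: "'a \<Rightarrow> 'a set" where
  "to_tree x = branch (floor_level x) x"

lemma to_tree_in: "x \<in> M \<Longrightarrow> to_tree x \<in> branches"
  by (simp add: to_tree_def branch_in floor_level_outside)

lemma level_to_tree: "x \<in> M \<Longrightarrow> level (to_tree x) = floor_level x"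
  by (simp add: to_tree_def level_branch floor_level_outside)

lemma parent_dist:
  assumes "C \<in> branches" "level C > 0"
  shows "gdist branch_tree (Vert C) (Vert (parent C)) \<le> 1"
  using tree.gdist_edge_ends[of "(C, parent C)"] assms by auto

text \<open>Points at distance at most 1 differ by at most one level and lie in one coarse component
  outside the smaller ball. So their images agree or one is the parent of the other.\<close>

lemma to_tree_step:
  assumes x: "x \<in> M" and y: "y \<in> M" and xy: "d x y \<le> 1" and le: "floor_level x \<le> floor_level y"
  shows "gdist branch_tree (Vert (to_tree x)) (Vert (to_tree y)) \<le> 1"
proof -
  let ?n = "floor_level x"
  have "floor_level y \<le> Suc ?n"
    using triangle[OF b x y] xy floor_level[of x] floor_level[of y] by linarith
  then consider "floor_level y = ?n" | "floor_level y = Suc ?n" using le by linarith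
  moreover have yn: "y \<in> outside ?n" using floor_level_outside[OF y] outside_mono[OF le] by auto
  have "(x, y) \<in> near d (outside ?n)" using yn floor_level_outside[OF x] xy by (auto simp: near_def)
  then have e: "branch ?n y = branch ?n x" by (intro branch_eq) (auto simp: branch_def)
  ultimately show ?thesis
  proof cases
    case 1
    then show ?thesis using e to_tree_in[OF x] by (simp add: to_tree_def)
  next
    case 2
    then have "parent (to_tree y) = to_tree x"
      using parent_branch[of y ?n] floor_level_outside[OF y] e by (simp add: to_tree_def)
    then show ?thesis
      using parent_dist[OF to_tree_in[OF y]] level_to_tree[OF y] 2 tree.commute by simp
  qed
qed

lemma to_tree_upper:
  assumes x: "x \<in> M" and y: "y \<in> M"
  shows "gdist branch_tree (Vert (to_tree x)) (Vert (to_tree y)) \<le> d x y + 1"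
proof -
  obtain g where g: "geodesic_segment M d g x y" using geodesic x y by (meson geodesic_space_def)
  from geodesic_chain[OF g nonneg]
  obtain \<tau> and N :: nat where \<tau>: "\<tau> 0 = 0" "\<tau> N = d x y" "mono \<tau>"
    "\<forall>i. \<tau> i \<in> {0..d x y}" "\<forall>i. d (g (\<tau> i)) (g (\<tau> (Suc i))) \<le> 1" "real N \<le> d x y + 1" .
  have gM: "g (\<tau> i) \<in> M" for i using geodesic_segmentD(3)[OF g] \<tau>(4) by blast
  let ?F = "\<lambda>i. Vert (to_tree (g (\<tau> i)))"
  have Fin: "?F i \<in> gpoints branch_tree" for i using to_tree_in[OF gM] by simp
  have step: "gdist branch_tree (?F i) (?F (Suc i)) \<le> 1" for i
  proof (cases "floor_level (g (\<tau> i)) \<le> floor_level (g (\<tau> (Suc i)))")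
    case True
    then show ?thesis using to_tree_step[OF gM gM] \<tau>(5) by blast
  next
    case False
    have "d (g (\<tau> (Suc i))) (g (\<tau> i)) \<le> 1" using \<tau>(5) commute by simp
    then have "gdist branch_tree (?F (Suc i)) (?F i) \<le> 1" using to_tree_step[OF gM gM] False by simp
    then show ?thesis using tree.commute by simp
  qed
  have "gdist branch_tree (?F 0) (?F i) \<le> real i" for i
  proof (induction i)
    case 0
    show ?case using Fin by simp
  next
    case (Suc i)
    show ?case using tree.triangle[OF Fin[of 0] Fin[of i] Fin[of "Suc i"]] step[of i] Suc by simp
  qed
  from this[of N] show ?thesis using \<tau>(1,2,6) geodesic_segmentD(1,2)[OF g] by simp
qed

text \<open>The potential is the distance from x to the representative of a branch, divided by
  \<open>4 + 6 * \<Delta>\<close>; by \<open>branch_narrow\<close> it changes by at most 1 along an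
  edge of the tree. The additional 2 pays for replacing x and y by the representatives of their
  images.\<close>

lemma to_tree_lower:
  assumes x: "x \<in> M" and y: "y \<in> M"
  shows "d x y \<le> (4 + 6 * \<Delta>) * (gdist branch_tree (Vert (to_tree x)) (Vert (to_tree y)) + 2)"
proof -
  let ?c = "4 + 6 * \<Delta>"
  have c: "?c > 0" using \<Delta> by simp
  define \<phi> where "\<phi> C = d x (rep C) / ?c" for C
  have repM: "rep C \<in> M" if "C \<in> branches" for C using rep(3)[OF that] outside_M by blast
  have diff: "\<bar>d x u - d x v\<bar> \<le> d u v" if "u \<in> M" "v \<in> M" for u v
    using triangle[OF x that] triangle[OF x that(2,1)] commute[of u v] by linarith
  have 1: "d (rep C) (rep (parent C)) \<le> ?c" if C: "C \<in> branches" "level C > 0" for C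
  proof -
    have "rep (parent C) \<in> branch (level C - 1) (rep C)"
      using rep(1)[OF parent(1)[OF C(1)]] by (simp add: parent_def)
    moreover have "d b (rep C) \<le> real (level C - 1) + 2" "d b (rep (parent C)) \<le> real (level C - 1) + 2"
      using rep(2)[OF C(1)] rep(2)[OF parent(1)[OF C(1)]] parent(2)[OF C(1)] C(2) by auto
    ultimately show ?thesis using branch_narrow[OF rep_outside[OF C(1)]] by blast
  qed
  have "\<bar>\<phi> (to_tree x) - \<phi> (to_tree y)\<bar> \<le> gdist branch_tree (Vert (to_tree x)) (Vert (to_tree y))"
  proof (rule tree.vertex_Lipschitz)
    fix e assume "e \<in> medges branch_tree"
    then obtain C where C: "e = (C, parent C)" "C \<in> branches" "level C > 0" by auto
    have "\<bar>d x (rep C) - d x (rep (parent C))\<bar> \<le> ?c"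
      using diff[OF repM repM] 1[OF C(2,3)] C(2) parent(1)[OF C(2)] by (meson order_trans)
    then have "\<bar>\<phi> C - \<phi> (parent C)\<bar> \<le> 1"
      using c by (simp add: \<phi>_def diff_divide_distrib[symmetric])
    then show "\<bar>\<phi> (mtail branch_tree e) - \<phi> (mhead branch_tree e)\<bar> \<le> mlen branch_tree e" using C by simp
  qed (use to_tree_in x y in auto)
  moreover have near_rep: "d z (rep (to_tree z)) \<le> ?c" if z: "z \<in> M" for z
  proof (rule branch_narrow[OF floor_level_outside[OF z]])
    show "rep (to_tree z) \<in> branch (floor_level z) z"
      using rep(1)[OF to_tree_in[OF z]] by (simp add: to_tree_def)
    show "d b z \<le> real (floor_level z) + 2" using floor_level[of z] by linarith
    show "d b (rep (to_tree z)) \<le> real (floor_level z) + 2"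
      using rep(2)[OF to_tree_in[OF z]] level_to_tree[OF z] by simp
  qed
  have rx: "rep (to_tree x) \<in> M" and ry: "rep (to_tree y) \<in> M" using repM to_tree_in x y by auto
  have "d x y \<le> d x (rep (to_tree y)) + ?c"
    using triangle[OF x ry y] near_rep[OF y] commute[of "rep (to_tree y)" y] by linarith
  moreover have "d x (rep (to_tree y)) = ?c * \<phi> (to_tree y)" using c by (simp add: \<phi>_def)
  moreover have "\<phi> (to_tree x) \<le> 1" using near_rep[OF x] c by (simp add: \<phi>_def)
  ultimately have "d x y \<le> ?c * \<phi> (to_tree y) + ?c"
    "\<phi> (to_tree y) \<le> gdist branch_tree (Vert (to_tree x)) (Vert (to_tree y)) + 1" by linarith+
  then have "d x y \<le> ?c * (gdist branch_tree (Vert (to_tree x)) (Vert (to_tree y)) + 1) + ?c"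
    using mult_left_mono[of "\<phi> (to_tree y)" "gdist branch_tree (Vert (to_tree x)) (Vert (to_tree y)) + 1" ?c] c
    by linarith
  then show ?thesis by (simp add: algebra_simps)
qed

lemma to_tree_quasi_isometry:
  "quasi_isometry (4 + 6 * \<Delta>) 2 M d (gpoints branch_tree) (gdist branch_tree) (\<lambda>x. Vert (to_tree x))"
  unfolding quasi_isometry_def
proof (intro conjI ballI)
  let ?c = "4 + 6 * \<Delta>"
  show "1 \<le> ?c" using \<Delta> by simp
  show "(0::real) \<le> 2" by simp
  show "(\<lambda>x. Vert (to_tree x)) \<in> M \<rightarrow> gpoints branch_tree" using to_tree_in by auto
  fix x y assume x: "x \<in> M" and y: "y \<in> M"
  show "d x y / ?c - 2 \<le> gdist branch_tree (Vert (to_tree x)) (Vert (to_tree y))"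
    using to_tree_lower[OF x y] \<Delta> by (simp add: field_simps)
  have "d x y \<le> ?c * d x y" using \<Delta> mult_right_mono[of 1 ?c "d x y"] by simp
  then show "gdist branch_tree (Vert (to_tree x)) (Vert (to_tree y)) \<le> ?c * d x y + 2"
    using to_tree_upper[OF x y] by linarith
next
  have onto: "to_tree (rep C) = C" "rep C \<in> M" if "C \<in> branches" for C
    using rep[OF that] outside_M by (auto simp: to_tree_def floor_level_def)
  fix z assume z: "z \<in> gpoints branch_tree"
  then show "\<exists>x\<in>M. gdist branch_tree (Vert (to_tree x)) z \<le> 2"
  proof (cases rule: tree.gpoint_cases)
    case (1 C)
    then show ?thesis using onto[of C] by (intro bexI[of _ "rep C"]) auto
  next
    case (2 e t)
    then obtain C where C: "e = (C, parent C)" "C \<in> branches" by auto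
    have "gdist branch_tree z (Vert C) \<le> t" using tree.gdist_gends[OF z, of C t] 2 C by simp
    then show ?thesis using onto[OF C(2)] 2 tree.commute[of z] by (intro bexI[of _ "rep C"]) auto
  qed
qed

end

theorem bottleneck_quasi_tree:
  assumes geo: "geodesic_space M d" and bot: "geodesic_bottleneck M d \<Delta>" and \<Delta>: "\<Delta> \<ge> 0"
  shows "quasi_tree M d"
proof (cases "M = {}")
  case True
  \<comment> \<open>There is no base point to start from; the graph without vertices counts as a
    tree and is isometric to M.\<close>
  let ?T = "\<lparr> mverts = {}, medges = {}, mtail = fst, mhead = snd, mlen = \<lambda>_. 1 \<rparr> :: ('a set, 'a set \<times> 'a set) mgraph"
  have "tree_mgraph ?T"
    by (auto simp: tree_mgraph_def wf_mgraph_def unit_mgraph_def connected_mgraph_def is_cycle_def)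
  moreover have "quasi_isometry 1 0 M d (gpoints ?T) (gdist ?T) f" for f
    using True by (auto simp: quasi_isometry_def gpoints_def)
  ultimately show ?thesis using geo unfolding quasi_tree_def by blast
next
  case False
  then obtain b where "b \<in> M" by blast
  then interpret bottleneck_space M d \<Delta> b using assms by unfold_locales
  show ?thesis using geo branch_tree_tree to_tree_quasi_isometry unfolding quasi_tree_def by blast
qed

section \<open>Quasi-isometries to trees produce bottlenecks\<close>

text \<open>Loop erasure: if the new end z already occurs, the path is cut back to it. Distinctness
  of the edges follows from that of the vertices, as an old edge equal to e would have z as an
  end.\<close>

lemma distinct_path:
  assumes "(u, v) \<in> {(a, b). \<exists>e\<in>E. {t e, h e} = {a, b}}\<^sup>*"
  shows "\<exists>vs es. length vs = Suc (length es) \<and> vs ! 0 = u \<and> vs ! length es = v \<and> distinct vs \<and>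
     distinct es \<and> set es \<subseteq> E \<and> (\<forall>i<length es. {t (es ! i), h (es ! i)} = {vs ! i, vs ! Suc i})"
  using assms
proof (induction rule: rtrancl_induct)
  case base
  show ?case by (intro exI[of _ "[u]"] exI[of _ "[]"]) auto
next
  case (step y z)
  obtain vs es where *: "length vs = Suc (length es)" "vs ! 0 = u" "vs ! length es = y" "distinct vs"
    "distinct es" "set es \<subseteq> E" "\<And>i. i < length es \<Longrightarrow> {t (es ! i), h (es ! i)} = {vs ! i, vs ! Suc i}"
    using step.IH by blast
  obtain e where e: "e \<in> E" "{t e, h e} = {y, z}" using step.hyps by auto
  show ?case
  proof (cases "z \<in> set vs")
    case True
    then obtain k where k: "k < length vs" "vs ! k = z" by (auto simp: in_set_conv_nth)
    have "set (take k es) \<subseteq> E" using *(6) set_take_subset by (rule subset_trans[rotated])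
    moreover have "k \<le> length es" using k *(1) by simp
    moreover have "{t (take k es ! i), h (take k es ! i)} = {take (Suc k) vs ! i, take (Suc k) vs ! Suc i}"
      if "i < k" for i
      using *(7)[of i] that \<open>k \<le> length es\<close> by simp
    ultimately show ?thesis
      using *(1,2,4,5) k(2) by (intro exI[of _ "take (Suc k) vs"] exI[of _ "take k es"]) simp
  next
    case False
    have "e \<notin> set es"
    proof
      assume "e \<in> set es"
      then obtain i where i: "i < length es" "es ! i = e" by (auto simp: in_set_conv_nth)
      then have "z \<in> {vs ! i, vs ! Suc i}" using *(7)[of i] e(2) by auto
      then show False using False i *(1) by auto
    qed
    moreover have "{t ((es @ [e]) ! i), h ((es @ [e]) ! i)} = {(vs @ [z]) ! i, (vs @ [z]) ! Suc i}"
      if "i < Suc (length es)" for i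
      using that *(1,3) *(7)[of i] e(2) by (auto simp: nth_append less_Suc_eq)
    ultimately show ?thesis
      using * e(1) False by (intro exI[of _ "vs @ [z]"] exI[of _ "es @ [e]"]) (auto simp: nth_append)
  qed
qed

text \<open>\<sigma> tells on which side of e a vertex lies: it is reachability from the tail
  without using e. If the head were reachable, e would close a simple path to a cycle; for a loop
  that path is empty.\<close>

lemma tree_bridge:
  assumes T: "tree_mgraph T" and e: "e \<in> medges T"
  shows "\<exists>\<sigma>. \<sigma> (mtail T e) \<noteq> \<sigma> (mhead T e) \<and>
    (\<forall>e'\<in>medges T. e' \<noteq> e \<longrightarrow> (\<sigma> (mtail T e') \<longleftrightarrow> \<sigma> (mhead T e')))"
proof -
  let ?E = "medges T - {e}"
  let ?R = "{(a, b). \<exists>e\<in>?E. {mtail T e, mhead T e} = {a, b}}"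
  define \<sigma> where "\<sigma> v \<longleftrightarrow> (mtail T e, v) \<in> ?R\<^sup>*" for v
  have "\<not> \<sigma> (mhead T e)"
  proof
    assume "\<sigma> (mhead T e)"
    from distinct_path[OF this[unfolded \<sigma>_def]] obtain vs es
      where *: "length vs = Suc (length es)" "vs ! 0 = mtail T e" "vs ! length es = mhead T e" "distinct vs"
        "distinct es" "set es \<subseteq> ?E"
        "\<And>i. i < length es \<Longrightarrow> {mtail T (es ! i), mhead T (es ! i)} = {vs ! i, vs ! Suc i}"
      by blast
    have "is_cycle T vs (es @ [e])"
      unfolding is_cycle_def
    proof (intro conjI allI impI)
      fix i assume i: "i < length (es @ [e])"
      show "{mtail T ((es @ [e]) ! i), mhead T ((es @ [e]) ! i)} = {vs ! i, vs ! (Suc i mod length (es @ [e]))}"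
      proof (cases "i < length es")
        case True
        then have "Suc i mod length (es @ [e]) = Suc i" by simp
        then show ?thesis using *(7)[OF True] True by (simp only: nth_append if_True)
      next
        case False
        then have "i = length es" using i by simp
        then show ?thesis using *(2,3) by (simp add: insert_commute)
      qed
    qed (use * e in auto)
    then show False using T by (auto simp: tree_mgraph_def)
  qed
  moreover have "\<sigma> (mtail T e)" by (simp add: \<sigma>_def)
  moreover have "\<sigma> (mtail T e') \<longleftrightarrow> \<sigma> (mhead T e')" if "e' \<in> medges T" "e' \<noteq> e" for e'
  proof -
    have "(mtail T e', mhead T e') \<in> ?R" "(mhead T e', mtail T e') \<in> ?R" using that by auto
    then show ?thesis unfolding \<sigma>_def by (meson rtrancl.rtrancl_into_rtrancl)
  qed
  ultimately show ?thesis by blast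
qed

section \<open>Edges that separate a tree\<close>

locale tree_graph =
  fixes T :: "('v, 'e) mgraph"
  assumes tree: "tree_mgraph T"
begin

sublocale length_graph T
  using tree by unfold_locales (auto simp: tree_mgraph_def unit_mgraph_def)

lemma len_1: "e \<in> medges T \<Longrightarrow> mlen T e = 1"
  using tree by (auto simp: tree_mgraph_def unit_mgraph_def)

abbreviation vdist :: "'v \<Rightarrow> 'v \<Rightarrow> real" where
  "vdist u v \<equiv> gdist T (Vert u) (Vert v)"

text \<open>Only the ends of the separating edge and the two sides are recorded, not the edge with
  its orientation, which makes the notion symmetric in w and w'.\<close>

definition separates :: "('v \<Rightarrow> bool) \<Rightarrow> 'v \<Rightarrow> 'v \<Rightarrow> bool" where
  "separates \<sigma> w w' \<longleftrightarrow> w \<in> mverts T \<and> w' \<in> mverts T \<and> \<sigma> w \<noteq> \<sigma> w' \<and> vdist w w' \<le> 1 \<and>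
     (\<forall>e\<in>medges T. \<sigma> (mtail T e) = \<sigma> (mhead T e) \<or> {mtail T e, mhead T e} = {w, w'})"

lemma separates_sym: "separates \<sigma> w w' \<Longrightarrow> separates \<sigma> w' w"
  by (auto simp: separates_def commute)

text \<open>The potential is the distance to w plus 1 on the side of w, and 0 on the other side. It
  is 1-Lipschitz since the sides are joined only between w, where it is 1, and w', where it is
  0.\<close>

lemma crossing:
  assumes s: "separates \<sigma> w w'" and a: "a \<in> mverts T" "\<sigma> a = \<sigma> w" and c: "c \<in> mverts T" "\<sigma> c \<noteq> \<sigma> w"
  shows "vdist a w + 1 \<le> vdist a c"
proof -
  have w: "w \<in> mverts T" using s by (simp add: separates_def)
  define \<phi> where "\<phi> y = (if \<sigma> y = \<sigma> w then vdist y w + 1 else 0)" for y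
  have "\<bar>\<phi> a - \<phi> c\<bar> \<le> vdist a c"
  proof (rule vertex_Lipschitz)
    fix e assume e: "e \<in> medges T"
    have te: "mtail T e \<in> mverts T" "mhead T e \<in> mverts T" using tail_in head_in e by auto
    from s e consider "\<sigma> (mtail T e) = \<sigma> (mhead T e)" | "{mtail T e, mhead T e} = {w, w'}"
      by (auto simp: separates_def)
    then show "\<bar>\<phi> (mtail T e) - \<phi> (mhead T e)\<bar> \<le> mlen T e"
    proof cases
      case 1
      have "\<bar>vdist (mtail T e) w - vdist (mhead T e) w\<bar> \<le> vdist (mtail T e) (mhead T e)"
        using triangle[of "Vert (mtail T e)" "Vert (mhead T e)" "Vert w"]
          triangle[of "Vert (mhead T e)" "Vert (mtail T e)" "Vert w"] te w
          commute[of "Vert (mhead T e)" "Vert (mtail T e)"] by simp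
      then show ?thesis using 1 gdist_edge_ends[OF e] len_pos[OF e] by (simp add: \<phi>_def)
    next
      case 2
      have "\<phi> w = 1" "\<phi> w' = 0" using s w by (auto simp: \<phi>_def separates_def)
      then show ?thesis using 2 len_1[OF e] by (auto simp: doubleton_eq_iff)
    qed
  qed (use a c in auto)
  then show ?thesis using a c by (simp add: \<phi>_def)
qed

lemma crossing_near:
  assumes s: "separates \<sigma> w w'" and a: "a \<in> mverts T" and c: "c \<in> mverts T" and ne: "\<sigma> a \<noteq> \<sigma> c"
  shows "vdist a w \<le> vdist a c"
proof (cases "\<sigma> a = \<sigma> w")
  case True
  then show ?thesis using crossing[OF s a _ c] ne by simp
next
  case False
  have w: "w \<in> mverts T" "w' \<in> mverts T" "\<sigma> w \<noteq> \<sigma> w'" "vdist w w' \<le> 1" using s by (auto simp: separates_def)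
  have "vdist a w' + 1 \<le> vdist a c"
    using crossing[OF separates_sym[OF s] a _ c] False ne w(3) by auto
  then show ?thesis
    using triangle[of "Vert a" "Vert w'" "Vert w"] a w commute[of "Vert w" "Vert w'"] by simp
qed

lemma walk_split:
  "walk T u r v \<Longrightarrow> real k \<le> r \<Longrightarrow> \<exists>w. walk T u (real k) w \<and> walk T w (r - real k) v"
proof (induction rule: walk.induct)
  case (walk_refl u)
  then show ?case using walk.walk_refl[of u T] by (intro exI[of _ u]) simp
next
  case (walk_fwd u r e)
  obtain n where n: "r = real n" using walk_Nats[OF walk_fwd.hyps(1)] by (auto elim: Nats_cases)
  show ?case
  proof (cases "k \<le> n")
    case True
    then obtain w where "walk T u (real k) w" "walk T w (r - real k) (mtail T e)" using walk_fwd.IH n by auto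
    then show ?thesis using walk.walk_fwd[OF _ walk_fwd.hyps(2), of w "r - real k"]
      by (intro exI[of _ w]) (simp add: algebra_simps)
  next
    case False
    then have k: "real k = r + mlen T e" using walk_fwd.prems n len_1[OF walk_fwd.hyps(2)] by simp
    show ?thesis
      using walk.walk_fwd[OF walk_fwd.hyps] walk.walk_refl[of "mhead T e" T] head_in[OF walk_fwd.hyps(2)]
      by (intro exI[of _ "mhead T e"]) (simp add: k)
  qed
next
  case (walk_bwd u r e)
  obtain n where n: "r = real n" using walk_Nats[OF walk_bwd.hyps(1)] by (auto elim: Nats_cases)
  show ?case
  proof (cases "k \<le> n")
    case True
    then obtain w where "walk T u (real k) w" "walk T w (r - real k) (mhead T e)" using walk_bwd.IH n by auto
    then show ?thesis using walk.walk_bwd[OF _ walk_bwd.hyps(2), of w "r - real k"]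
      by (intro exI[of _ w]) (simp add: algebra_simps)
  next
    case False
    then have k: "real k = r + mlen T e" using walk_bwd.prems n len_1[OF walk_bwd.hyps(2)] by simp
    show ?thesis
      using walk.walk_bwd[OF walk_bwd.hyps] walk.walk_refl[of "mtail T e" T] tail_in[OF walk_bwd.hyps(2)]
      by (intro exI[of _ "mtail T e"]) (simp add: k)
  qed
qed

lemma walk_1:
  assumes "walk T u 1 v"
  shows "\<exists>e\<in>medges T. {mtail T e, mhead T e} = {u, v}"
  using assms
proof (cases rule: walk.cases)
  case (walk_fwd r e)
  then have "r = 0" using len_1 by simp
  then show ?thesis using walk_fwd walk_zero by blast
next
  case (walk_bwd r e)
  then have "r = 0" using len_1 by simp
  then show ?thesis using walk_bwd walk_zero by blast
qed simp

text \<open>The edge between lengths L and L + 1 on a shortest walk from u to v. If u or v lay on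
  the wrong side, \<open>crossing\<close> would contradict that the walk is shortest.\<close>

lemma separating_edge:
  assumes u: "u \<in> mverts T" and v: "v \<in> mverts T" and far: "real L + 1 \<le> vdist u v"
  obtains \<sigma> w w' where "separates \<sigma> w w'" "vdist u w = real L" "\<sigma> u = \<sigma> w" "\<sigma> v \<noteq> \<sigma> u"
proof -
  let ?D = "vdist u v"
  obtain w' where w'1: "walk T u (real (Suc L)) w'" and w'2: "walk T w' (?D - real (Suc L)) v"
    using walk_split[OF gdist_walk[OF u v], of "Suc L"] far by auto
  obtain w where w1: "walk T u (real L) w" and w2: "walk T w (real (Suc L) - real L) w'"
    using walk_split[OF w'1, of L] by auto
  have ww': "walk T w 1 w'" using w2 by simp
  obtain e where e: "e \<in> medges T" "{mtail T e, mhead T e} = {w, w'}" using walk_1[OF ww'] by blast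
  obtain \<sigma> where \<sigma>: "\<sigma> (mtail T e) \<noteq> \<sigma> (mhead T e)"
    "\<And>e'. e' \<in> medges T \<Longrightarrow> e' \<noteq> e \<Longrightarrow> \<sigma> (mtail T e') \<longleftrightarrow> \<sigma> (mhead T e')"
    using tree_bridge[OF tree e(1)] by blast
  have in': "w \<in> mverts T" "w' \<in> mverts T" using walk_in[OF ww'] by auto
  have s: "separates \<sigma> w w'"
    unfolding separates_def using in' \<sigma> e gdist_walk_le[OF ww'] by (metis doubleton_eq_iff)
  have ne: "\<sigma> w \<noteq> \<sigma> w'" using s by (simp add: separates_def)
  have d1: "vdist u w \<le> L" "vdist u w' \<le> L + 1" "vdist w' v \<le> ?D - (L + 1)" "vdist w w' \<le> 1"
    using gdist_walk_le[OF w1] gdist_walk_le[OF w'1] gdist_walk_le[OF w'2] gdist_walk_le[OF ww'] by auto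
  have d2: "?D \<le> vdist u w' + vdist w' v" "vdist u w' \<le> vdist u w + vdist w w'" "vdist w v \<le> vdist w w' + vdist w' v"
    "?D \<le> vdist u w + vdist w v"
    using triangle[of "Vert u" "Vert w'" "Vert v"] triangle[of "Vert u" "Vert w" "Vert w'"]
      triangle[of "Vert w" "Vert w'" "Vert v"] triangle[of "Vert u" "Vert w" "Vert v"] u v in' by auto
  have uw: "\<sigma> u = \<sigma> w"
  proof (rule ccontr)
    assume "\<sigma> u \<noteq> \<sigma> w"
    then have "vdist u w' + 1 \<le> vdist u w"
      using crossing[OF separates_sym[OF s] u _ in'(1)] ne by auto
    then show False using d1 d2 by linarith
  qed
  moreover have "\<sigma> v \<noteq> \<sigma> w"
  proof
    assume "\<sigma> v = \<sigma> w"
    then have "vdist v w + 1 \<le> vdist v w'"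
      using crossing[OF s v _ in'(2)] ne by auto
    then show False using d1 d2 commute[of "Vert v" "Vert w"] commute[of "Vert v" "Vert w'"] by linarith
  qed
  ultimately show thesis using that[OF s] d1 d2 by auto
qed

lemma near_vertex:
  assumes "p \<in> gpoints T"
  shows "\<exists>v\<in>mverts T. gdist T p (Vert v) \<le> 1"
  using assms
proof (cases rule: gpoint_cases)
  case (1 v)
  then show ?thesis by (intro bexI[of _ v]) auto
next
  case (2 e t)
  then show ?thesis
    using gdist_gends[OF assms, of "mtail T e" t] tail_in len_1 by (intro bexI[of _ "mtail T e"]) auto
qed

end

text \<open>If a coarse path missed a neighbourhood of \<open>u\<close>, then on the way from \<open>u\<close> to its start
  there would be an edge of the tree, far from \<open>u\<close>, that both geodesics from \<open>u\<close> to the ends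
  of the path cross; but \<open>u\<close> is coarsely between the ends.\<close>

lemma (in tree_graph) vertex_map_bottleneck:
  fixes L :: nat
  assumes geo: "geodesic_space Y d" and \<nu>: "\<And>x. x \<in> Y \<Longrightarrow> \<nu> x \<in> mverts T"
    and C: "C \<ge> 1" and A: "A \<ge> 0" and s: "s \<ge> 1"
    and up: "\<And>x y. x \<in> Y \<Longrightarrow> y \<in> Y \<Longrightarrow> vdist (\<nu> x) (\<nu> y) \<le> C * d x y + A"
    and low: "\<And>x y. x \<in> Y \<Longrightarrow> y \<in> Y \<Longrightarrow> d x y \<le> C * (vdist (\<nu> x) (\<nu> y) + A)"
    and L: "real L > (C * s + A) + A + C * (C * (2 * (C * s + A) + A) + c)" and c: "c \<ge> 0"
  shows "bottleneck Y d s c (C * (C * s + A + L + 1 + A))"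
  unfolding bottleneck_def
proof (intro allI impI, elim conjE)
  interpret Y: Metric_space Y d using geodesic_space_metric[OF geo] .
  fix f n u
  assume fY: "f ` {..n} \<subseteq> Y" and step: "\<forall>i<n. d (f i) (f (Suc i)) \<le> s" and u: "u \<in> Y"
    and between: "d (f 0) u + d u (f n) \<le> d (f 0) (f n) + c"
  \<comment> \<open>Bounds the movement in the tree during one step of length s. Hence a step that
    crosses the separating edge starts within J of w.\<close>
  define J where "J = C * s + A"
  have J: "J \<ge> 0" using C A s by (simp add: J_def)
  have f_in: "f i \<in> Y" if "i \<le> n" for i using fY that by auto
  have jump: "vdist (\<nu> x) (\<nu> y) \<le> J" if "x \<in> Y" "y \<in> Y" "d x y \<le> s" for x y
  proof -
    have "C * d x y \<le> C * s" using that(3) C by (intro mult_left_mono) auto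
    then show ?thesis using up[OF that(1,2)] by (simp add: J_def)
  qed
  have close: "d x u \<le> C * (J + L + 1 + A)" if "x \<in> Y" "vdist (\<nu> x) (\<nu> u) \<le> J + L + 1" for x
  proof -
    have "C * (vdist (\<nu> x) (\<nu> u) + A) \<le> C * (J + L + 1 + A)" using that(2) C by (intro mult_left_mono) auto
    then show ?thesis using low[OF that(1) u] by linarith
  qed
  show "\<exists>i\<le>n. d (f i) u \<le> C * (C * s + A + L + 1 + A)"
  proof (cases "vdist (\<nu> u) (\<nu> (f 0)) < L + 1")
    case True
    then have "d (f 0) u \<le> C * (J + L + 1 + A)"
      using close[OF f_in[of 0]] J commute[of "Vert (\<nu> u)"] by simp
    then show ?thesis by (auto simp: J_def intro!: exI[of _ 0])
  next
    case False
    then have far: "real L + 1 \<le> vdist (\<nu> u) (\<nu> (f 0))" by simp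
    from separating_edge[OF \<nu>[OF u] \<nu>[OF f_in[of 0]] far] obtain \<sigma> w w'
      where sep: "separates \<sigma> w w'" and uw: "vdist (\<nu> u) w = real L" "\<sigma> (\<nu> u) = \<sigma> w"
        and x: "\<sigma> (\<nu> (f 0)) \<noteq> \<sigma> (\<nu> u)" by auto
    have w: "w \<in> mverts T" using sep by (simp add: separates_def)
    have cross: "vdist (\<nu> y) w \<le> J" if "y \<in> Y" "y' \<in> Y" "d y y' \<le> s" "\<sigma> (\<nu> y) \<noteq> \<sigma> (\<nu> y')" for y y'
      using crossing_near[OF sep \<nu> \<nu> that(4)] that(1,2) jump[OF that(1-3)] by linarith
    show ?thesis
    proof (cases "\<sigma> (\<nu> (f n)) = \<sigma> (\<nu> u)")
      case True
      then obtain i where i: "i < n" "\<sigma> (\<nu> (f i)) \<noteq> \<sigma> (\<nu> u)" "\<sigma> (\<nu> (f (Suc i))) = \<sigma> (\<nu> u)"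
        using discrete_exit[of "\<lambda>i. \<sigma> (\<nu> (f i)) \<noteq> \<sigma> (\<nu> u)" n] x by auto
      have fi: "f i \<in> Y" "f (Suc i) \<in> Y" using f_in i by auto
      have "vdist (\<nu> (f i)) w \<le> J" using cross[OF fi] step i by auto
      then have "vdist (\<nu> (f i)) (\<nu> u) \<le> J + L + 1"
        using triangle[of "Vert (\<nu> (f i))" "Vert w" "Vert (\<nu> u)"] \<nu> fi u w uw
          commute[of "Vert w" "Vert (\<nu> u)"] by simp
      from close[OF fi(1) this] show ?thesis using i by (intro exI[of _ i]) (auto simp: J_def)
    next
      case False
      have visit: "\<exists>y\<in>Y. d z u = d z y + d y u \<and> vdist (\<nu> y) w \<le> J"
        if z: "z \<in> Y" "\<sigma> (\<nu> z) \<noteq> \<sigma> (\<nu> u)" for z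
      proof -
        obtain g where g: "geodesic_segment Y d g z u" using geo z u by (meson geodesic_space_def)
        from geodesic_chain[OF g Y.nonneg]
        obtain \<tau> and N :: nat where \<tau>: "\<tau> 0 = 0" "\<tau> N = d z u" "mono \<tau>"
          "\<forall>i. \<tau> i \<in> {0..d z u}" "\<forall>i. d (g (\<tau> i)) (g (\<tau> (Suc i))) \<le> 1" "real N \<le> d z u + 1" .
        have gY: "g (\<tau> i) \<in> Y" for i using geodesic_segmentD(3)[OF g] \<tau>(4) by blast
        obtain i where i: "\<sigma> (\<nu> (g (\<tau> i))) \<noteq> \<sigma> (\<nu> u)" "\<sigma> (\<nu> (g (\<tau> (Suc i)))) = \<sigma> (\<nu> u)"
          using discrete_exit[of "\<lambda>i. \<sigma> (\<nu> (g (\<tau> i))) \<noteq> \<sigma> (\<nu> u)" N] \<tau>(1,2) geodesic_segmentD(1,2)[OF g] z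
          by auto
        have "d (g (\<tau> i)) (g (\<tau> (Suc i))) \<le> s" using \<tau>(5)[rule_format, of i] s by simp
        then have "vdist (\<nu> (g (\<tau> i))) w \<le> J" using cross[OF gY gY] i by auto
        moreover have "d z u = d z (g (\<tau> i)) + d (g (\<tau> i)) u"
          using geodesic_segmentD(4)[OF g, of 0 "\<tau> i"] geodesic_segmentD(4)[OF g, of "\<tau> i" "d z u"]
            geodesic_segmentD(1,2)[OF g] \<tau>(4)[rule_format, of i] by auto
        ultimately show ?thesis using gY by blast
      qed
      obtain y1 where y1: "y1 \<in> Y" "d (f 0) u = d (f 0) y1 + d y1 u" "vdist (\<nu> y1) w \<le> J"
        using visit[OF f_in[of 0] x] by auto
      obtain y2 where y2: "y2 \<in> Y" "d (f n) u = d (f n) y2 + d y2 u" "vdist (\<nu> y2) w \<le> J"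
        using visit[OF f_in[of n] False] by auto
      have "vdist (\<nu> y1) (\<nu> y2) \<le> 2 * J"
        using triangle[of "Vert (\<nu> y1)" "Vert w" "Vert (\<nu> y2)"] \<nu> y1 y2 w commute[of "Vert w" "Vert (\<nu> y2)"] by simp
      then have "C * (vdist (\<nu> y1) (\<nu> y2) + A) \<le> C * (2 * J + A)" using C by (intro mult_left_mono) auto
      then have d12: "d y1 y2 \<le> C * (2 * J + A)" using low[OF y1(1) y2(1)] by linarith
      have "d (f 0) (f n) \<le> d (f 0) y1 + d y1 y2 + d y2 (f n)"
        using Y.triangle[of "f 0" y1 "f n"] Y.triangle[of y1 y2 "f n"] f_in[of 0] f_in[of n] y1 y2 by simp
      then have sum: "d y1 u + d u y2 \<le> d y1 y2 + c"
        using between y1(2) y2(2) Y.commute[of u "f n"] Y.commute[of u y2] Y.commute[of y2 "f n"] by linarith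
      \<comment> \<open>The separating edge is at distance L from u, while \<open>y1\<close> is near
        it; so \<open>d y1 u\<close> is large. L is chosen to contradict the upper bound from
        \<open>sum\<close> and \<open>d12\<close>.\<close>
      have "L \<le> vdist (\<nu> u) (\<nu> y1) + J"
        using triangle[of "Vert (\<nu> u)" "Vert (\<nu> y1)" "Vert w"] \<nu> y1 u w uw by simp
      then have "L - J - A \<le> C * d y1 u" using up[OF u y1(1)] Y.commute[of u y1] by simp
      also have "\<dots> \<le> C * (C * (2 * J + A) + c)"
        using sum d12 Y.nonneg[of u y2] C by (intro mult_left_mono) linarith+
      finally show ?thesis using L unfolding J_def by linarith
    qed
  qed
qed

text \<open>The bound has to serve all pieces at once, so Y, d, T and f are quantified inside the
  conclusion. Moving the values of f to vertices changes distances by at most 2, which is absorbed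
  by replacing the additive constant C with C + 2.\<close>

theorem quasi_isometric_tree_bottleneck:
  fixes C s c :: real
  assumes s: "s \<ge> 1" and c: "c \<ge> 0"
  obtains \<Delta> where "\<Delta> \<ge> 0"
    "\<forall>(Y :: 'a set) d (T :: ('v, 'e) mgraph) f. geodesic_space Y d \<longrightarrow> tree_mgraph T \<longrightarrow>
       quasi_isometry C C Y d (gpoints T) (gdist T) f \<longrightarrow> bottleneck Y d s c \<Delta>"
proof -
  \<comment> \<open>That C is at least 1 becomes known only once a quasi-isometry is given, so
    \<Delta> is chosen, and made nonnegative, without it.\<close>
  define A where "A = \<bar>C\<bar> + 2"
  define L where "L = nat \<lceil>(C * s + A) + A + C * (C * (2 * (C * s + A) + A) + c)\<rceil> + 1"
  define \<Delta> where "\<Delta> = C * (C * s + A + L + 1 + A)"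
  show thesis
  proof (rule that[of "max 0 \<Delta>"], simp, intro allI impI)
    fix Y :: "'a set" and d and T :: "('v, 'e) mgraph" and f
    assume geo: "geodesic_space Y d" and T: "tree_mgraph T"
      and q: "quasi_isometry C C Y d (gpoints T) (gdist T) f"
    interpret tree_graph T using T by unfold_locales
    have C: "C \<ge> 1" and f: "\<And>x. x \<in> Y \<Longrightarrow> f x \<in> gpoints T"
      and q1: "\<And>x y. x \<in> Y \<Longrightarrow> y \<in> Y \<Longrightarrow> d x y / C - C \<le> gdist T (f x) (f y)"
      and q2: "\<And>x y. x \<in> Y \<Longrightarrow> y \<in> Y \<Longrightarrow> gdist T (f x) (f y) \<le> C * d x y + C"
      using q unfolding quasi_isometry_def by auto
    have A: "A \<ge> 0" "A = C + 2" using C by (auto simp: A_def)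
    have "\<exists>v\<in>mverts T. gdist T (f x) (Vert v) \<le> 1" if "x \<in> Y" for x
      using near_vertex[OF f[OF that]] .
    then obtain \<nu> where \<nu>: "\<And>x. x \<in> Y \<Longrightarrow> \<nu> x \<in> mverts T" "\<And>x. x \<in> Y \<Longrightarrow> gdist T (f x) (Vert (\<nu> x)) \<le> 1"
      by metis
    have near': "vdist (\<nu> x) (\<nu> y) \<le> gdist T (f x) (f y) + 2 \<and> gdist T (f x) (f y) \<le> vdist (\<nu> x) (\<nu> y) + 2"
      if x: "x \<in> Y" and y: "y \<in> Y" for x y
    proof -
      have in': "Vert (\<nu> x) \<in> gpoints T" "Vert (\<nu> y) \<in> gpoints T" using \<nu> x y by auto
      show ?thesis
        using triangle[OF in'(1) f[OF x] in'(2)] triangle[OF f[OF x] f[OF y] in'(2)]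
          triangle[OF f[OF x] in'(1) f[OF y]] triangle[OF in' f[OF y]] \<nu>(2)[OF x] \<nu>(2)[OF y]
          commute[of "Vert (\<nu> x)" "f x"] commute[of "Vert (\<nu> y)" "f y"] by linarith
    qed
    have "bottleneck Y d s c (C * (C * s + A + L + 1 + A))"
    proof (rule vertex_map_bottleneck[OF geo \<nu>(1) C A(1) s _ _ _ c])
      fix x y assume x: "x \<in> Y" and y: "y \<in> Y"
      show "vdist (\<nu> x) (\<nu> y) \<le> C * d x y + A" using q2[OF x y] near'[OF x y] A(2) by linarith
      have "d x y / C \<le> vdist (\<nu> x) (\<nu> y) + A" using q1[OF x y] near'[OF x y] A(2) by linarith
      then show "d x y \<le> C * (vdist (\<nu> x) (\<nu> y) + A)" using C by (simp add: field_simps)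
    next
      show "(C * s + A) + A + C * (C * (2 * (C * s + A) + A) + c) < real L"
        unfolding L_def by linarith
    qed
    then show "bottleneck Y d s c (max 0 \<Delta>)"
      unfolding bottleneck_def \<Delta>_def by (meson max.coboundedI2)
  qed
qed

section \<open>Asymptotic cones\<close>

locale cone_space =
  fixes M :: "'a set" and d :: "'a \<Rightarrow> 'a \<Rightarrow> real" and \<omega> :: "nat filter"
    and s :: "nat \<Rightarrow> real" and b :: "nat \<Rightarrow> 'a"
  assumes geo: "geodesic_space M d" and ultrafilter: "nonprincipal_ultrafilter \<omega>"
    and scale: "filterlim s at_top \<omega>" and base: "\<And>n. b n \<in> M"
begin

sublocale Metric_space M d
  using geo by (rule geodesic_space_metric)

abbreviation seqs :: "(nat \<Rightarrow> 'a) set" where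
  "seqs \<equiv> cone_seqs M d \<omega> s b"

abbreviation cn :: "(nat \<Rightarrow> 'a) set set" where
  "cn \<equiv> cone M d \<omega> s b"

abbreviation cd :: "(nat \<Rightarrow> 'a) set \<Rightarrow> (nat \<Rightarrow> 'a) set \<Rightarrow> real" where
  "cd \<equiv> cone_dist M d \<omega> s b"

definition cl :: "(nat \<Rightarrow> 'a) \<Rightarrow> (nat \<Rightarrow> 'a) set" where
  "cl x = cone_rel M d \<omega> s b `` {x}"

definition rd :: "(nat \<Rightarrow> 'a) \<Rightarrow> (nat \<Rightarrow> 'a) \<Rightarrow> nat \<Rightarrow> real" where
  "rd x y n = d (x n) (y n) / s n"

section \<open>Limits along the ultrafilter\<close>

lemma nontrivial: "\<omega> \<noteq> bot"
  using ultrafilter by (simp add: nonprincipal_ultrafilter_def)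

lemma not_eventually_ultra: "\<not> eventually P \<omega> \<Longrightarrow> eventually (\<lambda>n. \<not> P n) \<omega>"
  using ultrafilter by (auto simp: nonprincipal_ultrafilter_def)

text \<open>Compactness of an interval yields a cluster point, and along an ultrafilter a cluster
  point is a limit.\<close>

lemma bounded_converges:
  fixes f :: "nat \<Rightarrow> real"
  assumes "eventually (\<lambda>n. \<bar>f n\<bar> \<le> B) \<omega>"
  shows "\<exists>l. (f \<longlongrightarrow> l) \<omega>"
proof -
  have "eventually (\<lambda>y. y \<in> {-B..B}) (filtermap f \<omega>)"
    unfolding eventually_filtermap using assms by eventually_elim auto
  moreover have "filtermap f \<omega> \<noteq> bot" using nontrivial by (simp add: filtermap_bot_iff)
  ultimately obtain l where l: "inf (nhds l) (filtermap f \<omega>) \<noteq> bot"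
    using compact_Icc[of "-B" B] unfolding compact_filter by blast
  have "(f \<longlongrightarrow> l) \<omega>"
  proof (rule topological_tendstoI, rule ccontr)
    fix U assume U: "open U" "l \<in> U" and "\<not> eventually (\<lambda>n. f n \<in> U) \<omega>"
    then have "eventually (\<lambda>y. y \<notin> U) (filtermap f \<omega>)"
      using not_eventually_ultra by (simp add: eventually_filtermap)
    moreover have "eventually (\<lambda>y. y \<in> U) (nhds l)" using U by (auto simp: eventually_nhds)
    ultimately have "eventually (\<lambda>_. False) (inf (nhds l) (filtermap f \<omega>))"
      unfolding eventually_inf by (intro exI[of _ "\<lambda>y. y \<in> U"] exI[of _ "\<lambda>y. y \<notin> U"]) auto
    then show False using l by (simp add: eventually_False)
  qed
  then show ?thesis by blast
qed

lemma s_pos: "eventually (\<lambda>n. s n > 0) \<omega>"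
  using scale by (simp add: filterlim_at_top_dense)

lemma const_rescaled: "((\<lambda>n. C / s n) \<longlongrightarrow> 0) \<omega>"
  by (rule tendsto_divide_0[OF tendsto_const filterlim_at_top_imp_at_infinity[OF scale]])

lemma seqs_in: "x \<in> seqs \<Longrightarrow> x n \<in> M"
  by (auto simp: cone_seqs_def)

lemma rd_nonneg: "eventually (\<lambda>n. rd x y n \<ge> 0) \<omega>"
  using s_pos by eventually_elim (simp add: rd_def)

lemma rd_commute: "rd x y = rd y x"
  by (auto simp: rd_def commute)

lemma rd_triangle:
  assumes "\<And>n. x n \<in> M" "\<And>n. y n \<in> M" "\<And>n. z n \<in> M"
  shows "eventually (\<lambda>n. rd x z n \<le> rd x y n + rd y z n) \<omega>"
  using s_pos
proof eventually_elim
  case (elim n)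
  have "d (x n) (z n) / s n \<le> (d (x n) (y n) + d (y n) (z n)) / s n"
    using triangle[OF assms(1,2,3)] elim by (intro divide_right_mono) auto
  then show ?case by (simp add: rd_def add_divide_distrib)
qed

lemma seqs_bounded:
  assumes x: "x \<in> seqs" and y: "y \<in> seqs"
  shows "\<exists>B. eventually (\<lambda>n. rd x y n \<le> B) \<omega>"
proof -
  obtain B B' where B: "eventually (\<lambda>n. rd x b n \<le> B) \<omega>" "eventually (\<lambda>n. rd y b n \<le> B') \<omega>"
    using x y by (auto simp: cone_seqs_def rd_def)
  have "eventually (\<lambda>n. rd x y n \<le> rd x b n + rd b y n) \<omega>"
    using rd_triangle seqs_in x y base by blast
  then have "eventually (\<lambda>n. rd x y n \<le> B + B') \<omega>"
    using B by eventually_elim (simp add: rd_commute[of b])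
  then show ?thesis by blast
qed

lemma seqs_close:
  assumes x: "x \<in> seqs" and w: "\<And>n. w n \<in> M" and B: "eventually (\<lambda>n. rd w x n \<le> B) \<omega>"
  shows "w \<in> seqs"
proof -
  obtain B' where B': "eventually (\<lambda>n. rd x b n \<le> B') \<omega>"
    using x by (auto simp: cone_seqs_def rd_def)
  have "eventually (\<lambda>n. rd w b n \<le> rd w x n + rd x b n) \<omega>"
    using rd_triangle seqs_in x w base by blast
  then have "eventually (\<lambda>n. rd w b n \<le> B + B') \<omega>"
    using B B' by eventually_elim simp
  then show ?thesis using w by (auto simp: cone_seqs_def rd_def)
qed

lemma rd_converges:
  assumes x: "x \<in> seqs" and y: "y \<in> seqs"
  shows "\<exists>l. (rd x y \<longlongrightarrow> l) \<omega>"
proof -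
  obtain B where "eventually (\<lambda>n. rd x y n \<le> B) \<omega>" using seqs_bounded[OF x y] by blast
  then have "eventually (\<lambda>n. \<bar>rd x y n\<bar> \<le> B) \<omega>" using rd_nonneg[of x y] by eventually_elim simp
  then show ?thesis by (rule bounded_converges)
qed

section \<open>The cone as a metric space\<close>

lemma rel_iff: "(x, y) \<in> cone_rel M d \<omega> s b \<longleftrightarrow> x \<in> seqs \<and> y \<in> seqs \<and> (rd x y \<longlongrightarrow> 0) \<omega>"
  by (auto simp: cone_rel_def rd_def[abs_def])

lemma rd_refl: "x \<in> seqs \<Longrightarrow> (rd x x \<longlongrightarrow> 0) \<omega>"
  using seqs_in[of x] by (simp add: rd_def[abs_def])

lemma rd_zero_trans:
  assumes "x \<in> seqs" "y \<in> seqs" "z \<in> seqs" "(rd x y \<longlongrightarrow> 0) \<omega>" "(rd y z \<longlongrightarrow> 0) \<omega>"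
  shows "(rd x z \<longlongrightarrow> 0) \<omega>"
proof (rule tendsto_sandwich[OF rd_nonneg rd_triangle])
  show "((\<lambda>n. rd x y n + rd y z n) \<longlongrightarrow> 0) \<omega>" using tendsto_add[OF assms(4,5)] by simp
qed (use assms(1-3) seqs_in in auto)

lemma equiv_rel: "equiv seqs (cone_rel M d \<omega> s b)"
proof (rule equivI)
  show "cone_rel M d \<omega> s b \<subseteq> seqs \<times> seqs" by (auto simp: rel_iff)
  show "refl_on seqs (cone_rel M d \<omega> s b)" by (auto simp: refl_on_def rel_iff rd_refl)
  show "sym (cone_rel M d \<omega> s b)" by (auto simp: sym_def rel_iff rd_commute)
  show "trans (cone_rel M d \<omega> s b)"
    unfolding trans_def rel_iff using rd_zero_trans by blast
qed

lemma in_cl: "y \<in> cl x \<longleftrightarrow> x \<in> seqs \<and> y \<in> seqs \<and> (rd x y \<longlongrightarrow> 0) \<omega>"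
  by (simp add: cl_def rel_iff)

lemma cl_self: "x \<in> seqs \<Longrightarrow> x \<in> cl x"
  by (simp add: in_cl rd_refl)

lemma cl_in: "x \<in> seqs \<Longrightarrow> cl x \<in> cn"
  by (simp add: cone_def cl_def quotientI)

lemma cone_rep:
  assumes "p \<in> cn" "x \<in> p"
  shows "x \<in> seqs" "p = cl x"
proof -
  obtain y where y: "y \<in> seqs" "p = cl y" using assms(1) by (auto simp: cone_def cl_def elim!: quotientE)
  then show "x \<in> seqs" using assms(2) by (simp add: in_cl)
  have "(y, x) \<in> cone_rel M d \<omega> s b" using assms(2) y by (simp add: cl_def)
  then show "p = cl x" using y equiv_class_eq[OF equiv_rel] by (simp add: cl_def)
qed

lemma cone_nonempty: "p \<in> cn \<Longrightarrow> \<exists>x. x \<in> p"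
  using cl_self by (auto simp: cone_def cl_def elim!: quotientE)

lemma cone_obtain:
  assumes "p \<in> cn"
  obtains x where "x \<in> seqs" "p = cl x"
  using cone_nonempty[OF assms] cone_rep[OF assms] by blast

lemma cl_eq_iff: "x \<in> seqs \<Longrightarrow> y \<in> seqs \<Longrightarrow> cl x = cl y \<longleftrightarrow> (rd x y \<longlongrightarrow> 0) \<omega>"
  using eq_equiv_class_iff[OF equiv_rel, of x y] by (simp add: cl_def rel_iff)

lemma rd_lim_cong:
  assumes "x' \<in> cl x" "y' \<in> cl y" "(rd x y \<longlongrightarrow> l) \<omega>"
  shows "(rd x' y' \<longlongrightarrow> l) \<omega>"
proof -
  have in': "x n \<in> M" "x' n \<in> M" "y n \<in> M" "y' n \<in> M" for n
    using assms(1,2) seqs_in by (auto simp: in_cl)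
  have 0: "(rd x x' \<longlongrightarrow> 0) \<omega>" "(rd y y' \<longlongrightarrow> 0) \<omega>" using assms by (auto simp: in_cl)
  show ?thesis
  proof (rule tendsto_sandwich)
    have "((\<lambda>n. rd x y n - rd x x' n - rd y y' n) \<longlongrightarrow> l - 0 - 0) \<omega>"
      by (intro tendsto_diff assms 0)
    then show "((\<lambda>n. rd x y n - rd x x' n - rd y y' n) \<longlongrightarrow> l) \<omega>" by simp
    have "((\<lambda>n. rd x y n + rd x x' n + rd y y' n) \<longlongrightarrow> l + 0 + 0) \<omega>"
      by (intro tendsto_add assms 0)
    then show "((\<lambda>n. rd x y n + rd x x' n + rd y y' n) \<longlongrightarrow> l) \<omega>" by simp
    show "eventually (\<lambda>n. rd x' y' n \<le> rd x y n + rd x x' n + rd y y' n) \<omega>"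
      using rd_triangle[of x' x y', OF in'(2,1,4)] rd_triangle[of x y y', OF in'(1,3,4)]
      by eventually_elim (simp add: rd_commute[of x' x])
    show "eventually (\<lambda>n. rd x y n - rd x x' n - rd y y' n \<le> rd x' y' n) \<omega>"
      using rd_triangle[of x x' y, OF in'(1,2,3)] rd_triangle[of x' y' y, OF in'(2,4,3)]
      by eventually_elim (simp add: rd_commute[of y' y])
  qed
qed

lemma cd_lim:
  assumes x: "x \<in> seqs" and y: "y \<in> seqs"
  shows "(rd x y \<longlongrightarrow> cd (cl x) (cl y)) \<omega>"
proof -
  obtain l where l: "(rd x y \<longlongrightarrow> l) \<omega>" using rd_converges[OF x y] by blast
  have "cd (cl x) (cl y) = (THE l. \<exists>x'\<in>cl x. \<exists>y'\<in>cl y. (rd x' y' \<longlongrightarrow> l) \<omega>)"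
    using cl_in x y by (simp add: cone_dist_def rd_def[abs_def])
  also have "\<dots> = l"
  proof (rule the_equality)
    show "\<exists>x'\<in>cl x. \<exists>y'\<in>cl y. (rd x' y' \<longlongrightarrow> l) \<omega>" using l cl_self x y by blast
    fix l' assume "\<exists>x'\<in>cl x. \<exists>y'\<in>cl y. (rd x' y' \<longlongrightarrow> l') \<omega>"
    then show "l' = l" using rd_lim_cong[OF _ _ l] tendsto_unique[OF nontrivial] by blast
  qed
  finally show ?thesis using l by simp
qed

lemma cd_eqI: "x \<in> seqs \<Longrightarrow> y \<in> seqs \<Longrightarrow> (rd x y \<longlongrightarrow> l) \<omega> \<Longrightarrow> cd (cl x) (cl y) = l"
  using cd_lim tendsto_unique[OF nontrivial] by blast

text \<open>Bounded additive errors vanish after rescaling.\<close>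

lemma cd_le:
  assumes "x \<in> seqs" "y \<in> seqs" "x' \<in> seqs" "y' \<in> seqs"
    and "eventually (\<lambda>n. rd x y n \<le> rd x' y' n + C / s n) \<omega>"
  shows "cd (cl x) (cl y) \<le> cd (cl x') (cl y')"
proof -
  have "((\<lambda>n. rd x' y' n + C / s n) \<longlongrightarrow> cd (cl x') (cl y') + 0) \<omega>"
    by (intro tendsto_add cd_lim const_rescaled assms)
  from tendsto_le[OF nontrivial this cd_lim[OF assms(1,2)] assms(5)] show ?thesis by simp
qed

sublocale cone: Metric_space cn cd
proof
  fix p q r
  show nn: "0 \<le> cd p q" for p q
  proof (cases "p \<in> cn \<and> q \<in> cn")
    case True
    then obtain x y where "x \<in> seqs" "y \<in> seqs" "p = cl x" "q = cl y" using cone_obtain by metis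
    then show ?thesis using tendsto_lowerbound[OF cd_lim rd_nonneg nontrivial] by simp
  qed (auto simp: cone_dist_def)
  show "cd p q = cd q p"
  proof (cases "p \<in> cn \<and> q \<in> cn")
    case True
    then obtain x y where "x \<in> seqs" "y \<in> seqs" "p = cl x" "q = cl y" using cone_obtain by metis
    then show ?thesis using cd_eqI cd_lim rd_commute by metis
  qed (auto simp: cone_dist_def)
  assume p: "p \<in> cn" and q: "q \<in> cn"
  obtain x y where xy: "x \<in> seqs" "y \<in> seqs" "p = cl x" "q = cl y" using p q cone_obtain by metis
  show "cd p q = 0 \<longleftrightarrow> p = q"
    using xy cl_eq_iff cd_lim[OF xy(1,2)] cd_eqI by metis
  assume r: "r \<in> cn"
  obtain z where z: "z \<in> seqs" "r = cl z" using r cone_obtain by metis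
  have "((\<lambda>n. rd x y n + rd y z n) \<longlongrightarrow> cd p q + cd q r) \<omega>"
    using cd_lim xy z by (auto intro!: tendsto_add)
  moreover have "(rd x z \<longlongrightarrow> cd p r) \<omega>" using cd_lim xy z by auto
  moreover have "eventually (\<lambda>n. rd x z n \<le> rd x y n + rd y z n) \<omega>"
    using rd_triangle seqs_in xy z by blast
  ultimately show "cd p r \<le> cd p q + cd q r" by (rule tendsto_le[OF nontrivial])
qed

text \<open>The limit of the rescaled geodesics. The sets \<open>A n\<close> record where these run,
  so that the same construction gives geodesics of the cone and geodesics inside limits of
  pieces.\<close>

lemma cone_geodesic:
  assumes x: "x \<in> seqs" and y: "y \<in> seqs" and \<gamma>: "\<And>n. geodesic_segment M d (\<gamma> n) (x n) (y n)"
    and A: "eventually (\<lambda>n. \<gamma> n ` {0..d (x n) (y n)} \<subseteq> A n) \<omega>"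
  shows "\<exists>g. geodesic_segment cn cd g (cl x) (cl y) \<and> (\<forall>\<tau>. \<exists>w\<in>g \<tau>. eventually (\<lambda>n. w n \<in> A n) \<omega>)"
proof -
  let ?L = "cd (cl x) (cl y)"
  \<comment> \<open>The rescaled time, clamped to the domain of \<open>\<gamma> n\<close>; this
    keeps \<open>w \<tau> n\<close> in M for all real \<tau> and also where \<open>s n\<close> is
    not yet positive.\<close>
  define pos where "pos \<tau> n = min (max 0 (\<tau> * s n)) (d (x n) (y n))" for \<tau> n
  define w where "w \<tau> n = \<gamma> n (pos \<tau> n)" for \<tau> n
  have pos: "pos \<tau> n \<in> {0..d (x n) (y n)}" for \<tau> n by (auto simp: pos_def)
  have wM: "w \<tau> n \<in> M" for \<tau> n using geodesic_segmentD(3)[OF \<gamma> pos] by (simp add: w_def)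
  have wd: "d (w \<sigma> n) (w \<tau> n) = \<bar>pos \<sigma> n - pos \<tau> n\<bar>" for \<sigma> \<tau> n
    using geodesic_segmentD(4)[OF \<gamma> pos pos] by (simp add: w_def)
  have pos_s: "eventually (\<lambda>n. pos \<tau> n / s n = min (max 0 \<tau>) (rd x y n)) \<omega>" for \<tau>
    using s_pos
  proof eventually_elim
    case (elim n)
    have "max 0 (\<tau> * s n) = max 0 \<tau> * s n" using elim by (auto simp: max_def zero_le_mult_iff)
    then show ?case using elim by (simp add: pos_def rd_def min_def divide_simps)
  qed
  have lim: "(rd (w \<sigma>) (w \<tau>) \<longlongrightarrow> \<bar>min (max 0 \<sigma>) ?L - min (max 0 \<tau>) ?L\<bar>) \<omega>" for \<sigma> \<tau>
  proof (rule Lim_transform_eventually)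
    show "((\<lambda>n. \<bar>min (max 0 \<sigma>) (rd x y n) - min (max 0 \<tau>) (rd x y n)\<bar>) \<longlongrightarrow>
        \<bar>min (max 0 \<sigma>) ?L - min (max 0 \<tau>) ?L\<bar>) \<omega>"
      by (intro tendsto_rabs tendsto_diff tendsto_min tendsto_const cd_lim x y)
    show "eventually (\<lambda>n. \<bar>min (max 0 \<sigma>) (rd x y n) - min (max 0 \<tau>) (rd x y n)\<bar> = rd (w \<sigma>) (w \<tau>) n) \<omega>"
      using pos_s[of \<sigma>] pos_s[of \<tau>] s_pos
    proof eventually_elim
      case (elim n)
      have "rd (w \<sigma>) (w \<tau>) n = \<bar>pos \<sigma> n / s n - pos \<tau> n / s n\<bar>"
        using elim(3) by (simp add: rd_def wd diff_divide_distrib[symmetric])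
      then show ?case using elim(1,2) by simp
    qed
  qed
  have w0: "w 0 = x" using geodesic_segmentD(1)[OF \<gamma>] by (auto simp: w_def pos_def)
  have wS: "w \<tau> \<in> seqs" for \<tau>
  proof -
    obtain B where B: "eventually (\<lambda>n. rd x y n \<le> B) \<omega>" using seqs_bounded[OF x y] by blast
    have "d (w \<tau> n) (x n) \<le> d (x n) (y n)" for n
      using wd[of \<tau> n 0] pos[of \<tau> n] by (simp add: w0 pos_def)
    then have "eventually (\<lambda>n. rd (w \<tau>) x n \<le> rd x y n) \<omega>"
      using s_pos by (auto elim!: eventually_mono simp: rd_def divide_right_mono)
    then have "eventually (\<lambda>n. rd (w \<tau>) x n \<le> B) \<omega>" using B by eventually_elim simp
    then show ?thesis by (rule seqs_close[OF x wM])
  qed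
  have L: "?L \<ge> 0" by simp
  have dist: "cd (cl (w \<sigma>)) (cl (w \<tau>)) = \<bar>min (max 0 \<sigma>) ?L - min (max 0 \<tau>) ?L\<bar>" for \<sigma> \<tau>
    using cd_eqI[OF wS wS lim] .
  have dy: "cl (w ?L) = cl y"
  proof -
    have "(rd (w ?L) y \<longlongrightarrow> \<bar>min (max 0 ?L) ?L - ?L\<bar>) \<omega>"
    proof (rule Lim_transform_eventually)
      show "((\<lambda>n. \<bar>min (max 0 ?L) (rd x y n) - rd x y n\<bar>) \<longlongrightarrow> \<bar>min (max 0 ?L) ?L - ?L\<bar>) \<omega>"
        by (intro tendsto_rabs tendsto_diff tendsto_min tendsto_const cd_lim x y)
      have dist_y: "d (w ?L n) (y n) = \<bar>pos ?L n - d (x n) (y n)\<bar>" for n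
        using geodesic_segmentD(4)[OF \<gamma>[of n] pos, of "d (x n) (y n)" ?L] geodesic_segmentD(2)[OF \<gamma>[of n]]
        by (simp add: w_def)
      show "eventually (\<lambda>n. \<bar>min (max 0 ?L) (rd x y n) - rd x y n\<bar> = rd (w ?L) y n) \<omega>"
        using pos_s[of ?L] s_pos
      proof eventually_elim
        case (elim n)
        have "rd (w ?L) y n = \<bar>pos ?L n / s n - rd x y n\<bar>"
          using elim(2) by (simp add: rd_def dist_y diff_divide_distrib[symmetric])
        then show ?case using elim(1) by simp
      qed
    qed
    then show ?thesis using cl_eq_iff[OF wS y] by simp
  qed
  have "geodesic_segment cn cd (\<lambda>\<tau>. cl (w \<tau>)) (cl x) (cl y)"
    unfolding geodesic_segment_def using cl_in[OF wS] w0 dy dist L by auto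
  moreover have "\<exists>v\<in>cl (w \<tau>). eventually (\<lambda>n. v n \<in> A n) \<omega>" for \<tau>
    using A pos[of \<tau>] by (intro bexI[OF _ cl_self[OF wS]]) (auto elim!: eventually_mono simp: w_def)
  ultimately show ?thesis by blast
qed

lemma cone_geodesic_space: "geodesic_space cn cd"
  unfolding geodesic_space_def
proof (intro conjI ballI)
  show "Metric_space cn cd" ..
  fix p q assume "p \<in> cn" "q \<in> cn"
  then obtain x y where xy: "x \<in> seqs" "y \<in> seqs" "p = cl x" "q = cl y" using cone_obtain by metis
  have "\<forall>n. \<exists>g. geodesic_segment M d g (x n) (y n)"
    using geo seqs_in xy(1,2) by (simp add: geodesic_space_def)
  then obtain \<gamma> where "\<And>n. geodesic_segment M d (\<gamma> n) (x n) (y n)" by metis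
  from cone_geodesic[OF xy(1,2) this, of "\<lambda>_. UNIV"] show "\<exists>g. geodesic_segment cn cd g p q"
    using xy by auto
qed

end

section \<open>Simple loops in asymptotic cones\<close>

text \<open>Up to D, the two visits lie on either side of the midpoint, so \<open>pr V x\<close>
  keeps about half the distance to z, and \<open>pr V z\<close> to x. In the cone this prevents the
  projection of one point from being the other point.\<close>

lemma (in guided) midpoint_guide:
  assumes x: "x \<in> M" and z: "z \<in> M"
  shows "d x z / 2 \<le> D \<or> (\<exists>V\<in>I. pr V x \<noteq> pr V z \<and>
    d x z / 2 - 2 * D \<le> d (pr V x) z \<and> d x z / 2 - 2 * D \<le> d x (pr V z))"
proof -
  obtain g where g: "geodesic_segment M d g x z" using geodesic x z by (meson geodesic_space_def)
  let ?t = "d x z / 2"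
  have t: "?t \<in> {0..d x z}" by auto
  have gx: "d x (g u) = u" and gz: "d (g u) z = d x z - u" if "u \<in> {0..d x z}" for u
    using geodesic_segmentD(4)[OF g, of 0 u] geodesic_segmentD(4)[OF g, of u "d x z"]
      geodesic_segmentD(1,2)[OF g] that by auto
  have gM: "g u \<in> M" if "u \<in> {0..d x z}" for u using geodesic_segmentD(3)[OF g that] .
  from guide[OF x z g t] consider "d x (g ?t) \<le> D \<or> d (g ?t) z \<le> D" | V a b where "V \<in> I" "pr V x \<noteq> pr V z"
      "a \<in> {0..d x z}" "b \<in> {0..d x z}"
      "d (g a) (pr V x) \<le> D" "d (g b) (pr V z) \<le> D" "a - D \<le> ?t" "?t \<le> b + D"
    by blast
  then show ?thesis
  proof cases
    case 1
    then show ?thesis using gx[OF t] gz[OF t] by auto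
  next
    case (2 V a b)
    have pM: "pr V x \<in> M" "pr V z \<in> M" using pr_in_M 2(1) x z by auto
    have "d x z / 2 - 2 * D \<le> d (pr V x) z"
      using triangle[OF gM[OF 2(3)] pM(1) z] 2(5,7) gz[OF 2(3)] by linarith
    moreover have "d x z / 2 - 2 * D \<le> d x (pr V z)"
      using triangle[OF x pM(2) gM[OF 2(4)]] 2(6,8) gx[OF 2(4)] commute[of "pr V z" "g b"] by linarith
    ultimately show ?thesis using 2(1,2) by blast
  qed
qed

section \<open>Limits of projections\<close>

locale guided_cone = guided M d I P pr D + cone_space M d \<omega> s b
  for M :: "'a set" and d and I :: "'i set" and P pr D \<omega> s b
begin

text \<open>Projections to pieces that run off to infinity may leave the cone. A second point of the
  cone with a different projection prevents this, by \<open>pr_jump\<close>.\<close>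

lemma pr_seq:
  assumes V: "\<And>n. V n \<in> I" and x: "x \<in> seqs" and z: "z \<in> seqs"
    and ne: "eventually (\<lambda>n. pr (V n) (x n) \<noteq> pr (V n) (z n)) \<omega>"
  shows "(\<lambda>n. pr (V n) (x n)) \<in> seqs"
proof -
  obtain B where B: "eventually (\<lambda>n. rd x z n \<le> B) \<omega>" using seqs_bounded[OF x z] by blast
  have "eventually (\<lambda>n. D / s n < 1) \<omega>" using order_tendstoD(2)[OF const_rescaled, of 1 D] by simp
  then have "eventually (\<lambda>n. rd (\<lambda>n. pr (V n) (x n)) x n \<le> B + 1) \<omega>"
    using ne B s_pos
  proof eventually_elim
    case (elim n)
    have "d (pr (V n) (x n)) (x n) / s n \<le> (d (x n) (z n) + D) / s n"
      using pr_jump[OF V[of n] seqs_in[OF x, of n] seqs_in[OF z, of n]] elim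
        commute[of "x n"] by (intro divide_right_mono) auto
    moreover have "d (x n) (z n) / s n \<le> B" "D / s n < 1" using elim by (auto simp only: rd_def)
    ultimately show ?case unfolding rd_def add_divide_distrib by linarith
  qed
  then show ?thesis by (rule seqs_close[OF x pr_in_M[OF V seqs_in[OF x]]])
qed

text \<open>\<open>pr_jump\<close> in the cone: a point with another projection is at least as far
  from x as p is.\<close>

lemma pr_locally_constant:
  assumes V: "\<And>n. V n \<in> I" and x: "x \<in> seqs" and y: "y \<in> seqs" and p: "p \<in> seqs"
    and less: "cd (cl x) (cl y) < cd (cl x) (cl p)"
    and ev: "eventually (\<lambda>n. pr (V n) (x n) = p n) \<omega>"
  shows "eventually (\<lambda>n. pr (V n) (y n) = p n) \<omega>"
proof (rule ccontr)
  assume "\<not> ?thesis"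
  then have "eventually (\<lambda>n. pr (V n) (y n) \<noteq> p n) \<omega>" by (rule not_eventually_ultra)
  then have "eventually (\<lambda>n. rd x p n \<le> rd x y n + D / s n) \<omega>"
    using ev s_pos
  proof eventually_elim
    case (elim n)
    have "d (x n) (p n) / s n \<le> (d (x n) (y n) + D) / s n"
      using pr_jump[OF V[of n] seqs_in[OF x, of n] seqs_in[OF y, of n]] elim by (intro divide_right_mono) auto
    then show ?case by (simp add: rd_def add_divide_distrib)
  qed
  from cd_le[OF x p x y this] less show False by simp
qed

text \<open>All representatives are required to project to p because near \<open>cl p\<close> the
  answer may depend on the representative; elsewhere one representative decides, by
  \<open>projects_to_near\<close>.\<close>

definition projects_to :: "(nat \<Rightarrow> 'i) \<Rightarrow> (nat \<Rightarrow> 'a) \<Rightarrow> (nat \<Rightarrow> 'a) set \<Rightarrow> bool" where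
  "projects_to V p q \<longleftrightarrow> (\<forall>x\<in>q. eventually (\<lambda>n. pr (V n) (x n) = p n) \<omega>)"

lemma projects_to_near:
  assumes V: "\<And>n. V n \<in> I" and p: "p \<in> seqs" and q: "q \<in> cn" and q': "q' \<in> cn"
    and less: "cd q q' < cd q (cl p)" and x: "x \<in> q" "eventually (\<lambda>n. pr (V n) (x n) = p n) \<omega>"
  shows "projects_to V p q'"
  unfolding projects_to_def
proof
  fix y assume y: "y \<in> q'"
  show "eventually (\<lambda>n. pr (V n) (y n) = p n) \<omega>"
    using pr_locally_constant[OF V _ _ p _ x(2)] cone_rep[OF q x(1)] cone_rep[OF q' y] less by simp
qed

text \<open>Away from \<open>cl p\<close> the projection is locally constant along the path, hence
  constant on a connected set of times.\<close>

lemma projects_to_connected: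
  assumes V: "\<And>n. V n \<in> I" and p: "p \<in> seqs" and K: "connected K" "K \<subseteq> {0..1::real}"
    and g: "pathin cone.mtopology g" and avoid: "cl p \<notin> g ` K"
    and \<tau>: "\<tau>1 \<in> K" "\<tau>2 \<in> K" and at: "projects_to V p (g \<tau>1)"
  shows "projects_to V p (g \<tau>2)"
proof (rule connected_induction_simple[OF K(1) \<tau>, of "\<lambda>\<tau>. projects_to V p (g \<tau>)", OF at])
  fix \<tau> assume \<tau>: "\<tau> \<in> K"
  have cont: "continuous_map (top_of_set {0..1}) cone.mtopology g" using g by (simp add: pathin_def)
  have gin: "g \<sigma> \<in> cn" if "\<sigma> \<in> K" for \<sigma>
    using continuous_map_image_subset_topspace[OF cont] that K by auto
  define \<epsilon> where "\<epsilon> = cd (g \<tau>) (cl p)"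
  have "g \<tau> \<noteq> cl p" using avoid \<tau> by auto
  then have \<epsilon>: "\<epsilon> > 0" using gin[OF \<tau>] cl_in[OF p] by (simp add: \<epsilon>_def)
  \<comment> \<open>Two points in this ball are less than \<open>\<epsilon> / 2\<close> apart, but
    more than \<open>3 * \<epsilon> / 4\<close> away from \<open>cl p\<close>.\<close>
  obtain U where U: "openin (top_of_set {0..1}) U" "\<tau> \<in> U" "\<forall>\<sigma>\<in>U. g \<sigma> \<in> cone.mball (g \<tau>) (\<epsilon> / 4)"
  proof -
    have "\<tau> \<in> topspace (top_of_set {0..1})" "\<epsilon> / 4 > 0" using \<tau> K \<epsilon> by auto
    then show thesis using cont that unfolding cone.continuous_map_to_metric by blast
  qed
  have "projects_to V p (g \<sigma>')" if \<sigma>: "\<sigma> \<in> K \<inter> U" "\<sigma>' \<in> K \<inter> U" "projects_to V p (g \<sigma>)" for \<sigma> \<sigma>'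
  proof -
    obtain x where x: "x \<in> g \<sigma>" using cone_nonempty gin \<sigma> by blast
    have 1: "cd (g \<tau>) (g \<sigma>) < \<epsilon> / 4" "cd (g \<tau>) (g \<sigma>') < \<epsilon> / 4" using U(3) \<sigma> by auto
    have gs: "g \<tau> \<in> cn" "g \<sigma> \<in> cn" "g \<sigma>' \<in> cn" using gin \<tau> \<sigma> by auto
    have "cd (g \<sigma>) (g \<sigma>') < cd (g \<sigma>) (cl p)"
      using cone.triangle[OF gs(2,1,3)] cone.triangle[OF gs(1,2) cl_in[OF p]] 1
        cone.commute[of "g \<sigma>" "g \<tau>"] \<epsilon>_def \<epsilon> by linarith
    then show ?thesis using projects_to_near[OF V p gs(2,3) _ x] \<sigma>(3) x by (simp add: projects_to_def)
  qed
  moreover have "openin (top_of_set K) (K \<inter> U)"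
    using U(1) K(2) by (metis inf.absorb_iff2 openin_subtopology_Int2 subtopology_subtopology)
  ultimately show "\<exists>T. openin (top_of_set K) T \<and> \<tau> \<in> T \<and>
      (\<forall>x\<in>T. \<forall>y\<in>T. projects_to V p (g x) \<longrightarrow> projects_to V p (g y))"
    using \<tau> U(2) by (intro exI[of _ "K \<inter> U"]) blast
qed

text \<open>Both arcs of the loop between the two points pass through the limit of the projections.\<close>

lemma loop_projection:
  assumes V: "\<And>n. V n \<in> I" and g: "simple_loop cn cd g"
    and \<tau>: "\<tau>1 \<in> {0..<1}" "\<tau>2 \<in> {0..<1}" and x: "x \<in> g \<tau>1" and z: "z \<in> g \<tau>2"
    and ne: "eventually (\<lambda>n. pr (V n) (x n) \<noteq> pr (V n) (z n)) \<omega>"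
  shows "cl (\<lambda>n. pr (V n) (x n)) \<in> {g \<tau>1, g \<tau>2}"
proof (rule ccontr)
  assume not: "\<not> ?thesis"
  let ?p = "\<lambda>n. pr (V n) (x n)"
  have path: "pathin cone.mtopology g" and g01: "g 0 = g 1" and inj: "inj_on g {0..<1}"
    using g by (auto simp: simple_loop_def)
  have gin: "g \<sigma> \<in> cn" if "\<sigma> \<in> {0..1}" for \<sigma>
    using path that continuous_map_image_subset_topspace by (force simp: pathin_def)
  have xS: "x \<in> seqs" and zS: "z \<in> seqs" using cone_rep(1)[OF gin] x z \<tau> by (meson atLeastLessThan_iff atLeastAtMost_iff less_imp_le)+
  have p: "?p \<in> seqs" using pr_seq[OF V xS zS ne] .
  have g1: "g \<tau>1 \<in> cn" using gin \<tau> by auto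
  have "cd (g \<tau>1) (g \<tau>1) < cd (g \<tau>1) (cl ?p)" using g1 cl_in[OF p] not by auto
  then have at1: "projects_to V ?p (g \<tau>1)" using projects_to_near[OF V p g1 g1 _ x] by simp
  have at2: "\<not> projects_to V ?p (g \<tau>2)"
  proof
    assume "projects_to V ?p (g \<tau>2)"
    then have "eventually (\<lambda>n. pr (V n) (z n) = pr (V n) (x n)) \<omega>" using z by (simp add: projects_to_def)
    then have "eventually (\<lambda>n. False) \<omega>" using ne by eventually_elim simp
    then show False using nontrivial by simp
  qed
  define m where "m = min \<tau>1 \<tau>2"
  define m' where "m' = max \<tau>1 \<tau>2"
  have mm: "0 \<le> m" "m \<le> m'" "m' < 1" using \<tau> by (auto simp: m_def m'_def)
  have not': "g m \<noteq> cl ?p" "g m' \<noteq> cl ?p" using not by (auto simp: m_def m'_def min_def max_def)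
  have diff: "projects_to V ?p (g m) \<noteq> projects_to V ?p (g m')"
    using at1 at2 by (auto simp: m_def m'_def min_def max_def)
  have arc: "cl ?p \<in> g ` {\<alpha>..\<beta>} \<or> (projects_to V ?p (g \<alpha>) \<longleftrightarrow> projects_to V ?p (g \<beta>))"
    if "0 \<le> \<alpha>" "\<alpha> \<le> \<beta>" "\<beta> \<le> 1" for \<alpha> \<beta>
  proof -
    have K: "connected {\<alpha>..\<beta>}" "{\<alpha>..\<beta>} \<subseteq> {0..1}" using that by auto
    show ?thesis
      using projects_to_connected[OF V p K path, of \<alpha> \<beta>] projects_to_connected[OF V p K path, of \<beta> \<alpha>] that by auto
  qed
  have "cl ?p \<in> g ` {m..m'}" using arc[of m m'] mm diff by auto
  then obtain \<sigma> where \<sigma>: "\<sigma> \<in> {m..m'}" "cl ?p = g \<sigma>" by blast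
  then have \<sigma>': "m < \<sigma>" "\<sigma> < m'" using not' by (auto simp: order_less_le)
  have "cl ?p \<in> g ` {0..m} \<or> cl ?p \<in> g ` {m'..1}"
    using arc[of 0 m] arc[of m' 1] mm diff g01 by auto
  then obtain \<rho> where \<rho>: "\<rho> \<in> {0..m} \<union> {m'..1}" "cl ?p = g \<rho>" by blast
  \<comment> \<open>The time 1 is replaced by 0, since the loop is injective only on the half-open
    interval.\<close>
  define \<rho>' where "\<rho>' = (if \<rho> = 1 then 0 else \<rho>)"
  have "g \<rho>' = g \<sigma>" "\<rho>' \<in> {0..<1}" using \<rho> \<sigma>(2) g01 mm by (auto simp: \<rho>'_def)
  then have "\<rho>' = \<sigma>" using inj \<sigma>' mm by (auto dest: inj_onD)
  then show False using \<sigma>' \<rho>(1) mm by (auto simp: \<rho>'_def split: if_splits)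
qed

definition piece_limit :: "(nat \<Rightarrow> 'i) \<Rightarrow> (nat \<Rightarrow> 'a) set set" where
  "piece_limit V = {q \<in> cn. \<exists>x\<in>q. eventually (\<lambda>n. x n \<in> P (V n)) \<omega>}"

text \<open>\<open>midpoint_guide\<close> provides \<open>V n\<close> as soon as x n and z n are far
  apart compared with D, which is \<omega>-almost surely the case; elsewhere any index will
  do.\<close>

lemma common_piece:
  assumes x: "x \<in> seqs" and z: "z \<in> seqs" and ne: "cl x \<noteq> cl z"
  obtains V where "\<And>n. V n \<in> I" "eventually (\<lambda>n. pr (V n) (x n) \<noteq> pr (V n) (z n)) \<omega>"
    "cl (\<lambda>n. pr (V n) (x n)) \<noteq> cl z" "cl (\<lambda>n. pr (V n) (z n)) \<noteq> cl x"
proof -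
  let ?L = "cd (cl x) (cl z)"
  have L: "?L > 0" using ne cl_in x z by simp
  define good where "good n V \<longleftrightarrow> V \<in> I \<and> pr V (x n) \<noteq> pr V (z n) \<and>
    d (x n) (z n) / 2 - 2 * D \<le> d (pr V (x n)) (z n) \<and> d (x n) (z n) / 2 - 2 * D \<le> d (x n) (pr V (z n))" for n V
  have "eventually (\<lambda>n. rd x z n > ?L / 2) \<omega>"
    using order_tendstoD(1)[OF cd_lim[OF x z], of "?L / 2"] L by simp
  moreover have "eventually (\<lambda>n. (2 * D) / s n < ?L / 2) \<omega>"
    using order_tendstoD(2)[OF const_rescaled, of "?L / 2" "2 * D"] L by simp
  ultimately have ev: "eventually (\<lambda>n. \<exists>V. good n V) \<omega>"
    using s_pos
  proof eventually_elim
    case (elim n)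
    then have "2 * D / s n < d (x n) (z n) / s n" unfolding rd_def by linarith
    then have "2 * D < d (x n) (z n)" using elim(3) by (simp add: divide_less_cancel)
    then show ?case using midpoint_guide[OF seqs_in[OF x] seqs_in[OF z], of n n] by (auto simp: good_def)
  qed
  have "\<exists>n V. good n V" using eventually_happens[OF ev] nontrivial by blast
  then have "I \<noteq> {}" by (auto simp: good_def)
  define V where "V n = (if \<exists>V. good n V then SOME V. good n V else SOME V. V \<in> I)" for n
  have good: "eventually (\<lambda>n. good n (V n)) \<omega>"
    using ev by eventually_elim (auto simp: V_def intro: someI_ex)
  have V: "V n \<in> I" for n
  proof (cases "\<exists>V. good n V")
    case True
    then have "good n (V n)" by (auto simp: V_def intro: someI_ex)
    then show ?thesis by (simp add: good_def)
  next
    case False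
    then show ?thesis using \<open>I \<noteq> {}\<close> by (auto simp: V_def some_in_eq)
  qed
  have ne': "eventually (\<lambda>n. pr (V n) (x n) \<noteq> pr (V n) (z n)) \<omega>"
    using good by eventually_elim (simp add: good_def)
  then have ne'': "eventually (\<lambda>n. pr (V n) (z n) \<noteq> pr (V n) (x n)) \<omega>" by eventually_elim simp
  note p = pr_seq[OF V x z ne'] and q = pr_seq[OF V z x ne'']
  \<comment> \<open>Equal limits of u and v would bound the distance of x and z by an amount that
    vanishes after rescaling. It is applied to a projection and the opposite point.\<close>
  have half: "False" if u: "u \<in> seqs" and v: "v \<in> seqs" and eq: "cl u = cl v"
    and far: "eventually (\<lambda>n. d (x n) (z n) / 2 - 2 * D \<le> d (u n) (v n)) \<omega>" for u v
  proof -
    have "eventually (\<lambda>n. rd x z n \<le> 2 * rd u v n + 4 * D / s n) \<omega>"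
      using far s_pos
    proof eventually_elim
      case (elim n)
      have "d (x n) (z n) / s n \<le> (2 * d (u n) (v n) + 4 * D) / s n"
        using elim by (intro divide_right_mono) auto
      then show ?case by (simp add: rd_def add_divide_distrib)
    qed
    moreover have "((\<lambda>n. 2 * rd u v n + 4 * D / s n) \<longlongrightarrow> 2 * 0 + 0) \<omega>"
      using cl_eq_iff[OF u v] eq by (intro tendsto_add tendsto_mult tendsto_const const_rescaled) auto
    ultimately have "?L \<le> 2 * 0 + 0" using tendsto_le[OF nontrivial _ cd_lim[OF x z]] by blast
    then show False using L by simp
  qed
  have "eventually (\<lambda>n. d (x n) (z n) / 2 - 2 * D \<le> d (pr (V n) (x n)) (z n)) \<omega>"
    "eventually (\<lambda>n. d (x n) (z n) / 2 - 2 * D \<le> d (x n) (pr (V n) (z n))) \<omega>"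
    using good by (eventually_elim, simp add: good_def)+
  then show thesis using that[OF V ne'] half[OF p z] half[OF x q] by metis
qed

text \<open>Apply \<open>common_piece\<close> to the points at times 0 and 1/2. By
  \<open>loop_projection\<close> each projection is one of the two points, and it is not the
  opposite one, so both points are their own projections and lie in the limit of V. For a further
  point outside this limit, the projection cannot be the point itself, so comparison with either of
  the two points identifies it with that point. Then the two would be equal.\<close>

lemma loop_in_piece:
  assumes g: "simple_loop cn cd g"
  shows "\<exists>V. (\<forall>n. V n \<in> I) \<and> g ` {0..1} \<subseteq> piece_limit V"
proof -
  have g01: "g 0 = g 1" and inj: "inj_on g {0..<1}" using g by (auto simp: simple_loop_def)
  have gin: "g \<sigma> \<in> cn" if "\<sigma> \<in> {0..1}" for \<sigma>
    using g that continuous_map_image_subset_topspace by (force simp: pathin_def simple_loop_def)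
  define h where "h = (1/2 :: real)"
  have h: "h \<in> {0..<1}" "h \<noteq> 0" by (auto simp: h_def)
  have 0: "(0::real) \<in> {0..<1}" by simp
  have "g 0 \<in> cn" "g h \<in> cn" using gin h by auto
  then obtain x z where x: "x \<in> g 0" and z: "z \<in> g h" using cone_nonempty by blast
  have gx: "x \<in> seqs" "g 0 = cl x" and gz: "z \<in> seqs" "g h = cl z"
    using cone_rep[OF gin x] cone_rep[OF gin z] h by auto
  have ne: "g 0 \<noteq> g h" using inj_onD[OF inj _ 0 h(1)] h(2) by auto
  obtain V where V: "\<And>n. V n \<in> I" and Vne: "eventually (\<lambda>n. pr (V n) (x n) \<noteq> pr (V n) (z n)) \<omega>"
    and px: "cl (\<lambda>n. pr (V n) (x n)) \<noteq> cl z" and pz: "cl (\<lambda>n. pr (V n) (z n)) \<noteq> cl x"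
    using common_piece[OF gx(1) gz(1)] ne unfolding gx gz by blast
  have Vne': "eventually (\<lambda>n. pr (V n) (z n) \<noteq> pr (V n) (x n)) \<omega>" using Vne by eventually_elim simp
  have pr_piece: "cl (\<lambda>n. pr (V n) (w n)) \<in> piece_limit V"
    if "(\<lambda>n. pr (V n) (w n)) \<in> seqs" "w \<in> seqs" for w
    unfolding piece_limit_def using that(1) pr_in[OF V seqs_in[OF that(2)]]
    by (intro CollectI conjI cl_in bexI[OF _ cl_self] always_eventually allI)
  have a: "cl (\<lambda>n. pr (V n) (x n)) = g 0"
    using loop_projection[OF V g 0 h(1) x z Vne] px gz by auto
  have c: "cl (\<lambda>n. pr (V n) (z n)) = g h"
    using loop_projection[OF V g h(1) 0 z x Vne'] pz gx by auto
  have S: "(\<lambda>n. pr (V n) (x n)) \<in> seqs" "(\<lambda>n. pr (V n) (z n)) \<in> seqs"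
    using pr_seq[OF V gx(1) gz(1) Vne] pr_seq[OF V gz(1) gx(1) Vne'] by auto
  have in0: "g 0 \<in> piece_limit V" and inh: "g h \<in> piece_limit V"
    using pr_piece[OF S(1) gx(1)] pr_piece[OF S(2) gz(1)] a c by auto
  have main: "g \<tau> \<in> piece_limit V" if \<tau>: "\<tau> \<in> {0..<1}" for \<tau>
  proof (rule ccontr)
    assume out: "g \<tau> \<notin> piece_limit V"
    have "g \<tau> \<in> cn" using gin \<tau> by auto
    then obtain y where y: "y \<in> g \<tau>" using cone_nonempty by blast
    have gy: "y \<in> seqs" "g \<tau> = cl y" using cone_rep[OF gin y] \<tau> by auto
    let ?r = "\<lambda>n. pr (V n) (y n)"
    have r: "cl ?r = g \<sigma>"
      if \<sigma>: "\<sigma> \<in> {0..<1}" and w: "w \<in> g \<sigma>" "w \<in> seqs" "(\<lambda>n. pr (V n) (w n)) \<in> seqs" "cl (\<lambda>n. pr (V n) (w n)) = g \<sigma>"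
      for \<sigma> w
    proof (cases "eventually (\<lambda>n. pr (V n) (y n) = pr (V n) (w n)) \<omega>")
      case True
      then have 1: "eventually (\<lambda>n. rd ?r (\<lambda>n. pr (V n) (w n)) n = 0) \<omega>"
      proof eventually_elim
        case (elim n)
        then show ?case using pr_in_M[OF V[of n] seqs_in[OF w(2), of n]] by (simp add: rd_def)
      qed
      then have "?r \<in> seqs"
        by (intro seqs_close[OF w(3) pr_in_M[OF V seqs_in[OF gy(1)]], where B = 0])
          (auto elim!: eventually_mono)
      then show ?thesis
        using cl_eq_iff[OF _ w(3)] tendsto_eventually[OF 1] w(4) by simp
    next
      case False
      then have ne: "eventually (\<lambda>n. pr (V n) (y n) \<noteq> pr (V n) (w n)) \<omega>" by (rule not_eventually_ultra)
      have in': "cl ?r \<in> piece_limit V" using pr_piece[OF pr_seq[OF V gy(1) w(2) ne] gy(1)] .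
      from loop_projection[OF V g \<tau> \<sigma> y w(1) ne] consider "cl ?r = g \<tau>" | "cl ?r = g \<sigma>" by blast
      then show ?thesis
      proof cases
        case 1
        then show ?thesis using in' out by metis
      qed
    qed
    have "g 0 = g h" using r[OF 0 x gx(1) S(1) a] r[OF h(1) z gz(1) S(2) c] by simp
    then show False using ne by simp
  qed
  have "g \<tau> \<in> piece_limit V" if "\<tau> \<in> {0..1}" for \<tau>
    using main[of \<tau>] in0 g01 that by (cases "\<tau> = 1") auto
  then show ?thesis using V by blast
qed

section \<open>Limits of pieces\<close>

lemma piece_limit_geodesic:
  assumes V: "\<And>n. V n \<in> I"
  shows "geodesic_space (piece_limit V) cd"
  unfolding geodesic_space_def
proof (intro conjI ballI)
  show "Metric_space (piece_limit V) cd"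
    by (rule cone.subspace) (auto simp: piece_limit_def)
  fix p q assume p: "p \<in> piece_limit V" and q: "q \<in> piece_limit V"
  obtain x y where xy: "x \<in> p" "y \<in> q" "eventually (\<lambda>n. x n \<in> P (V n)) \<omega>" "eventually (\<lambda>n. y n \<in> P (V n)) \<omega>"
    using p q by (auto simp: piece_limit_def)
  have pq: "p \<in> cn" "q \<in> cn" using p q by (auto simp: piece_limit_def)
  have S: "x \<in> seqs" "p = cl x" "y \<in> seqs" "q = cl y" using cone_rep pq xy by auto
  have "\<exists>h. geodesic_segment M d h (x n) (y n) \<and>
    (x n \<in> P (V n) \<and> y n \<in> P (V n) \<longrightarrow> h ` {0..d (x n) (y n)} \<subseteq> P (V n))" for n
  proof (cases "x n \<in> P (V n) \<and> y n \<in> P (V n)")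
    case True
    then obtain h where "geodesic_segment (P (V n)) d h (x n) (y n)"
      using piece_geodesic[OF V] by (meson geodesic_space_def)
    then show ?thesis using piece_sub[OF V[of n]] by (intro exI[of _ h]) (auto simp: geodesic_segment_def)
  next
    case False
    then show ?thesis using geodesic seqs_in S by (auto simp: geodesic_space_def)
  qed
  then obtain \<gamma> where \<gamma>: "\<And>n. geodesic_segment M d (\<gamma> n) (x n) (y n)"
    "\<And>n. x n \<in> P (V n) \<and> y n \<in> P (V n) \<Longrightarrow> \<gamma> n ` {0..d (x n) (y n)} \<subseteq> P (V n)" by metis
  have "eventually (\<lambda>n. \<gamma> n ` {0..d (x n) (y n)} \<subseteq> P (V n)) \<omega>"
    using xy(3,4) by eventually_elim (use \<gamma>(2) in blast)
  from cone_geodesic[OF S(1,3) \<gamma>(1) this] obtain g where g: "geodesic_segment cn cd g p q"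
    "\<And>\<tau>. \<exists>w\<in>g \<tau>. eventually (\<lambda>n. w n \<in> P (V n)) \<omega>" using S by blast
  have "g ` {0..cd p q} \<subseteq> piece_limit V"
    using g(2) geodesic_segmentD(3)[OF g(1)] by (auto simp: piece_limit_def)
  then show "\<exists>g. geodesic_segment (piece_limit V) cd g p q"
    using g(1) by (auto simp: geodesic_segment_def)
qed

text \<open>By \<open>pr_const\<close> all of \<open>P (W n)\<close> projects to a single point c of
  \<open>P (V n)\<close>. A point of \<open>P (V n)\<close> at distance r from a point of
  \<open>P (W n)\<close> is within \<open>2 * r + D\<close> of c, so after rescaling there is room
  for one common point only.\<close>

lemma piece_limits_meet:
  assumes V: "\<And>n. V n \<in> I" and W: "\<And>n. W n \<in> I" and ne: "eventually (\<lambda>n. V n \<noteq> W n) \<omega>"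
    and p: "p \<in> piece_limit V \<inter> piece_limit W" and q: "q \<in> piece_limit V \<inter> piece_limit W"
  shows "p = q"
proof -
  have "\<exists>x\<in>p. eventually (\<lambda>n. x n \<in> P (V n)) \<omega>" "\<exists>x\<in>p. eventually (\<lambda>n. x n \<in> P (W n)) \<omega>"
    "\<exists>x\<in>q. eventually (\<lambda>n. x n \<in> P (V n)) \<omega>" "\<exists>x\<in>q. eventually (\<lambda>n. x n \<in> P (W n)) \<omega>"
    using p q by (auto simp: piece_limit_def)
  then obtain x x' y y' where *: "x \<in> p" "x' \<in> p" "y \<in> q" "y' \<in> q"
    "eventually (\<lambda>n. x n \<in> P (V n)) \<omega>" "eventually (\<lambda>n. x' n \<in> P (W n)) \<omega>"
    "eventually (\<lambda>n. y n \<in> P (V n)) \<omega>" "eventually (\<lambda>n. y' n \<in> P (W n)) \<omega>"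
    by blast
  have pq: "p \<in> cn" "q \<in> cn" using p q by (auto simp: piece_limit_def)
  have S: "x \<in> seqs" "x' \<in> seqs" "y \<in> seqs" "y' \<in> seqs" using cone_rep(1) pq * by auto
  have e: "p = cl x" "p = cl x'" "q = cl y" "q = cl y'" using cone_rep(2) pq * by auto
  have "eventually (\<lambda>n. rd x y n \<le> 2 * rd x x' n + 2 * rd y y' n + 2 * D / s n) \<omega>"
    using *(5-8) ne s_pos
  proof eventually_elim
    case (elim n)
    let ?c = "pr (V n) (x' n)"
    have c: "pr (V n) (y' n) = ?c" using pr_const[OF V W elim(5) elim(4,2)] .
    have cM: "?c \<in> M" using pr_in_M[OF V seqs_in[OF S(2)]] .
    have close: "d u ?c \<le> 2 * d u u' + D" if u: "u \<in> P (V n)" "u' \<in> M" "pr (V n) u' = ?c" for u u'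
    proof (cases "u = ?c")
      case True
      then show ?thesis using D_ge nonneg[of u u'] cM by simp
    next
      case False
      have uM: "u \<in> M" using u(1) piece_sub[OF V] by auto
      have "pr (V n) u' \<noteq> pr (V n) u" using u(3) False pr_id[OF V[of n] u(1)] by simp
      then have "d u' ?c \<le> d u' u + D" using pr_jump[OF V[of n] u(2) uM] u(3) by simp
      then show ?thesis using triangle[OF uM u(2) cM] commute[of u u'] by linarith
    qed
    have "d (x n) (y n) \<le> 2 * d (x n) (x' n) + 2 * d (y n) (y' n) + 2 * D"
      using triangle[OF seqs_in[OF S(1), of n] cM seqs_in[OF S(3), of n]]
        close[OF elim(1) seqs_in[OF S(2)] HOL.refl] close[OF elim(3) seqs_in[OF S(4)] c]
        commute[of "y n" ?c] by linarith
    then have "d (x n) (y n) / s n \<le> (2 * d (x n) (x' n) + 2 * d (y n) (y' n) + 2 * D) / s n"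
      using elim(6) by (intro divide_right_mono) auto
    then show ?case by (simp add: rd_def add_divide_distrib)
  qed
  moreover have "((\<lambda>n. 2 * rd x x' n + 2 * rd y y' n + 2 * D / s n) \<longlongrightarrow> 2 * 0 + 2 * 0 + 0) \<omega>"
    using cl_eq_iff[OF S(1,2)] cl_eq_iff[OF S(3,4)] e
    by (intro tendsto_add tendsto_mult tendsto_const const_rescaled) auto
  ultimately have "cd p q \<le> 2 * 0 + 2 * 0 + 0"
    using tendsto_le[OF nontrivial _ cd_lim[OF S(1,3)]] e by blast
  then have "cd p q = 0" using cone.nonneg[of p q] by linarith
  then show ?thesis using pq by simp
qed

lemma ultrapower_piece:
  assumes "c \<in> ultrapower \<omega> (P ` I)"
  obtains V where "\<forall>n. V n \<in> I" "(\<lambda>n. P (V n)) \<in> c"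
    "limit_set M d \<omega> s b c = piece_limit V"
proof -
  obtain A where A: "\<forall>n. A n \<in> P ` I"
    and c: "c = {B. (\<forall>n. B n \<in> P ` I) \<and> eventually (\<lambda>n. A n = B n) \<omega>}"
    using assms by (auto simp: ultrapower_def elim!: quotientE)
  have "\<forall>n. \<exists>v. v \<in> I \<and> A n = P v" using A by blast
  then obtain V where V: "\<And>n. V n \<in> I" "\<And>n. A n = P (V n)" by metis
  have in': "(\<lambda>n. P (V n)) \<in> c" using c V by auto
  have "(\<exists>B\<in>c. eventually (\<lambda>n. x n \<in> B n) \<omega>) \<longleftrightarrow> eventually (\<lambda>n. x n \<in> P (V n)) \<omega>" for x
  proof
    assume "\<exists>B\<in>c. eventually (\<lambda>n. x n \<in> B n) \<omega>"
    then obtain B where "eventually (\<lambda>n. A n = B n) \<omega>" "eventually (\<lambda>n. x n \<in> B n) \<omega>" using c by blast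
    then show "eventually (\<lambda>n. x n \<in> P (V n)) \<omega>" by eventually_elim (simp add: V(2)[symmetric])
  next
    assume "eventually (\<lambda>n. x n \<in> P (V n)) \<omega>"
    then show "\<exists>B\<in>c. eventually (\<lambda>n. x n \<in> B n) \<omega>" using in' by (rule bexI)
  qed
  then have "limit_set M d \<omega> s b c = piece_limit V"
    unfolding limit_set_def piece_limit_def by simp
  then show thesis using that[of V] V(1) in' by blast
qed

lemma ultrapower_class:
  assumes "\<And>n. V n \<in> I"
  shows "\<exists>c\<in>ultrapower \<omega> (P ` I). limit_set M d \<omega> s b c = piece_limit V"
proof -
  let ?R = "{(A, B). (\<forall>n. A n \<in> P ` I) \<and> (\<forall>n. B n \<in> P ` I) \<and> eventually (\<lambda>n. A n = B n) \<omega>}"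
  let ?c = "?R `` {\<lambda>n. P (V n)}"
  have c: "?c \<in> ultrapower \<omega> (P ` I)"
    unfolding ultrapower_def using assms by (intro quotientI) auto
  have "(\<exists>B\<in>?c. eventually (\<lambda>n. x n \<in> B n) \<omega>) \<longleftrightarrow> eventually (\<lambda>n. x n \<in> P (V n)) \<omega>" for x
  proof
    assume "\<exists>B\<in>?c. eventually (\<lambda>n. x n \<in> B n) \<omega>"
    then obtain B where "eventually (\<lambda>n. P (V n) = B n) \<omega>" "eventually (\<lambda>n. x n \<in> B n) \<omega>" by blast
    then show "eventually (\<lambda>n. x n \<in> P (V n)) \<omega>" by eventually_elim simp
  next
    have "(\<lambda>n. P (V n)) \<in> ?c" using assms by auto
    then show "eventually (\<lambda>n. x n \<in> P (V n)) \<omega> \<Longrightarrow> \<exists>B\<in>?c. eventually (\<lambda>n. x n \<in> B n) \<omega>"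
      by (rule bexI[rotated])
  qed
  then have "limit_set M d \<omega> s b ?c = piece_limit V"
    unfolding limit_set_def piece_limit_def by simp
  then show ?thesis using c by blast
qed

theorem cone_tree_graded:
  "tree_graded cn cd {c \<in> ultrapower \<omega> (P ` I). limit_set M d \<omega> s b c \<noteq> {}} (limit_set M d \<omega> s b)"
  unfolding tree_graded_def
proof (intro conjI ballI allI impI)
  show "geodesic_space cn cd" by (rule cone_geodesic_space)
  show "limit_set M d \<omega> s b c \<subseteq> cn" for c by (auto simp: limit_set_def)
  show "geodesic_space (limit_set M d \<omega> s b c) cd"
    if "c \<in> {c \<in> ultrapower \<omega> (P ` I). limit_set M d \<omega> s b c \<noteq> {}}" for c
  proof -
    have "c \<in> ultrapower \<omega> (P ` I)" using that by simp
    from ultrapower_piece[OF this] obtain V where "\<forall>n. V n \<in> I" "(\<lambda>n. P (V n)) \<in> c"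
      "limit_set M d \<omega> s b c = piece_limit V" .
    then show ?thesis using piece_limit_geodesic[of V] by simp
  qed
next
  fix c c' p q
  assume "c \<in> {c \<in> ultrapower \<omega> (P ` I). limit_set M d \<omega> s b c \<noteq> {}}"
    "c' \<in> {c \<in> ultrapower \<omega> (P ` I). limit_set M d \<omega> s b c \<noteq> {}}"
  then have c: "c \<in> ultrapower \<omega> (P ` I)" and c': "c' \<in> ultrapower \<omega> (P ` I)" by auto
  assume ne: "c \<noteq> c'"
    and p: "p \<in> limit_set M d \<omega> s b c \<inter> limit_set M d \<omega> s b c'"
    and q: "q \<in> limit_set M d \<omega> s b c \<inter> limit_set M d \<omega> s b c'"
  obtain V where V: "\<forall>n. V n \<in> I" "(\<lambda>n. P (V n)) \<in> c" "limit_set M d \<omega> s b c = piece_limit V"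
    using ultrapower_piece[OF c] .
  obtain W where W: "\<forall>n. W n \<in> I" "(\<lambda>n. P (W n)) \<in> c'" "limit_set M d \<omega> s b c' = piece_limit W"
    using ultrapower_piece[OF c'] .
  \<comment> \<open>Indices that agree almost surely would put the two sequences of sets into one
    class; so they differ almost surely, by the ultrafilter property.\<close>
  have "\<not> eventually (\<lambda>n. V n = W n) \<omega>"
  proof
    assume "eventually (\<lambda>n. V n = W n) \<omega>"
    then have PVW: "eventually (\<lambda>n. P (V n) = P (W n)) \<omega>" by eventually_elim simp
    obtain A where A: "c = {B. (\<forall>n. B n \<in> P ` I) \<and> eventually (\<lambda>n. A n = B n) \<omega>}"
      using c by (auto simp: ultrapower_def elim!: quotientE)
    obtain A' where A': "c' = {B. (\<forall>n. B n \<in> P ` I) \<and> eventually (\<lambda>n. A' n = B n) \<omega>}"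
      using c' by (auto simp: ultrapower_def elim!: quotientE)
    have "eventually (\<lambda>n. A n = P (V n)) \<omega>" "eventually (\<lambda>n. A' n = P (W n)) \<omega>"
      using V(2) W(2) A A' by auto
    then have AA': "eventually (\<lambda>n. A n = A' n) \<omega>" using PVW by eventually_elim simp
    have "eventually (\<lambda>n. A n = B n) \<omega> \<longleftrightarrow> eventually (\<lambda>n. A' n = B n) \<omega>" for B
    proof
      assume "eventually (\<lambda>n. A n = B n) \<omega>"
      then show "eventually (\<lambda>n. A' n = B n) \<omega>" using AA' by eventually_elim simp
    next
      assume "eventually (\<lambda>n. A' n = B n) \<omega>"
      then show "eventually (\<lambda>n. A n = B n) \<omega>" using AA' by eventually_elim simp
    qed
    then show False using ne A A' by simp
  qed
  from not_eventually_ultra[OF this] show "p = q"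
    using piece_limits_meet[OF V(1)[rule_format] W(1)[rule_format]] p q V(3) W(3) by simp
next
  fix g assume "simple_loop cn cd g"
  from loop_in_piece[OF this] obtain V where V: "\<And>n. V n \<in> I" "g ` {0..1} \<subseteq> piece_limit V" by blast
  obtain c where "c \<in> ultrapower \<omega> (P ` I)" "limit_set M d \<omega> s b c = piece_limit V"
    using ultrapower_class[of V] V(1) by blast
  then show "\<exists>c\<in>{c \<in> ultrapower \<omega> (P ` I). limit_set M d \<omega> s b c \<noteq> {}}. g ` {0..1} \<subseteq> limit_set M d \<omega> s b c"
    using V(2) by (intro bexI[of _ c]) auto
qed

end

theorem (in guided) asymptotically_tree_graded_pieces:
  "asymptotically_tree_graded M d (P ` I)"
  unfolding asymptotically_tree_graded_def
proof (intro conjI allI impI)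
  show "Metric_space M d" ..
  show "\<forall>A\<in>P ` I. A \<subseteq> M" using piece_sub by blast
  fix \<omega> and s :: "nat \<Rightarrow> real" and b :: "nat \<Rightarrow> 'a"
  assume *: "nonprincipal_ultrafilter \<omega> \<and> filterlim s at_top \<omega> \<and> (\<forall>n. b n \<in> M)"
  interpret guided_cone M d I P pr D \<omega> s b
    using * geodesic by unfold_locales auto
  show "tree_graded (cone M d \<omega> s b) (cone_dist M d \<omega> s b)
      {c \<in> ultrapower \<omega> (P ` I). limit_set M d \<omega> s b c \<noteq> {}} (limit_set M d \<omega> s b)"
    by (rule cone_tree_graded)
qed

section \<open>Transfer along isometries\<close>

lemma bottleneck_isometry:
  assumes "bottleneck A dA s c \<Delta>" "i \<in> B \<rightarrow> A" and iso: "\<And>x y. x \<in> B \<Longrightarrow> y \<in> B \<Longrightarrow> dA (i x) (i y) = d x y"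
  shows "bottleneck B d s c \<Delta>"
  unfolding bottleneck_def
proof (intro allI impI, elim conjE)
  fix f :: "nat \<Rightarrow> 'b" and n u
  assume f: "f ` {..n} \<subseteq> B" and step: "\<forall>k<n. d (f k) (f (Suc k)) \<le> s" and u: "u \<in> B"
    and btw: "d (f 0) u + d u (f n) \<le> d (f 0) (f n) + c"
  have fB: "f k \<in> B" if "k \<le> n" for k using f that by auto
  have "\<exists>k\<le>n. dA ((i \<circ> f) k) (i u) \<le> \<Delta>"
  proof (rule bottleneckD[OF assms(1)])
    show "(i \<circ> f) ` {..n} \<subseteq> A" using assms(2) fB by auto
    show "\<forall>k<n. dA ((i \<circ> f) k) ((i \<circ> f) (Suc k)) \<le> s" using step iso fB by simp
    show "i u \<in> A" using assms(2) u by auto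
    show "dA ((i \<circ> f) 0) (i u) + dA (i u) ((i \<circ> f) n) \<le> dA ((i \<circ> f) 0) ((i \<circ> f) n) + c"
      using btw iso fB u by simp
  qed
  then show "\<exists>k\<le>n. d (f k) u \<le> \<Delta>" using iso fB u by auto
qed

lemma geodesic_segment_isometry:
  assumes g: "geodesic_segment A dA g x y" and e: "e \<in> A \<rightarrow> B" and xy: "x \<in> A" "y \<in> A"
    and iso: "\<And>x y. x \<in> A \<Longrightarrow> y \<in> A \<Longrightarrow> d (e x) (e y) = dA x y"
  shows "geodesic_segment B d (\<lambda>s. e (g s)) (e x) (e y)"
  unfolding geodesic_segment_def iso[OF xy]
  using g e iso by (auto simp: geodesic_segment_def image_subset_iff)

lemma delta_hyperbolic_isometry:
  assumes hyp: "delta_hyperbolic \<delta> A dA" and i: "i \<in> B \<rightarrow> A"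
    and iso: "\<And>x y. x \<in> B \<Longrightarrow> y \<in> B \<Longrightarrow> dA (i x) (i y) = d x y" and geo: "geodesic_space B d"
  shows "delta_hyperbolic \<delta> B d"
  unfolding delta_hyperbolic_def
proof (intro conjI ballI allI impI)
  show "0 \<le> \<delta>" using hyp by (simp add: delta_hyperbolic_def)
  show "geodesic_space B d" by (rule geo)
  fix x y z f g h p
  assume pts: "x \<in> B" "y \<in> B" "z \<in> B"
    and "geodesic_segment B d f x y \<and> geodesic_segment B d g y z \<and> geodesic_segment B d h x z"
  then have seg: "geodesic_segment B d f x y" "geodesic_segment B d g y z" "geodesic_segment B d h x z" by auto
  assume "p \<in> f ` {0..d x y}"
  then obtain t where t: "t \<in> {0..d x y}" "p = f t" by auto
  have pA: "i x \<in> A" "i y \<in> A" "i z \<in> A" using i pts by auto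
  have "\<exists>q \<in> (\<lambda>s. i (g s)) ` {0..d y z} \<union> (\<lambda>s. i (h s)) ` {0..d x z}. dA (i (f t)) q \<le> \<delta>"
    using delta_hyperbolicD[OF hyp pA geodesic_segment_isometry[OF seg(1) i pts(1,2) iso]
        geodesic_segment_isometry[OF seg(2) i pts(2,3) iso] geodesic_segment_isometry[OF seg(3) i pts(1,3) iso], of t]
      t(1) iso pts by simp
  then show "\<exists>q\<in>g ` {0..d y z} \<union> h ` {0..d x z}. d p q \<le> \<delta>"
    using iso geodesic_segmentD(3)[OF seg(1) t(1)] geodesic_segmentD(3)[OF seg(2)] geodesic_segmentD(3)[OF seg(3)] t(2)
    by (auto; metis UnI1 UnI2 atLeastAtMost_iff image_eqI)
qed

section \<open>Projection complexes\<close>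

locale projection_complex =
  fixes I :: "'i set" and G :: "'i \<Rightarrow> ('v, 'e) mgraph" and \<pi> :: "'i \<Rightarrow> 'i \<Rightarrow> 'v set" and \<theta> K :: nat
  assumes graphs: "\<And>X. X \<in> I \<Longrightarrow> wf_mgraph (G X) \<and> unit_mgraph (G X) \<and> connected_mgraph (G X)"
    and proj: "\<And>X Y. X \<in> I \<Longrightarrow> Y \<in> I \<Longrightarrow> X \<noteq> Y \<Longrightarrow> \<pi> Y X \<noteq> {} \<and> \<pi> Y X \<subseteq> mverts (G Y)"
    and diam: "\<And>X Y. X \<in> I \<Longrightarrow> Y \<in> I \<Longrightarrow> X \<noteq> Y \<Longrightarrow> proj_dist G \<pi> Y X X \<le> ereal (real \<theta>)"
    and P1': "\<And>X Y Z. X \<in> I \<Longrightarrow> Y \<in> I \<Longrightarrow> Z \<in> I \<Longrightarrow> X \<noteq> Y \<Longrightarrow> Y \<noteq> Z \<Longrightarrow> X \<noteq> Z \<Longrightarrow>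
                proj_dist G \<pi> Y X Z > ereal (real \<theta>) \<Longrightarrow> \<pi> X Y = \<pi> X Z"
    and fin: "\<And>X Z. X \<in> I \<Longrightarrow> Z \<in> I \<Longrightarrow>
                finite {Y \<in> I - {X, Z}. proj_dist G \<pi> Y X Z > ereal (real \<theta>)}"
    and K: "K > 0" "K \<ge> 4 * \<theta>"
begin

section \<open>Closeness of projections\<close>

abbreviation vd :: "'i \<Rightarrow> 'v \<Rightarrow> 'v \<Rightarrow> real" where
  "vd X u v \<equiv> gdist (G X) (Vert u) (Vert v)"

lemma length_graph_G: "X \<in> I \<Longrightarrow> length_graph (G X)"
  using graphs[of X] by unfold_locales (auto simp: unit_mgraph_def)

text \<open>An elementary form of an upper bound on \<open>proj_dist\<close>, which is a supremum in
  \<open>ereal\<close>; see \<open>proj_dist_le\<close>.\<close>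

definition close :: "nat \<Rightarrow> 'i \<Rightarrow> 'i \<Rightarrow> 'i \<Rightarrow> bool" where
  "close c Y X Z \<longleftrightarrow> (\<forall>u\<in>\<pi> Y X \<union> \<pi> Y Z. \<forall>v\<in>\<pi> Y X \<union> \<pi> Y Z. vd Y u v \<le> real c)"

lemma proj_dist_le: "proj_dist G \<pi> Y X Z \<le> ereal (real c) \<longleftrightarrow> close c Y X Z"
  unfolding proj_dist_def ediam_def close_def by (auto simp: SUP_le_iff)

lemma close_sym: "close c Y X Z \<longleftrightarrow> close c Y Z X"
  by (simp add: close_def Un_commute)

lemma close_refl: "X \<in> I \<Longrightarrow> Y \<in> I \<Longrightarrow> X \<noteq> Y \<Longrightarrow> close \<theta> Y X X"
  using diam[of X Y] by (simp add: proj_dist_le)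

lemma close_mono: "close c Y X Z \<Longrightarrow> c \<le> c' \<Longrightarrow> close c' Y X Z"
  unfolding close_def by (meson of_nat_mono order_trans)

lemma close_D: "close c Y X Z \<Longrightarrow> u \<in> \<pi> Y X \<union> \<pi> Y Z \<Longrightarrow> v \<in> \<pi> Y X \<union> \<pi> Y Z \<Longrightarrow> vd Y u v \<le> real c"
  by (simp add: close_def)

lemma close_triangle:
  assumes I: "X \<in> I" "Y \<in> I" "Z \<in> I" "W \<in> I" "X \<noteq> Y" "Z \<noteq> Y" "W \<noteq> Y"
    and c: "close c Y X Z" and c': "close c' Y Z W"
  shows "close (c + c') Y X W"
proof -
  interpret length_graph "G Y" using length_graph_G[OF I(2)] .
  obtain z where z: "z \<in> \<pi> Y Z" using proj[OF I(3,2,6)] by blast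
  have to_X: "vd Y u z \<le> real c" "vd Y z u \<le> real c" if "u \<in> \<pi> Y X" for u
    using close_D[OF c, of u z] close_D[OF c, of z u] that z by auto
  have to_W: "vd Y u z \<le> real c'" "vd Y z u \<le> real c'" if "u \<in> \<pi> Y W" for u
    using close_D[OF c', of u z] close_D[OF c', of z u] that z by auto
  have tri: "vd Y u v \<le> vd Y u z + vd Y z v" if "u \<in> \<pi> Y X \<union> \<pi> Y W" "v \<in> \<pi> Y X \<union> \<pi> Y W" for u v
  proof (rule triangle)
    show "Vert u \<in> gpoints (G Y)" "Vert v \<in> gpoints (G Y)" "Vert z \<in> gpoints (G Y)"
      using that z proj[OF I(1,2,5)] proj[OF I(4,2,7)] proj[OF I(3,2,6)] by auto
  qed
  have same: "vd Y u v \<le> real c + real c'" if "u \<in> \<pi> Y X \<and> v \<in> \<pi> Y X \<or> u \<in> \<pi> Y W \<and> v \<in> \<pi> Y W" for u v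
    using that close_D[OF c, of u v] close_D[OF c', of u v] by fastforce
  show ?thesis unfolding close_def
  proof (intro ballI)
    fix u v assume uv: "u \<in> \<pi> Y X \<union> \<pi> Y W" "v \<in> \<pi> Y X \<union> \<pi> Y W"
    then consider "u \<in> \<pi> Y X \<and> v \<in> \<pi> Y X \<or> u \<in> \<pi> Y W \<and> v \<in> \<pi> Y W"
      | "u \<in> \<pi> Y X" "v \<in> \<pi> Y W" | "u \<in> \<pi> Y W" "v \<in> \<pi> Y X" by blast
    then show "vd Y u v \<le> real (c + c')"
    proof cases
      case 1 then show ?thesis using same by simp
    next
      case 2 then show ?thesis using tri[OF uv] to_X[of u] to_W[of v] by linarith
    next
      case 3 then show ?thesis using tri[OF uv] to_X[of v] to_W[of u] by linarith
    qed
  qed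
qed

lemma far_distinct:
  assumes "\<not> close \<theta> Y X Z" "X \<in> I" "Y \<in> I" "X \<noteq> Y"
  shows "X \<noteq> Z"
  using assms close_refl by blast

text \<open>(P1') and its mirror image: if W separates X and Z by more than \<theta>, then X sees W
  and Z alike, and Z sees W and X alike, where seeing alike means having the same
  projection.\<close>

lemma P1:
  assumes "\<not> close \<theta> W X Z" "X \<in> I" "W \<in> I" "Z \<in> I" "X \<noteq> W" "Z \<noteq> W"
  shows "\<pi> X W = \<pi> X Z" "\<pi> Z W = \<pi> Z X"
proof -
  have ne: "X \<noteq> Z" using far_distinct assms by blast
  have "proj_dist G \<pi> W X Z > ereal (real \<theta>)" "proj_dist G \<pi> W Z X > ereal (real \<theta>)"
    using assms(1) proj_dist_le close_sym by (auto simp: not_le[symmetric])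
  then show "\<pi> X W = \<pi> X Z" "\<pi> Z W = \<pi> Z X"
    using P1'[of X W Z] P1'[of Z W X] assms ne by auto
qed

lemma close_cong: "\<pi> Y Z = \<pi> Y Z' \<Longrightarrow> close c Y X Z \<longleftrightarrow> close c Y X Z'"
  "\<pi> Y Z = \<pi> Y Z' \<Longrightarrow> close c Y Z X \<longleftrightarrow> close c Y Z' X"
  by (simp_all add: close_def)

text \<open>Usually written \<open>Y\<^sub>K(X, Z)\<close>.\<close>

definition SK :: "'i \<Rightarrow> 'i \<Rightarrow> 'i set" where
  "SK X Z = {W \<in> I - {X, Z}. \<not> close K W X Z}"

section \<open>Separating pieces\<close>

lemma SK_sym: "SK X Z = SK Z X"
  using close_sym by (auto simp: SK_def)

lemma SK_far: "W \<in> SK X Z \<Longrightarrow> \<not> close \<theta> W X Z"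
  using close_mono[of \<theta> W X Z K] K by (auto simp: SK_def)

lemma finite_SK: "X \<in> I \<Longrightarrow> Z \<in> I \<Longrightarrow> finite (SK X Z)"
proof (rule finite_subset[OF _ fin])
  show "SK X Z \<subseteq> {Y \<in> I - {X, Z}. ereal (real \<theta>) < proj_dist G \<pi> Y X Z}"
    using SK_far proj_dist_le by (auto simp: SK_def not_le[symmetric])
qed

lemma adjacent_iff: "proj_adjacent I G \<pi> K X Z \<longleftrightarrow> X \<in> I \<and> Z \<in> I \<and> X \<noteq> Z \<and> SK X Z = {}"
  by (auto simp: proj_adjacent_def SK_def proj_dist_le)

lemma SK_P1:
  assumes "W \<in> SK X Z" "X \<in> I" "Z \<in> I"
  shows "\<pi> X W = \<pi> X Z" "\<pi> Z W = \<pi> Z X" "W \<in> I" "W \<noteq> X" "W \<noteq> Z"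
  using P1[OF SK_far[OF assms(1)]] assms by (auto simp: SK_def)

text \<open>Picture the order X, V, W, Z. Since V separates X from W, the piece W sees V and X
  alike, so W separates V from Z as it separates X from Z. Therefore V sees W and Z alike, and
  separates X from Z as well.\<close>

lemma SK_left:
  assumes X: "X \<in> I" and Z: "Z \<in> I" and W: "W \<in> SK X Z" and V: "V \<in> SK X W"
  shows "\<pi> V W = \<pi> V Z" "V \<in> SK X Z" "\<pi> W V = \<pi> W X"
proof -
  have WI: "W \<in> I" "W \<noteq> X" "W \<noteq> Z" and VI: "V \<in> I" "V \<noteq> X" "V \<noteq> W" using W V by (auto simp: SK_def)
  note VW = SK_P1[OF V X WI(1)]
  have farW: "\<not> close \<theta> W X Z" using SK_far[OF W] .
  show piW: "\<pi> W V = \<pi> W X" using VW(2) .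
  have VZ: "V \<noteq> Z"
  proof
    assume "V = Z"
    then have "close \<theta> W X Z \<longleftrightarrow> close \<theta> W X X" using close_cong(1)[of W Z X] piW by simp
    then show False using farW close_refl X WI by blast
  qed
  have "\<not> close \<theta> W V Z" using farW close_cong(2)[OF piW] by simp
  then show e: "\<pi> V W = \<pi> V Z" using P1(1)[of W V Z] VI WI Z by auto
  have "\<not> close K V X W" using V by (simp add: SK_def)
  then show "V \<in> SK X Z" using close_cong(1)[OF e] VZ VI by (simp add: SK_def)
qed

text \<open>W itself is lost, so the number of separators can serve as a measure for
  inductions.\<close>

lemma SK_psubset:
  assumes "X \<in> I" "Z \<in> I" "W \<in> SK X Z"
  shows "SK X W \<subset> SK X Z"
  using SK_left(2)[OF assms] assms(3) by (auto simp: SK_def)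

text \<open>If X separated Z from Y by more than \<theta>, then Y would see X and Z alike. For the
  same reason a separator W of X and Y sees Z and Y as \<theta>-close; it therefore separates X from
  Z by more than \<theta>, but by at most K because X and Z are adjacent. There is no room for two
  such pieces, so X, W, Y is a path in the projection complex.\<close>

lemma jump_separators:
  assumes adj: "proj_adjacent I G \<pi> K X Z" and Y: "Y \<in> I" "Y \<noteq> X" "Y \<noteq> Z" and ne: "\<pi> Y X \<noteq> \<pi> Y Z"
  shows "close \<theta> X Z Y" "W \<in> SK X Y \<Longrightarrow> SK X W = {} \<and> SK W Y = {} \<and> close (K + \<theta>) W X Y"
proof -
  have X: "X \<in> I" and Z: "Z \<in> I" and XZ: "X \<noteq> Z" and empty: "SK X Z = {}"
    using adj by (auto simp: adjacent_iff)
  show "close \<theta> X Z Y" using P1(2)[of X Z Y] X Y Z XZ ne by metis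
  have sep: "W \<noteq> Z \<and> close \<theta> W Z Y \<and> close K W X Z \<and> close (K + \<theta>) W X Y \<and> \<not> close \<theta> W X Z"
    if W: "W \<in> SK X Y" for W
  proof -
    note P = SK_P1[OF W X Y(1)]
    have WZ: "W \<noteq> Z" using P(2) ne by auto
    have c: "close \<theta> W Z Y"
      using P1(2)[of W Z Y] P Y Z WZ ne by metis
    have c': "close K W X Z" using empty P(3,4) WZ by (auto simp: SK_def)
    have d: "close (K + \<theta>) W X Y"
      by (rule close_triangle[of X W Z Y, OF X P(3) Z Y(1) _ _ _ c' c]) (use P WZ in auto)
    have "\<not> close \<theta> W X Z"
    proof
      assume "close \<theta> W X Z"
      from close_triangle[of X W Z Y, OF X P(3) Z Y(1) _ _ _ this c]
      have "close (\<theta> + \<theta>) W X Y" using P WZ by auto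
      then have "close K W X Y" using close_mono[of "\<theta> + \<theta>" W X Y K] K by simp
      then show False using W by (simp add: SK_def)
    qed
    then show ?thesis using WZ c c' d by blast
  qed
  have left: "SK X W = {}" if W: "W \<in> SK X Y" for W
  proof (rule ccontr)
    assume "SK X W \<noteq> {}"
    then obtain V where V: "V \<in> SK X W" by blast
    note VY = SK_left[OF X Y(1) W V]
    have VI: "V \<in> I" "V \<noteq> X" "V \<noteq> W" and WI: "W \<in> I" "W \<noteq> X" using V W by (auto simp: SK_def)
    \<comment> \<open>W separates V from Z, so V sees W and Z alike and would separate X from Z by
      more than K, against adjacency.\<close>
    have "\<not> close \<theta> W V Z" using sep[OF W] close_cong(2)[OF VY(3)] by simp
    then have "\<pi> V W = \<pi> V Z" using P1(1)[of W V Z] VI WI Z sep[OF W] by auto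
    then have "\<not> close K V X Z" using V close_cong(1)[of V W Z K X] by (simp add: SK_def)
    then show False using sep[OF VY(2)] by simp
  qed
  assume W: "W \<in> SK X Y"
  have WI: "W \<in> I" "W \<noteq> X" "W \<noteq> Y" using W by (auto simp: SK_def)
  have "SK W Y = {}"
  proof (rule ccontr)
    assume "SK W Y \<noteq> {}"
    then obtain V where V: "V \<in> SK Y W" using SK_sym by blast
    have W': "W \<in> SK Y X" using W SK_sym by blast
    note VX = SK_left[OF Y(1) X W' V]
    have VI: "V \<in> I" "V \<noteq> W" "V \<noteq> Y" using V by (auto simp: SK_def)
    have "\<not> close K W X V" using W close_cong(1)[OF VX(3), of K X] by (simp add: SK_def)
    then have "W \<in> SK X V" using WI VI by (simp add: SK_def)
    moreover have "V \<in> SK X Y" using VX(2) SK_sym by blast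
    ultimately show False using left by blast
  qed
  then show "SK X W = {} \<and> SK W Y = {} \<and> close (K + \<theta>) W X Y" using left[OF W] sep[OF W] by blast
qed

section \<open>The quasi-tree of metric spaces\<close>

abbreviation CK where "CK \<equiv> quasi_tree_of_spaces I G \<pi> K"

abbreviation cd :: "_ \<Rightarrow> _ \<Rightarrow> real" where "cd \<equiv> gdist CK"

lemma mverts_CK [simp]: "(X, x) \<in> mverts CK \<longleftrightarrow> X \<in> I \<and> x \<in> mverts (G X)"
  by (auto simp: quasi_tree_of_spaces_def)

lemma Inl_edge:
  assumes "X \<in> I" "e \<in> medges (G X)"
  shows "Inl (X, e) \<in> medges CK" "mtail CK (Inl (X, e)) = (X, mtail (G X) e)"
    "mhead CK (Inl (X, e)) = (X, mhead (G X) e)" "mlen CK (Inl (X, e)) = 1"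
  using assms graphs[OF assms(1)] by (auto simp: quasi_tree_of_spaces_def unit_mgraph_def)

lemma Inr_edge:
  assumes "proj_adjacent I G \<pi> K X Y" "x \<in> \<pi> X Y" "y \<in> \<pi> Y X"
  shows "Inr {(Y, y), (X, x)} \<in> medges CK" "mlen CK (Inr {(Y, y), (X, x)}) = K"
    "{mtail CK (Inr {(Y, y), (X, x)}), mhead CK (Inr {(Y, y), (X, x)})} = {(Y, y), (X, x)}"
proof -
  have "{(Y, y), (X, x)} \<in> {{(Y, y), (X, x)} | X Y x y. proj_adjacent I G \<pi> K X Y \<and> y \<in> \<pi> Y X \<and> x \<in> \<pi> X Y}"
    using assms by blast
  then show "Inr {(Y, y), (X, x)} \<in> medges CK" "mlen CK (Inr {(Y, y), (X, x)}) = K"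
    by (simp_all add: quasi_tree_of_spaces_def)
  have "\<exists>p. {(Y, y), (X, x)} = {fst p, snd p}" by (rule exI[of _ "((Y, y), (X, x))"]) simp
  then have "{(Y, y), (X, x)} = {fst (SOME p. {(Y, y), (X, x)} = {fst p, snd p}), snd (SOME p. {(Y, y), (X, x)} = {fst p, snd p})}"
    by (rule someI_ex)
  then show "{mtail CK (Inr {(Y, y), (X, x)}), mhead CK (Inr {(Y, y), (X, x)})} = {(Y, y), (X, x)}"
    by (simp add: quasi_tree_of_spaces_def)
qed

text \<open>The arbitrary orientation of an added edge is absorbed here: adjacency is symmetric, so
  X and Y can be named after the tail and the head.\<close>

lemma CK_edge_cases:
  assumes "e \<in> medges CK"
  obtains (graph) X e' where "X \<in> I" "e' \<in> medges (G X)" "e = Inl (X, e')"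
    "mtail CK e = (X, mtail (G X) e')" "mhead CK e = (X, mhead (G X) e')" "mlen CK e = 1"
  | (added) X Y x y where "proj_adjacent I G \<pi> K X Y" "x \<in> \<pi> X Y" "y \<in> \<pi> Y X"
    "mtail CK e = (X, x)" "mhead CK e = (Y, y)" "mlen CK e = K"
proof -
  have "e \<in> Inl ` (SIGMA X:I. medges (G X)) \<or>
    e \<in> Inr ` {{(Y, y), (X, x)} | X Y x y. proj_adjacent I G \<pi> K X Y \<and> y \<in> \<pi> Y X \<and> x \<in> \<pi> X Y}"
    using assms by (simp add: quasi_tree_of_spaces_def)
  then consider X e' where "X \<in> I" "e' \<in> medges (G X)" "e = Inl (X, e')"
    | X Y x y where "proj_adjacent I G \<pi> K X Y" "x \<in> \<pi> X Y" "y \<in> \<pi> Y X" "e = Inr {(Y, y), (X, x)}"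
    by blast
  then show thesis
  proof cases
    case 1
    then show thesis using graph Inl_edge by metis
  next
    case (2 X Y x y)
    note edge = Inr_edge[OF 2(1-3)]
    have adj: "proj_adjacent I G \<pi> K Y X" using 2(1) adjacent_iff SK_sym by metis
    have len: "mlen CK e = K" using edge(2) 2(4) by simp
    from edge(3) 2(4) have "mtail CK e = (X, x) \<and> mhead CK e = (Y, y) \<or> mtail CK e = (Y, y) \<and> mhead CK e = (X, x)"
      by (auto simp: doubleton_eq_iff)
    then show thesis using added[OF 2(1-3) _ _ len] added[OF adj 2(3,2) _ _ len] by blast
  qed
qed

lemma proj_in:
  assumes "proj_adjacent I G \<pi> K X Y" "x \<in> \<pi> X Y"
  shows "X \<in> I" "Y \<in> I" "X \<noteq> Y" "x \<in> mverts (G X)"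
  using assms proj[of Y X] by (auto simp: adjacent_iff)

lemma wf_CK: "wf_mgraph CK"
  unfolding wf_mgraph_def
proof
  fix e assume "e \<in> medges CK"
  then show "mtail CK e \<in> mverts CK \<and> mhead CK e \<in> mverts CK \<and> mlen CK e > 0"
  proof (cases rule: CK_edge_cases)
    case (graph X e')
    then show ?thesis using graphs[of X] by (auto simp: wf_mgraph_def)
  next
    case (added X Y x y)
    moreover have "proj_adjacent I G \<pi> K Y X" using added(1) adjacent_iff SK_sym by metis
    ultimately show ?thesis using proj_in[of X Y x] proj_in[of Y X y] K by simp
  qed
qed

text \<open>Induction on the number of separators: two pieces without separators are joined by an
  added edge, and otherwise one passes through a separator, with fewer separators on either
  side.\<close>

lemma connected_CK: "connected_mgraph CK"
proof -
  let ?R = "\<Union>e\<in>medges CK. {(mtail CK e, mhead CK e), (mhead CK e, mtail CK e)}"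
  have inside: "((X, x), (X, y)) \<in> ?R\<^sup>*" if X: "X \<in> I" and x: "x \<in> mverts (G X)" and y: "y \<in> mverts (G X)" for X x y
  proof -
    have "(x, y) \<in> (\<Union>e\<in>medges (G X). {(mtail (G X) e, mhead (G X) e), (mhead (G X) e, mtail (G X) e)})\<^sup>*"
      using graphs[OF X] x y by (simp add: connected_mgraph_def)
    then show ?thesis
    proof (induction rule: rtrancl_induct)
      case (step y z)
      then obtain e where e: "e \<in> medges (G X)" "(y, z) = (mtail (G X) e, mhead (G X) e) \<or> (y, z) = (mhead (G X) e, mtail (G X) e)"
        by blast
      then have "((X, y), (X, z)) \<in> ?R" using Inl_edge[OF X e(1)] by force
      then show ?case by (rule rtrancl_into_rtrancl[OF step.IH])
    qed simp
  qed
  have "((X, x), (Z, z)) \<in> ?R\<^sup>*"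
    if "X \<in> I" "Z \<in> I" "x \<in> mverts (G X)" "z \<in> mverts (G Z)" "card (SK X Z) = n" for X Z x z n
    using that
  proof (induction n arbitrary: X Z x z rule: less_induct)
    case (less n)
    note XZ = less.prems(1-4)
    show ?case
    proof (cases "X = Z")
      case True
      then show ?thesis using inside XZ by simp
    next
      case ne: False
      show ?thesis
      proof (cases "SK X Z = {}")
        case True
        then have adj: "proj_adjacent I G \<pi> K X Z" using adjacent_iff XZ ne by simp
        obtain a c where ac: "a \<in> \<pi> X Z" "c \<in> \<pi> Z X" using proj[of Z X] proj[of X Z] XZ ne by auto
        have "a \<in> mverts (G X)" "c \<in> mverts (G Z)" using proj[of Z X] proj[of X Z] XZ ne ac by auto
        then have "((X, x), (X, a)) \<in> ?R\<^sup>*" "((Z, c), (Z, z)) \<in> ?R\<^sup>*" using inside XZ by auto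
        moreover have "((X, a), (Z, c)) \<in> ?R"
          using Inr_edge[OF adj ac] by (auto simp: doubleton_eq_iff intro!: bexI[of _ "Inr {(Z, c), (X, a)}"])
        ultimately show ?thesis by (meson rtrancl_into_rtrancl rtrancl_trans)
      next
        case False
        then obtain W where W: "W \<in> SK X Z" by blast
        have WI: "W \<in> I" "W \<noteq> X" using W by (auto simp: SK_def)
        obtain w where w: "w \<in> mverts (G W)" using proj[of X W] XZ WI by auto
        have "card (SK X W) < n"
          using psubset_card_mono[OF finite_SK SK_psubset[OF XZ(1,2) W]] XZ less.prems(5) by simp
        moreover have "card (SK W Z) < n"
        proof -
          have "W \<in> SK Z X" using W SK_sym by blast
          from psubset_card_mono[OF finite_SK SK_psubset[OF XZ(2,1) this]] show ?thesis
            using XZ less.prems(5) SK_sym by metis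
        qed
        ultimately have "((X, x), (W, w)) \<in> ?R\<^sup>*" "((W, w), (Z, z)) \<in> ?R\<^sup>*"
          using less.IH XZ WI w by blast+
        then show ?thesis by (rule rtrancl_trans)
      qed
    qed
  qed
  then show ?thesis unfolding connected_mgraph_def by (auto simp: quasi_tree_of_spaces_def)
qed

sublocale CK: length_graph CK
proof
  fix e assume "e \<in> medges CK"
  then show "mlen CK e \<in> \<nat>" by (cases rule: CK_edge_cases) auto
qed (rule wf_CK connected_CK)+

lemma CK_len_le:
  assumes "e \<in> medges CK"
  shows "mlen CK e \<le> K"
  using assms by (cases rule: CK_edge_cases) (use K in auto)

lemma CK_Lipschitz:
  fixes \<phi> :: "'i \<times> 'v \<Rightarrow> real"
  assumes "\<And>X e. X \<in> I \<Longrightarrow> e \<in> medges (G X) \<Longrightarrow> \<bar>\<phi> (X, mtail (G X) e) - \<phi> (X, mhead (G X) e)\<bar> \<le> 1"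
    and "\<And>X Y x y. proj_adjacent I G \<pi> K X Y \<Longrightarrow> x \<in> \<pi> X Y \<Longrightarrow> y \<in> \<pi> Y X \<Longrightarrow> \<bar>\<phi> (X, x) - \<phi> (Y, y)\<bar> \<le> K"
    and "u \<in> mverts CK" "v \<in> mverts CK"
  shows "\<bar>\<phi> u - \<phi> v\<bar> \<le> cd (Vert u) (Vert v)"
proof (rule CK.vertex_Lipschitz[OF _ assms(3,4)])
  fix e assume "e \<in> medges CK"
  then show "\<bar>\<phi> (mtail CK e) - \<phi> (mhead CK e)\<bar> \<le> mlen CK e"
    by (cases rule: CK_edge_cases) (use assms(1,2) in auto)
qed

lemma adjacent_dist:
  assumes adj: "proj_adjacent I G \<pi> K X Y" and x: "x \<in> \<pi> X Y" and y: "y \<in> \<pi> Y X"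
  shows "cd (Vert (X, x)) (Vert (Y, y)) \<le> K"
  using CK.gdist_edge_ends[OF Inr_edge(1)[OF assms]] Inr_edge(2,3)[OF assms] CK.commute
  by (auto simp: doubleton_eq_iff)

section \<open>Vertex projections and isometric copies\<close>

lemma walk_copy:
  assumes X: "X \<in> I"
  shows "walk (G X) u r v \<Longrightarrow> walk CK (X, u) r (X, v)"
proof (induction rule: walk.induct)
  case (walk_refl u)
  then show ?case using X by (intro walk.walk_refl) simp
next
  case (walk_fwd u r e)
  then show ?case
    using walk.walk_fwd[of CK "(X, u)" r "Inl (X, e)"] Inl_edge[OF X walk_fwd.hyps(2)] graphs[OF X]
    by (simp add: unit_mgraph_def)
next
  case (walk_bwd u r e)
  then show ?case
    using walk.walk_bwd[of CK "(X, u)" r "Inl (X, e)"] Inl_edge[OF X walk_bwd.hyps(2)] graphs[OF X]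
    by (simp add: unit_mgraph_def)
qed

text \<open>The choice from \<open>\<pi> Y X\<close> depends on this set only, so that equal projections give the
  same point.\<close>

definition vproj :: "'i \<Rightarrow> 'i \<times> 'v \<Rightarrow> 'v" where
  "vproj Y w = (if fst w = Y then snd w else SOME y. y \<in> \<pi> Y (fst w))"

lemma vproj_self [simp]: "vproj Y (Y, y) = y"
  by (simp add: vproj_def)

lemma vproj_other:
  assumes "X \<in> I" "Y \<in> I" "X \<noteq> Y"
  shows "vproj Y (X, x) \<in> \<pi> Y X"
  using proj[OF assms] assms(3) by (auto simp: vproj_def intro: someI)

lemma vproj_cong: "X \<noteq> Y \<Longrightarrow> Z \<noteq> Y \<Longrightarrow> \<pi> Y X = \<pi> Y Z \<Longrightarrow> vproj Y (X, x) = vproj Y (Z, z)"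
  by (simp add: vproj_def)

lemma vproj_in:
  assumes "w \<in> mverts CK" "Y \<in> I"
  shows "vproj Y w \<in> mverts (G Y)"
proof (cases w)
  case (Pair X x)
  then show ?thesis using assms vproj_other[of X Y x] proj[of X Y] by (cases "X = Y") auto
qed

text \<open>Checked edge by edge. Inside another piece the projection is constant. Across an added
  edge it moves by at most K: by adjacency if Y is neither end, and otherwise because the end in Y
  and the projection of the other end both lie in one set of diameter at most \<theta>.\<close>

lemma vproj_Lipschitz:
  assumes Y: "Y \<in> I" and u: "u \<in> mverts CK" and v: "v \<in> mverts CK"
  shows "vd Y (vproj Y u) (vproj Y v) \<le> cd (Vert u) (Vert v)"
proof -
  interpret Y: length_graph "G Y" using length_graph_G[OF Y] .
  define \<phi> where "\<phi> w = vd Y (vproj Y u) (vproj Y w)" for w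
  have diff: "\<bar>\<phi> w - \<phi> w'\<bar> \<le> vd Y (vproj Y w) (vproj Y w')" if "w \<in> mverts CK" "w' \<in> mverts CK" for w w'
  proof -
    have in': "Vert (vproj Y u) \<in> gpoints (G Y)" "Vert (vproj Y w) \<in> gpoints (G Y)" "Vert (vproj Y w') \<in> gpoints (G Y)"
      using vproj_in Y u that by auto
    show ?thesis
      using Y.triangle[OF in'(1,2,3)] Y.triangle[OF in'(1,3,2)] Y.commute[of "Vert (vproj Y w)" "Vert (vproj Y w')"]
      by (simp add: \<phi>_def)
  qed
  have "\<bar>\<phi> u - \<phi> v\<bar> \<le> cd (Vert u) (Vert v)"
  proof (rule CK_Lipschitz[OF _ _ u v])
    fix X e assume X: "X \<in> I" and e: "e \<in> medges (G X)"
    interpret X: length_graph "G X" using length_graph_G[OF X] .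
    show "\<bar>\<phi> (X, mtail (G X) e) - \<phi> (X, mhead (G X) e)\<bar> \<le> 1"
    proof (cases "X = Y")
      case True
      then show ?thesis
        using diff[of "(X, mtail (G X) e)" "(X, mhead (G X) e)"] X e X.tail_in X.head_in X.gdist_edge_ends[OF e]
          graphs[OF X] by (auto simp: unit_mgraph_def)
    next
      case False
      then show ?thesis by (simp add: \<phi>_def vproj_def)
    qed
  next
    fix X Z x z assume adj: "proj_adjacent I G \<pi> K X Z" and x: "x \<in> \<pi> X Z" and z: "z \<in> \<pi> Z X"
    have adj': "proj_adjacent I G \<pi> K Z X" using adj adjacent_iff SK_sym by metis
    note X = proj_in[OF adj x] and Z = proj_in[OF adj' z]
    have "vd Y (vproj Y (X, x)) (vproj Y (Z, z)) \<le> K"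
    proof -
      consider "Y = X" | "Y = Z" | "Y \<noteq> X" "Y \<noteq> Z" by blast
      then show ?thesis
      proof cases
        case 1
        have "close K X Z Z" using close_mono[OF close_refl[OF Z(1) X(1)]] X K by simp
        from close_D[OF this, of x "vproj X (Z, z)"] show ?thesis using 1 x vproj_other[of Z X z] X by simp
      next
        case 2
        have "close K Z X X" using close_mono[OF close_refl[OF X(1) Z(1)]] X K by simp
        from close_D[OF this, of "vproj Z (X, x)" z] show ?thesis using 2 z vproj_other[of X Z x] X by simp
      next
        case 3
        have "close K Y X Z" using adj 3 Y by (auto simp: adjacent_iff SK_def)
        from close_D[OF this] show ?thesis using vproj_other[of X Y x] vproj_other[of Z Y z] X Y 3 by simp
      qed
    qed
    then show "\<bar>\<phi> (X, x) - \<phi> (Z, z)\<bar> \<le> K" using diff[of "(X, x)" "(Z, z)"] X Z by simp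
  qed
  moreover have "\<phi> u = 0" using vproj_in[OF u Y] by (simp add: \<phi>_def)
  ultimately show ?thesis by (simp add: \<phi>_def)
qed

text \<open>The 1-Lipschitz retraction \<open>vproj X\<close> rules out shortcuts outside the
  copy.\<close>

lemma vertex_isometry:
  assumes X: "X \<in> I" and u: "u \<in> mverts (G X)" and v: "v \<in> mverts (G X)"
  shows "cd (Vert (X, u)) (Vert (X, v)) = vd X u v"
proof (rule antisym)
  interpret X: length_graph "G X" using length_graph_G[OF X] .
  show "cd (Vert (X, u)) (Vert (X, v)) \<le> vd X u v"
    using CK.gdist_walk_le[OF walk_copy[OF X X.gdist_walk[OF u v]]] .
  show "vd X u v \<le> cd (Vert (X, u)) (Vert (X, v))"
    using vproj_Lipschitz[OF X, of "(X, u)" "(X, v)"] assms by simp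
qed

abbreviation emb :: "'i \<Rightarrow> ('v, 'e) gpoint \<Rightarrow> ('i \<times> 'v, 'i \<times> 'e + ('i \<times> 'v) set) gpoint" where
  "emb X \<equiv> map_gpoint (Pair X) (\<lambda>e. Inl (X, e))"

lemma emb_in: "X \<in> I \<Longrightarrow> p \<in> gpoints (G X) \<Longrightarrow> emb X p \<in> gpoints CK"
  using Inl_edge graphs[of X] by (auto simp: gpoints_def unit_mgraph_def)

lemma gends_emb:
  assumes "X \<in> I" "p \<in> gpoints (G X)"
  shows "gends CK (emb X p) = (\<lambda>(a, \<alpha>). ((X, a), \<alpha>)) ` gends (G X) p"
  using assms Inl_edge[OF assms(1)] graphs[OF assms(1)] by (auto simp: gpoints_def unit_mgraph_def)

text \<open>A point and its image have the same exits, and two inner points share an edge before the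
  embedding exactly if they do afterwards. This reduces the comparison of shortcuts to
  \<open>vertex_isometry\<close>.\<close>

lemma emb_isometry:
  assumes X: "X \<in> I" and p: "p \<in> gpoints (G X)" and q: "q \<in> gpoints (G X)"
  shows "cd (emb X p) (emb X q) = gdist (G X) p q"
proof (rule antisym)
  interpret X: length_graph "G X" using length_graph_G[OF X] .
  note in' = emb_in[OF X p] emb_in[OF X q]
  have path_le: "cd (emb X p) (emb X q) \<le> c" if "shortcut CK (emb X p) (emb X q) c" for c
    using CK.gdist_attained(2)[OF in' CK.pl_path_shortcut[OF that in']] .
  have path_le': "gdist (G X) p q \<le> c" if "shortcut (G X) p q c" for c
    using X.gdist_attained(2)[OF p q X.pl_path_shortcut[OF that p q]] .
  have "shortcut CK (emb X p) (emb X q) (gdist (G X) p q)"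
    using X.gdist_attained(1)[OF p q] unfolding shortcut_def
  proof (elim disjE exE conjE)
    fix a \<alpha> b \<beta> n
    assume *: "(a, \<alpha>) \<in> gends (G X) p" "(b, \<beta>) \<in> gends (G X) q" "walk (G X) a n b"
      "gdist (G X) p q = \<alpha> + n + \<beta>"
    have "((X, a), \<alpha>) \<in> gends CK (emb X p)" "((X, b), \<beta>) \<in> gends CK (emb X q)"
      using *(1,2) gends_emb[OF X] p q by force+
    then show "(\<exists>a \<alpha> b \<beta> n. (a, \<alpha>) \<in> gends CK (emb X p) \<and> (b, \<beta>) \<in> gends CK (emb X q) \<and> walk CK a n b \<and>
        gdist (G X) p q = \<alpha> + n + \<beta>) \<or>
      (\<exists>e s t. emb X p = Inner e s \<and> emb X q = Inner e t \<and> gdist (G X) p q = \<bar>s - t\<bar>)"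
      using walk_copy[OF X *(3)] *(4) by blast
  qed auto
  then show "cd (emb X p) (emb X q) \<le> gdist (G X) p q" by (rule path_le)
  show "gdist (G X) p q \<le> cd (emb X p) (emb X q)"
    using CK.gdist_attained(1)[OF in'] unfolding shortcut_def
  proof (elim disjE exE conjE)
    fix a \<alpha> b \<beta> n
    assume *: "(a, \<alpha>) \<in> gends CK (emb X p)" "(b, \<beta>) \<in> gends CK (emb X q)" "walk CK a n b"
      "cd (emb X p) (emb X q) = \<alpha> + n + \<beta>"
    obtain a' b' where ab: "a = (X, a')" "(a', \<alpha>) \<in> gends (G X) p" "b = (X, b')" "(b', \<beta>) \<in> gends (G X) q"
      using *(1,2) gends_emb[OF X] p q by auto
    have v: "a' \<in> mverts (G X)" "b' \<in> mverts (G X)" using X.gends_in(1) p q ab by auto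
    have "vd X a' b' \<le> n"
      using CK.gdist_walk_le[OF *(3)] vertex_isometry[OF X v] ab by simp
    moreover have "shortcut (G X) p q (\<alpha> + vd X a' b' + \<beta>)"
      unfolding shortcut_def using X.gdist_walk[OF v] ab by blast
    ultimately show ?thesis using path_le' *(4) by fastforce
  next
    fix e s t
    assume *: "emb X p = Inner e s" "emb X q = Inner e t" "cd (emb X p) (emb X q) = \<bar>s - t\<bar>"
    obtain e' where "p = Inner e' s" "q = Inner e' t"
      using *(1,2) by (cases p; cases q) auto
    then have "shortcut (G X) p q \<bar>s - t\<bar>" unfolding shortcut_def by blast
    then show ?thesis using path_le' *(3) by simp
  qed
qed

end

section \<open>Jumps of the projection along added edges\<close>

context projection_complex
begin

text \<open>By \<open>jump_separators\<close> at most one piece W lies between X and Y. The route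
  costs \<theta> inside X, K to W, \<open>K + \<theta>\<close> inside W and K to Y, which is at most
  \<open>4 * K\<close>. It ends exactly at y because Y sees W and X alike.\<close>

lemma jump_near_projection:
  assumes adj: "proj_adjacent I G \<pi> K X Z" and Y: "Y \<in> I" "Y \<noteq> X" "Y \<noteq> Z" and ne: "\<pi> Y X \<noteq> \<pi> Y Z"
    and x: "x \<in> \<pi> X Z" and y: "y \<in> \<pi> Y X"
  shows "cd (Vert (X, x)) (Vert (Y, y)) \<le> 4 * K"
proof -
  have X: "X \<in> I" and Z: "Z \<in> I" and XZ: "X \<noteq> Z" using adj by (auto simp: adjacent_iff)
  note js = jump_separators[OF adj Y ne]
  have vin: "v \<in> mverts (G V)" if "v \<in> \<pi> V U" "U \<in> I" "V \<in> I" "U \<noteq> V" for v V U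
    using proj[OF that(2-4)] that(1) by auto
  have xin: "x \<in> mverts (G X)" using vin[OF x] Z X XZ by simp
  have yin: "y \<in> mverts (G Y)" using vin[OF y] X Y by simp
  obtain x' where x': "x' \<in> \<pi> X Y" using proj[of Y X] X Y by auto
  have x'in: "x' \<in> mverts (G X)" using vin[OF x'] X Y by simp
  have 1: "cd (Vert (X, x)) (Vert (X, x')) \<le> \<theta>"
    using close_D[OF js(1), of x x'] x x' vertex_isometry[OF X xin x'in] by simp
  show ?thesis
  proof (cases "SK X Y = {}")
    case True
    then have "proj_adjacent I G \<pi> K X Y" using X Y by (simp add: adjacent_iff)
    from adjacent_dist[OF this x' y] show ?thesis
      using CK.triangle[of "Vert (X, x)" "Vert (X, x')" "Vert (Y, y)"] 1 X Y xin x'in yin K by simp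
  next
    case False
    then obtain W where W: "W \<in> SK X Y" by blast
    note P = SK_P1[OF W X Y(1)]
    have aXW: "proj_adjacent I G \<pi> K X W" and aWY: "proj_adjacent I G \<pi> K W Y"
      using js(2)[OF W] P X Y by (auto simp: adjacent_iff)
    obtain w w' where w: "w \<in> \<pi> W X" "w' \<in> \<pi> W Y" using proj[of X W] proj[of Y W] P X Y by auto
    have win: "w \<in> mverts (G W)" "w' \<in> mverts (G W)" using vin[OF w(1)] vin[OF w(2)] P X Y by auto
    have 2: "cd (Vert (X, x')) (Vert (W, w)) \<le> K" using adjacent_dist[OF aXW _ w(1), of x'] x' P(1) by simp
    have 3: "cd (Vert (W, w)) (Vert (W, w')) \<le> K + \<theta>"
      using close_D[of "K + \<theta>" W X Y w w'] js(2)[OF W] w vertex_isometry[OF P(3) win] by simp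
    have 4: "cd (Vert (W, w')) (Vert (Y, y)) \<le> K" using adjacent_dist[OF aWY w(2), of y] y P(2) by simp
    have "cd (Vert (X, x)) (Vert (Y, y)) \<le> cd (Vert (X, x)) (Vert (X, x')) + cd (Vert (X, x')) (Vert (W, w))
        + cd (Vert (W, w)) (Vert (W, w')) + cd (Vert (W, w')) (Vert (Y, y))"
      using CK.triangle[of "Vert (X, x)" "Vert (X, x')" "Vert (Y, y)"]
        CK.triangle[of "Vert (X, x')" "Vert (W, w)" "Vert (Y, y)"]
        CK.triangle[of "Vert (W, w)" "Vert (W, w')" "Vert (Y, y)"] X Y P(3) xin x'in yin win by simp
    then show ?thesis using 1 2 3 4 K by simp
  qed
qed

text \<open>The truncated distance to the projection, set to zero where the projection is different,
  is 1-Lipschitz.\<close>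

lemma vertex_jump:
  assumes Y: "Y \<in> I" and u: "u \<in> mverts CK" and v: "v \<in> mverts CK" and ne: "vproj Y u \<noteq> vproj Y v"
  shows "cd (Vert u) (Vert (Y, vproj Y u)) \<le> cd (Vert u) (Vert v) + 4 * K"
proof -
  define p where "p = vproj Y u"
  have p: "p \<in> mverts (G Y)" using vproj_in[OF u Y] by (simp add: p_def)
  define \<phi> where "\<phi> w = (if vproj Y w = p then max 0 (cd (Vert w) (Vert (Y, p)) - 4 * K) else 0)" for w
  have same: "\<bar>\<phi> w - \<phi> w'\<bar> \<le> cd (Vert w) (Vert w')"
    if "w \<in> mverts CK" "w' \<in> mverts CK" "vproj Y w = vproj Y w'" for w w'
    using CK.triangle[of "Vert w" "Vert w'" "Vert (Y, p)"] CK.triangle[of "Vert w'" "Vert w" "Vert (Y, p)"]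
      CK.commute[of "Vert w" "Vert w'"] that p Y by (auto simp: \<phi>_def max_def)
  have zero: "\<phi> (Y, a) = 0" if "a \<in> mverts (G Y)" for a
    using that Y p by (simp add: \<phi>_def)
  \<comment> \<open>The truncation at \<open>4 * K\<close> makes \<phi> vanish at both ends of an
    added edge that changes the projection.\<close>
  have jump0: "\<phi> (X, x) = 0"
    if adj: "proj_adjacent I G \<pi> K X Z" and x: "x \<in> \<pi> X Z" and Yn: "Y \<noteq> X" "Y \<noteq> Z"
      and ne: "vproj Y (X, x) \<noteq> vproj Y (Z, z)" for X Z x z
  proof (cases "vproj Y (X, x) = p")
    case True
    have "\<pi> Y X \<noteq> \<pi> Y Z" using ne vproj_cong[of X Y Z x z] Yn by auto
    moreover have "p \<in> \<pi> Y X" using True vproj_other[of X Y x] proj_in[OF adj x] Y Yn by auto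
    ultimately have "cd (Vert (X, x)) (Vert (Y, p)) \<le> 4 * K"
      using jump_near_projection[OF adj Y Yn _ x] by blast
    then show ?thesis by (simp add: \<phi>_def)
  qed (simp add: \<phi>_def)
  have enter0: "\<phi> (X, x) = 0" if adj: "proj_adjacent I G \<pi> K X Y" and x: "x \<in> \<pi> X Y" for X x
  proof (cases "vproj Y (X, x) = p")
    case True
    then have "p \<in> \<pi> Y X" using vproj_other[of X Y x] proj_in[OF adj x] by auto
    from adjacent_dist[OF adj x this] show ?thesis by (simp add: \<phi>_def)
  qed (simp add: \<phi>_def)
  have "\<bar>\<phi> u - \<phi> v\<bar> \<le> cd (Vert u) (Vert v)"
  proof (rule CK_Lipschitz[OF _ _ u v])
    fix X e assume X: "X \<in> I" and e: "e \<in> medges (G X)"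
    interpret X: length_graph "G X" using length_graph_G[OF X] .
    have ends: "mtail (G X) e \<in> mverts (G X)" "mhead (G X) e \<in> mverts (G X)" using X.tail_in X.head_in e by auto
    show "\<bar>\<phi> (X, mtail (G X) e) - \<phi> (X, mhead (G X) e)\<bar> \<le> 1"
    proof (cases "X = Y")
      case True
      then show ?thesis using zero ends by simp
    next
      case False
      have "\<bar>\<phi> (X, mtail (G X) e) - \<phi> (X, mhead (G X) e)\<bar> \<le> cd (Vert (X, mtail (G X) e)) (Vert (X, mhead (G X) e))"
        by (rule same) (use ends X False in \<open>auto simp: vproj_def\<close>)
      also have "\<dots> \<le> 1"
        using vertex_isometry[OF X ends] X.gdist_edge_ends[OF e] graphs[OF X] e by (simp add: unit_mgraph_def)
      finally show ?thesis .
    qed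
  next
    fix X Z x z assume adj: "proj_adjacent I G \<pi> K X Z" and x: "x \<in> \<pi> X Z" and z: "z \<in> \<pi> Z X"
    have adj': "proj_adjacent I G \<pi> K Z X" using adj adjacent_iff SK_sym by metis
    note X = proj_in[OF adj x] and Z = proj_in[OF adj' z]
    show "\<bar>\<phi> (X, x) - \<phi> (Z, z)\<bar> \<le> K"
    proof (cases "vproj Y (X, x) = vproj Y (Z, z)")
      case True
      then show ?thesis using same[of "(X, x)" "(Z, z)"] X Z adjacent_dist[OF adj x z] by simp
    next
      case False
      consider "X = Y" | "Z = Y" | "Y \<noteq> X" "Y \<noteq> Z" by blast
      then have "\<phi> (X, x) = 0 \<and> \<phi> (Z, z) = 0"
      proof cases
        case 1
        then show ?thesis using zero X enter0[of Z z] adj' z by simp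
      next
        case 2
        then show ?thesis using zero Z enter0[of X x] adj x by simp
      next
        case 3
        then show ?thesis using jump0[OF adj x 3 False] jump0[OF adj' z 3(2,1) False[symmetric]] by simp
      qed
      then show ?thesis by simp
    qed
  qed
  moreover have "\<phi> v = 0" using ne by (simp add: \<phi>_def p_def)
  ultimately show ?thesis by (simp add: \<phi>_def p_def)
qed

section \<open>Projections of arbitrary points\<close>

definition base :: "('i \<times> 'v, 'i \<times> 'e + ('i \<times> 'v) set) gpoint \<Rightarrow> 'i \<times> 'v" where
  "base p = (case p of Vert v \<Rightarrow> v | Inner e t \<Rightarrow> mtail CK e)"

lemma base_in: "p \<in> gpoints CK \<Longrightarrow> base p \<in> mverts CK"
  by (auto simp: base_def elim!: CK.gpoint_cases intro: CK.tail_in)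

lemma base_dist:
  assumes "p \<in> gpoints CK"
  shows "cd p (Vert (base p)) \<le> K"
  using assms
proof (cases rule: CK.gpoint_cases)
  case (1 v)
  then show ?thesis using assms by (simp add: base_def)
next
  case (2 e t)
  have "cd p (Vert (mtail CK e)) \<le> t" using CK.gdist_gends[OF assms, of "mtail CK e" t] 2 by simp
  then show ?thesis using CK_len_le[OF 2(1)] 2 by (simp add: base_def)
qed

text \<open>Moving to the tail keeps a point of a copy in its piece; for a point of an added edge
  the choice of the end is arbitrary.\<close>

lemma base_emb: "X \<in> I \<Longrightarrow> p \<in> gpoints (G X) \<Longrightarrow> fst (base (emb X p)) = X"
  using Inl_edge(2)[of X] by (auto simp: gpoints_def base_def)

lemma base_copy: "X \<in> I \<Longrightarrow> p \<in> space_copy G X \<Longrightarrow> fst (base p) = X"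
  using base_emb by (auto simp: space_copy_def)

lemma Vert_copy: "x \<in> mverts (G X) \<Longrightarrow> Vert (X, x) \<in> space_copy G X"
  unfolding space_copy_def gpoints_def by (rule image_eqI[of _ _ "Vert x"]) auto

text \<open>The case distinction makes the projection the identity on the copy, whereas passing
  through \<open>base\<close> would move the inner points of its edges.\<close>

definition gproj :: "'i \<Rightarrow> ('i \<times> 'v, 'i \<times> 'e + ('i \<times> 'v) set) gpoint \<Rightarrow>
    ('i \<times> 'v, 'i \<times> 'e + ('i \<times> 'v) set) gpoint" where
  "gproj X p = (if p \<in> space_copy G X then p else Vert (X, vproj X (base p)))"

lemma gproj_other: "X \<in> I \<Longrightarrow> p \<in> gpoints CK \<Longrightarrow> fst (base p) \<noteq> X \<Longrightarrow> gproj X p = Vert (X, vproj X (base p))"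
  using base_copy by (auto simp: gproj_def)

lemma gproj_own:
  assumes "X \<in> I" "p \<in> gpoints CK" "fst (base p) = X"
  shows "cd p (gproj X p) \<le> K"
proof -
  have "vproj X (base p) = snd (base p)" using assms by (simp add: vproj_def)
  then have "gproj X p = p \<or> gproj X p = Vert (base p)" using assms by (auto simp: gproj_def)
  then show ?thesis using base_dist[OF assms(2)] assms(2) by auto
qed

lemma copy_sub: "X \<in> I \<Longrightarrow> space_copy G X \<subseteq> gpoints CK"
  using emb_in by (auto simp: space_copy_def)

lemma copy_geodesic:
  assumes X: "X \<in> I"
  shows "geodesic_space (space_copy G X) cd"
  unfolding geodesic_space_def
proof (intro conjI ballI)
  interpret X: length_graph "G X" using length_graph_G[OF X] .
  show "Metric_space (space_copy G X) cd" by (rule CK.subspace[OF copy_sub[OF X]])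
  fix x y assume "x \<in> space_copy G X" "y \<in> space_copy G X"
  then obtain p q where pq: "p \<in> gpoints (G X)" "q \<in> gpoints (G X)" "x = emb X p" "y = emb X q"
    by (auto simp: space_copy_def)
  obtain g where "geodesic_segment (gpoints (G X)) (gdist (G X)) g p q"
    using X.geodesic pq by (meson geodesic_space_def)
  from geodesic_segment_isometry[OF this, of "emb X" "space_copy G X" cd]
  show "\<exists>g. geodesic_segment (space_copy G X) cd g x y"
    using emb_isometry[OF X] pq by (auto simp: space_copy_def)
qed

lemma gproj_in:
  assumes "X \<in> I" "p \<in> gpoints CK"
  shows "gproj X p \<in> space_copy G X"
  using Vert_copy[OF vproj_in[OF base_in[OF assms(2)] assms(1)]] by (simp add: gproj_def)

text \<open>Passing to base vertices costs K twice at x and once at z, so the \<open>4 * K\<close>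
  of \<open>vertex_jump\<close> becomes \<open>7 * K\<close>. If the base vertices have equal
  projections and x is outside the copy, then z is inside it, and x projects to the base vertex of
  z.\<close>

lemma gproj_jump:
  assumes X: "X \<in> I" and x: "x \<in> gpoints CK" and z: "z \<in> gpoints CK" and ne: "gproj X x \<noteq> gproj X z"
  shows "cd x (gproj X x) \<le> cd x z + 7 * K"
proof (cases "x \<in> space_copy G X")
  case True
  then show ?thesis using x by (simp add: gproj_def)
next
  case False
  let ?u = "base x" and ?v = "base z"
  have gx: "gproj X x = Vert (X, vproj X ?u)" using False by (simp add: gproj_def)
  have V: "Vert ?u \<in> gpoints CK" "Vert ?v \<in> gpoints CK" "Vert (X, vproj X ?u) \<in> gpoints CK"
    using base_in x z vproj_in[OF base_in[OF x] X] X by auto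
  have 1: "cd x (Vert (X, vproj X ?u)) \<le> cd x z + 7 * K" if "vproj X ?u \<noteq> vproj X ?v"
    using vertex_jump[OF X base_in[OF x] base_in[OF z] that] CK.triangle[OF x V(1) V(3)]
      CK.triangle[OF V(1) x V(2)] CK.triangle[OF x z V(2)] base_dist[OF x] base_dist[OF z]
      CK.commute[of x "Vert ?u"] by linarith
  show ?thesis
  proof (cases "vproj X ?u = vproj X ?v")
    case True
    have zP: "z \<in> space_copy G X"
    proof (rule ccontr)
      assume "z \<notin> space_copy G X"
      then have "gproj X z = Vert (X, vproj X ?v)" by (simp add: gproj_def)
      then show False using ne gx True by simp
    qed
    then have "vproj X ?v = snd ?v" "?v = (X, snd ?v)" using base_copy[OF X] by (auto simp: vproj_def prod_eq_iff)
    then have "gproj X x = Vert ?v" using gx True by simp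
    then show ?thesis using CK.triangle[OF x z V(2)] base_dist[OF z] K by simp
  qed (use 1 gx in simp)
qed

lemma gproj_const:
  assumes "X \<in> I" "Y \<in> I" "X \<noteq> Y" "p \<in> space_copy G Y" "q \<in> space_copy G Y"
  shows "gproj X p = gproj X q"
proof -
  have b: "fst (base p) = Y" "fst (base q) = Y" using base_copy assms by auto
  have "p \<in> gpoints CK" "q \<in> gpoints CK" using assms copy_sub by auto
  then show ?thesis using gproj_other b assms by (auto simp: vproj_def)
qed

text \<open>A preliminary instance with constant \<open>7 * K\<close>. Its
  \<open>visits_projections\<close> is used to prove \<open>guide_point\<close>, which then yields
  the instance of \<open>guided\<close> with a larger constant.\<close>

sublocale proj: projections "gpoints CK" cd I "space_copy G" gproj "7 * real K"
proof
  show "geodesic_space (gpoints CK) cd" by (rule CK.geodesic)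
  show "gproj X m = m" if "m \<in> space_copy G X" for X m using that by (simp add: gproj_def)
  show "1 \<le> 7 * real K" using K by simp
qed (use copy_sub copy_geodesic gproj_in gproj_jump in auto)

text \<open>Equal projections would be a common point of two sets of diameter at most \<theta>,
  whose union then has diameter at most \<open>2 * \<theta>\<close>, hence at most K.\<close>

lemma gproj_separator:
  assumes X: "X \<in> I" and Z: "Z \<in> I" and V: "V \<in> SK X Z"
    and x: "x \<in> gpoints CK" "fst (base x) = X" and z: "z \<in> gpoints CK" "fst (base z) = Z"
  shows "gproj V x \<noteq> gproj V z"
proof
  have VI: "V \<in> I" "V \<noteq> X" "V \<noteq> Z" using V by (auto simp: SK_def)
  interpret V: length_graph "G V" using length_graph_G[OF VI(1)] .
  obtain a c where ac: "base x = (X, a)" "base z = (Z, c)" using x z by (metis prod.collapse)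
  assume "gproj V x = gproj V z"
  then have eq: "vproj V (X, a) = vproj V (Z, c)" using gproj_other VI x z ac by simp
  let ?p = "vproj V (X, a)"
  have p: "?p \<in> \<pi> V X" "?p \<in> \<pi> V Z" using vproj_other[of X V a] vproj_other[of Z V c] VI X Z eq by auto
  have near: "vd V u ?p \<le> \<theta>" if "u \<in> \<pi> V X \<union> \<pi> V Z" for u
    using that close_D[OF close_refl[OF X VI(1)], of u ?p] close_D[OF close_refl[OF Z VI(1)], of u ?p] VI p by auto
  have vin: "Vert u \<in> gpoints (G V)" if "u \<in> \<pi> V X \<union> \<pi> V Z" for u
    using that proj[OF X VI(1)] proj[OF Z VI(1)] VI by auto
  have "close K V X Z" unfolding close_def
  proof (intro ballI)
    fix u v assume uv: "u \<in> \<pi> V X \<union> \<pi> V Z" "v \<in> \<pi> V X \<union> \<pi> V Z"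
    have "vd V u v \<le> vd V u ?p + vd V ?p v"
      using V.triangle[OF vin[OF uv(1)] vin vin[OF uv(2)]] p by blast
    then show "vd V u v \<le> real K"
      using near[OF uv(1)] near[OF uv(2)] V.commute[of "Vert ?p" "Vert v"] K by simp
  qed
  then show False using V by (simp add: SK_def)
qed

text \<open>A geodesic from \<open>X\<close> to \<open>Z\<close> visits, for each piece \<open>V\<close> that is \<open>X\<close>, \<open>Z\<close> or separates them,
  the projections of its ends to \<open>V\<close>. If the visits to no \<open>V\<close> surround the time \<open>t\<close>, consider
  a closest pair of pieces visited before and after \<open>t\<close>: these are adjacent.\<close>

lemma guide_point:
  assumes x: "x \<in> gpoints CK" and z: "z \<in> gpoints CK" and g: "geodesic_segment (gpoints CK) cd g x z"
    and t: "t \<in> {0..cd x z}" and D: "D = 16 * real K + 2"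
  shows "cd x (g t) \<le> D \<or> cd (g t) z \<le> D \<or>
      (\<exists>V\<in>I. gproj V x \<noteq> gproj V z \<and> (\<exists>a\<in>{0..cd x z}. \<exists>b\<in>{0..cd x z}.
         cd (g a) (gproj V x) \<le> D \<and> cd (g b) (gproj V z) \<le> D \<and> a - D \<le> t \<and> t \<le> b + D))"
proof (rule ccontr)
  assume contr: "\<not> ?thesis"
  define X where "X = fst (base x)"
  define Z where "Z = fst (base z)"
  let ?L = "cd x z"
  \<comment> \<open>H is the bound of \<open>visits_projections\<close> for \<open>7 * K\<close>,
    and E adds the distance K of x and z from their own pieces. D is twice E, so that a visit within
    E of x ends more than E before t.\<close>
  define H where "H = 7 * real K + 1"
  define E where "E = H + real K"
  have HD: "H \<le> D" "D = 2 * E" "H \<le> E" "E = H + real K" "E > 0" using D by (auto simp: H_def E_def)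
  have X: "X \<in> I" and Z: "Z \<in> I" using base_in[OF x] base_in[OF z] by (auto simp: X_def Z_def) (metis mverts_CK prod.collapse)+
  have L: "?L \<ge> 0" by simp
  have gx: "cd x (g u) = u" and gz: "cd (g u) z = ?L - u" if "u \<in> {0..?L}" for u
    using geodesic_segmentD(4)[OF g, of 0 u] geodesic_segmentD(4)[OF g, of u ?L]
      geodesic_segmentD(1,2)[OF g] that by auto
  have gM: "g u \<in> gpoints CK" if "u \<in> {0..?L}" for u using geodesic_segmentD(3)[OF g that] .
  have pM: "gproj V x \<in> gpoints CK" "gproj V z \<in> gpoints CK" if "V \<in> I" for V
    using gproj_in[OF that] copy_sub[OF that] x z by auto
  have t_far: "D < t" "t < ?L - D" using contr gx[OF t] gz[OF t] by auto
  have xX: "cd x (gproj X x) \<le> K" using gproj_own[OF X x] by (simp add: X_def)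
  have zZ: "cd z (gproj Z z) \<le> K" using gproj_own[OF Z z] by (simp add: Z_def)
  define relevant where "relevant = insert X (insert Z (SK X Z))"
  have rel_I: "V \<in> I" if "V \<in> relevant" for V using that X Z by (auto simp: relevant_def SK_def)
  have "\<exists>a b. 0 \<le> a \<and> a \<le> b \<and> b \<le> ?L \<and> cd (g a) (gproj V x) \<le> H \<and> cd (g b) (gproj V z) \<le> H"
    if V: "V \<in> relevant" for V
  proof (cases "gproj V x = gproj V z")
    case False
    from proj.visits_projections[OF g x z rel_I[OF V] False] show ?thesis
      unfolding H_def by metis
  next
    case True
    \<comment> \<open>A separator distinguishes x from z, so only X and Z remain; then x or z itself
      serves for both visits.\<close>
    then have "V = X \<or> V = Z"
      using V gproj_separator[OF X Z _ x X_def[symmetric] z Z_def[symmetric]] by (auto simp: relevant_def)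
    then show ?thesis
    proof
      assume "V = X"
      then show ?thesis using True xX geodesic_segmentD(1)[OF g] by (intro exI[of _ 0]) (auto simp: H_def)
    next
      assume "V = Z"
      then show ?thesis using True zZ geodesic_segmentD(2)[OF g] by (intro exI[of _ ?L]) (auto simp: H_def)
    qed
  qed
  then obtain a b where ab: "\<And>V. V \<in> relevant \<Longrightarrow> 0 \<le> a V \<and> a V \<le> b V \<and> b V \<le> ?L \<and>
      cd (g (a V)) (gproj V x) \<le> H \<and> cd (g (b V)) (gproj V z) \<le> H"
    by metis
  have abI: "a V \<in> {0..?L}" "b V \<in> {0..?L}" if "V \<in> relevant" for V using ab[OF that] by auto
  have rX: "X \<in> relevant" and rZ: "Z \<in> relevant" by (auto simp: relevant_def)
  have aX: "a X \<le> E"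
    using CK.triangle[OF x pM(1)[OF X] gM[OF abI(1)[OF rX]]] ab[OF rX] xX gx[OF abI(1)[OF rX]]
      CK.commute[of "gproj X x" "g (a X)"] HD by linarith
  have bZ: "b Z \<ge> ?L - E"
    using CK.triangle[OF gM[OF abI(2)[OF rZ]] pM(2)[OF Z] z] ab[OF rZ] zZ gz[OF abI(2)[OF rZ]]
      CK.commute[of "gproj Z z" z] HD by linarith
  \<comment> \<open>A visit before t and a visit after t are more than
    \<open>2 * E = 2 * H + 2 * K\<close> apart. For adjacent pieces the two projections concerned
    are joined by an added edge, so that the gap is at most \<open>2 * H + K\<close>.\<close>
  define before where "before V \<longleftrightarrow> b V + E < t" for V
  define after where "after V \<longleftrightarrow> t < a V - E" for V
  have split: "before V \<or> after V" if V: "V \<in> relevant" for V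
  proof (cases "gproj V x = gproj V z")
    case False
    have "\<not> (a V - D \<le> t \<and> t \<le> b V + D)"
    proof
      assume "a V - D \<le> t \<and> t \<le> b V + D"
      then have "\<exists>a\<in>{0..?L}. \<exists>b\<in>{0..?L}. cd (g a) (gproj V x) \<le> D \<and> cd (g b) (gproj V z) \<le> D \<and> a - D \<le> t \<and> t \<le> b + D"
        using ab[OF V] abI[OF V] HD(1) by (intro bexI[of _ "a V"] bexI[of _ "b V"]) linarith+
      then show False using contr False rel_I[OF V] by blast
    qed
    then show ?thesis using HD by (auto simp: before_def after_def)
  next
    case True
    then have "V = X \<or> V = Z"
      using V gproj_separator[OF X Z _ x X_def[symmetric] z Z_def[symmetric]] by (auto simp: relevant_def)
    then show ?thesis
    proof
      assume VX: "V = X"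
      have "b X \<le> E"
        using CK.triangle[OF x pM(1)[OF X] gM[OF abI(2)[OF rX]]] ab[OF rX] xX gx[OF abI(2)[OF rX]]
          CK.commute[of "gproj X x" "g (b X)"] HD True VX by simp
      then show ?thesis using t_far HD VX by (simp add: before_def)
    next
      assume VZ: "V = Z"
      have "a Z \<ge> ?L - E"
        using CK.triangle[OF gM[OF abI(1)[OF rZ]] pM(2)[OF Z] z] ab[OF rZ] zZ gz[OF abI(1)[OF rZ]]
          CK.commute[of "gproj Z z" z] HD True VZ by simp
      then show ?thesis using t_far HD VZ by (simp add: after_def)
    qed
  qed
  have excl: "\<not> (before V \<and> after V)" if "V \<in> relevant" for V
    using ab[OF that] HD by (auto simp: before_def after_def)
  have bX: "before X" using split[OF rX] aX t_far HD by (auto simp: after_def)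
  have aZ: "after Z" using split[OF rZ] bZ t_far HD by (auto simp: before_def)
  \<comment> \<open>The two equations say that A and B lie in this order between X and Z: A sees B
    as it sees Z, and B sees A as it sees X. If A and B are adjacent, the projections of z to A and
    of x to B are therefore the ends of an added edge. Otherwise a separator of A and B replaces one
    of them, depending on whether it is visited before or after t.\<close>
  have False if "A \<in> relevant" "B \<in> relevant" "before A" "after B" "SK A B \<subseteq> SK X Z"
    "\<pi> A B = \<pi> A Z" "\<pi> B A = \<pi> B X" "card (SK A B) = n" for A B n
    using that
  proof (induction n arbitrary: A B rule: less_induct)
    case (less n)
    note AB = less.prems(1-7)
    have I: "A \<in> I" "B \<in> I" using rel_I AB by auto
    have ne: "A \<noteq> B" "A \<noteq> Z" "B \<noteq> X" using excl AB bX aZ rX rZ by blast+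
    have repA: "A \<noteq> X \<Longrightarrow> \<not> close \<theta> A X Z" and repB: "B \<noteq> Z \<Longrightarrow> \<not> close \<theta> B X Z"
      using AB(1,2) ne SK_far by (auto simp: relevant_def)
    show ?case
    proof (cases "SK A B = {}")
      case True
      then have adj: "proj_adjacent I G \<pi> K A B" using I ne by (simp add: adjacent_iff)
      define u v where "u = snd (base z)" "v = snd (base x)"
      then have u: "base z = (Z, u)" and v: "base x = (X, v)" by (auto simp: X_def Z_def)
      have q: "gproj A z = Vert (A, vproj A (Z, u))" "vproj A (Z, u) \<in> \<pi> A B"
        using gproj_other[OF I(1) z] vproj_other[OF Z I(1), of u] ne(2) unfolding u AB(6) by auto
      have p: "gproj B x = Vert (B, vproj B (X, v))" "vproj B (X, v) \<in> \<pi> B A"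
        using gproj_other[OF I(2) x] vproj_other[OF X I(2), of v] ne(3) unfolding v AB(7) by auto
      have "cd (gproj A z) (gproj B x) \<le> K" using adjacent_dist[OF adj q(2) p(2)] q(1) p(1) by simp
      moreover have "a B - b A \<le> cd (g (b A)) (g (a B))"
        using geodesic_segmentD(4)[OF g abI(2)[OF AB(1)] abI(1)[OF AB(2)]] by simp
      moreover have "cd (g (b A)) (g (a B)) \<le> cd (g (b A)) (gproj A z) + cd (gproj A z) (gproj B x) + cd (gproj B x) (g (a B))"
        using CK.triangle[OF gM[OF abI(2)[OF AB(1)]] pM(2)[OF I(1)] gM[OF abI(1)[OF AB(2)]]]
          CK.triangle[OF pM(2)[OF I(1)] pM(1)[OF I(2)] gM[OF abI(1)[OF AB(2)]]] by linarith
      ultimately show False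
        using ab[OF AB(1)] ab[OF AB(2)] AB(3,4) CK.commute[of "gproj B x" "g (a B)"] HD
        unfolding before_def after_def by linarith
    next
      case False
      then obtain W where W: "W \<in> SK A B" by blast
      have W': "W \<in> SK B A" using W SK_sym by blast
      note P = SK_P1[OF W I]
      have WXZ: "W \<in> SK X Z" using W AB(5) by blast
      then have Wr: "W \<in> relevant" and WX: "W \<noteq> X" "W \<noteq> Z" by (auto simp: relevant_def SK_def)
      from split[OF Wr] show False
      proof
        assume Wa: "after W"
        have sub: "SK A W \<subset> SK A B" using SK_psubset[OF I W] .
        \<comment> \<open>A separates X from Z and sees W and Z alike, so it separates X from W;
          hence W sees A and X alike.\<close>
        have "\<pi> W A = \<pi> W X"
        proof (cases "A = X")
          case False
          have "\<not> close \<theta> A X W" using repA[OF False] close_cong(1)[of A W Z \<theta> X] P(1) AB(6) by simp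
          from P1(2)[OF this X I(1) P(3)] show ?thesis using False P(4) by auto
        qed simp
        moreover have "\<pi> A W = \<pi> A Z" using P(1) AB(6) by simp
        moreover have "card (SK A W) < n"
          using psubset_card_mono[OF finite_SK[OF I] sub] less.prems(8) by simp
        ultimately show False using less.IH[of _ A W] AB(1,3,5) Wr Wa sub by blast
      next
        assume Wb: "before W"
        have sub: "SK W B \<subset> SK A B" using SK_psubset[OF I(2,1) W'] SK_sym by metis
        have "\<pi> W B = \<pi> W Z"
        proof (cases "B = Z")
          case False
          have "\<not> close \<theta> B W Z" using repB[OF False] close_cong(2)[of B W X \<theta> Z] P(2) AB(7) by simp
          from P1(1)[OF this P(3) I(2) Z] show ?thesis using False P(5) by auto
        qed simp
        moreover have "\<pi> B W = \<pi> B X" using P(2) AB(7) by simp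
        moreover have "card (SK W B) < n"
          using psubset_card_mono[OF finite_SK[OF I] sub] less.prems(8) by simp
        ultimately show False using less.IH[of _ W B] AB(2,4,5) Wr Wb sub by blast
      qed
    qed
  qed
  from this[OF rX rZ bX aZ order_refl HOL.refl HOL.refl HOL.refl] show False .
qed

sublocale guided "gpoints CK" cd I "space_copy G" gproj "16 * real K + 2"
proof
  show "1 \<le> 16 * real K + 2" by simp
  show "cd x (gproj X x) \<le> cd x z + (16 * real K + 2)"
    if "X \<in> I" "x \<in> gpoints CK" "z \<in> gpoints CK" "gproj X x \<noteq> gproj X z" for X x z
    using gproj_jump[OF that] by simp
  show "gproj X p = gproj X q"
    if "X \<in> I" "Y \<in> I" "X \<noteq> Y" "p \<in> space_copy G Y" "q \<in> space_copy G Y" for X Y p q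
    using gproj_const[OF that] .
qed (use proj.geodesic proj.piece_sub proj.piece_geodesic proj.pr_in proj.pr_id guide_point in auto)

section \<open>The three conclusions\<close>

lemma copy_inverse:
  assumes X: "X \<in> I"
  obtains i where "i \<in> space_copy G X \<rightarrow> gpoints (G X)"
    "\<forall>x\<in>space_copy G X. \<forall>y\<in>space_copy G X. gdist (G X) (i x) (i y) = cd x y"
proof
  let ?i = "inv_into (gpoints (G X)) (emb X)"
  show "?i \<in> space_copy G X \<rightarrow> gpoints (G X)" by (auto simp: space_copy_def intro: inv_into_into)
  have "?i x \<in> gpoints (G X)" "emb X (?i x) = x" if "x \<in> space_copy G X" for x
    using that unfolding space_copy_def by (auto intro: inv_into_into f_inv_into_f)
  then show "\<forall>x\<in>space_copy G X. \<forall>y\<in>space_copy G X. gdist (G X) (?i x) (?i y) = cd x y"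
    using emb_isometry[OF X] by metis
qed

theorem quasi_tree_CK:
  fixes C :: real
  assumes "\<And>X. X \<in> I \<Longrightarrow> \<exists>(T :: ('t, 's) mgraph) f. tree_mgraph T \<and>
      quasi_isometry C C (gpoints (G X)) (gdist (G X)) (gpoints T) (gdist T) f"
  shows "quasi_tree (gpoints CK) cd"
proof -
  have s: "3 * H \<ge> 1" "16 * H \<ge> 0" using H_ge by auto
  from quasi_isometric_tree_bottleneck[OF s, of C]
  obtain \<Delta> where \<Delta>: "\<Delta> \<ge> 0"
    "\<forall>(Y :: ('v, 'e) gpoint set) d (T :: ('t, 's) mgraph) f. geodesic_space Y d \<longrightarrow> tree_mgraph T \<longrightarrow>
       quasi_isometry C C Y d (gpoints T) (gdist T) f \<longrightarrow> bottleneck Y d (3 * H) (16 * H) \<Delta>"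
    by blast
  have "bottleneck (space_copy G X) cd (3 * H) (16 * H) \<Delta>" if X: "X \<in> I" for X
  proof -
    interpret X: length_graph "G X" using length_graph_G[OF X] .
    have "bottleneck (gpoints (G X)) (gdist (G X)) (3 * H) (16 * H) \<Delta>"
      using \<Delta>(2) X.geodesic assms[OF X] by blast
    moreover obtain i where "i \<in> space_copy G X \<rightarrow> gpoints (G X)"
      "\<forall>x\<in>space_copy G X. \<forall>y\<in>space_copy G X. gdist (G X) (i x) (i y) = cd x y"
      using copy_inverse[OF X] by blast
    ultimately show ?thesis by (intro bottleneck_isometry[of _ _ _ _ _ i]) auto
  qed
  from bottleneck_pieces[OF this \<Delta>(1)] show ?thesis
    using bottleneck_quasi_tree[OF geodesic] \<Delta>(1) H_ge by simp
qed

theorem hyperbolic_CK: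
  assumes "\<And>X. X \<in> I \<Longrightarrow> delta_hyperbolic \<delta> (gpoints (G X)) (gdist (G X))"
  shows "hyperbolic (gpoints CK) cd"
proof -
  \<comment> \<open>If I is empty, the hypothesis does not tell that \<delta> is nonnegative, hence
    the maximum.\<close>
  have "delta_hyperbolic (max 0 \<delta>) (space_copy G X) cd" if X: "X \<in> I" for X
  proof -
    have \<delta>: "max 0 \<delta> = \<delta>" using assms[OF X] by (simp add: delta_hyperbolic_def)
    obtain i where "i \<in> space_copy G X \<rightarrow> gpoints (G X)"
      "\<forall>x\<in>space_copy G X. \<forall>y\<in>space_copy G X. gdist (G X) (i x) (i y) = cd x y"
      using copy_inverse[OF X] by blast
    then show ?thesis
      unfolding \<delta> by (intro delta_hyperbolic_isometry[OF assms[OF X] _ _ copy_geodesic[OF X]]) auto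
  qed
  from hyperbolic_pieces[OF this] show ?thesis by (auto simp: hyperbolic_def)
qed

end

theorem corollary6p8:
  fixes I :: "'i set"
    and G :: "'i \<Rightarrow> ('v, 'e) mgraph"
    and \<pi> :: "'i \<Rightarrow> 'i \<Rightarrow> 'v set"
    and \<theta> K :: nat
  defines "CK \<equiv> quasi_tree_of_spaces I G \<pi> K"
  assumes graphs: "\<And>X. X \<in> I \<Longrightarrow> wf_mgraph (G X) \<and> unit_mgraph (G X) \<and> connected_mgraph (G X)"
    and proj: "\<And>X Y. X \<in> I \<Longrightarrow> Y \<in> I \<Longrightarrow> X \<noteq> Y \<Longrightarrow> \<pi> Y X \<noteq> {} \<and> \<pi> Y X \<subseteq> mverts (G Y)"
    and diam: "\<And>X Y. X \<in> I \<Longrightarrow> Y \<in> I \<Longrightarrow> X \<noteq> Y \<Longrightarrow> proj_dist G \<pi> Y X X \<le> ereal (real \<theta>)"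
    and P1': "\<And>X Y Z. X \<in> I \<Longrightarrow> Y \<in> I \<Longrightarrow> Z \<in> I \<Longrightarrow> X \<noteq> Y \<Longrightarrow> Y \<noteq> Z \<Longrightarrow> X \<noteq> Z \<Longrightarrow>
                proj_dist G \<pi> Y X Z > ereal (real \<theta>) \<Longrightarrow> \<pi> X Y = \<pi> X Z"
    and fin: "\<And>X Z. X \<in> I \<Longrightarrow> Z \<in> I \<Longrightarrow>
                finite {Y \<in> I - {X, Z}. proj_dist G \<pi> Y X Z > ereal (real \<theta>)}"
    and K: "K > 0" "K \<ge> 4 * \<theta>"
  shows "((\<exists>C. \<forall>X\<in>I. \<exists>(T :: ('t, 's) mgraph) f.
              tree_mgraph T \<and>
              quasi_isometry C C (gpoints (G X)) (gdist (G X)) (gpoints T) (gdist T) f)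
            \<longrightarrow> quasi_tree (gpoints CK) (gdist CK)) \<and>
         ((\<exists>\<delta>. \<forall>X\<in>I. delta_hyperbolic \<delta> (gpoints (G X)) (gdist (G X)))
            \<longrightarrow> hyperbolic (gpoints CK) (gdist CK)) \<and>
         asymptotically_tree_graded (gpoints CK) (gdist CK) (space_copy G ` I)"
proof -
  interpret projection_complex I G \<pi> \<theta> K
    using assms(2-) by unfold_locales
  show ?thesis
    unfolding CK_def
  proof (intro conjI impI)
    assume "\<exists>C. \<forall>X\<in>I. \<exists>(T :: ('t, 's) mgraph) f. tree_mgraph T \<and>
      quasi_isometry C C (gpoints (G X)) (gdist (G X)) (gpoints T) (gdist T) f"
    then show "quasi_tree (gpoints (quasi_tree_of_spaces I G \<pi> K)) (gdist (quasi_tree_of_spaces I G \<pi> K))"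
      using quasi_tree_CK by blast
  next
    assume "\<exists>\<delta>. \<forall>X\<in>I. delta_hyperbolic \<delta> (gpoints (G X)) (gdist (G X))"
    then show "hyperbolic (gpoints (quasi_tree_of_spaces I G \<pi> K)) (gdist (quasi_tree_of_spaces I G \<pi> K))"
      using hyperbolic_CK by blast
  qed (rule asymptotically_tree_graded_pieces)
qed

end
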